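(* Let $R\in\mathcal{E}^d_M(\Omega)$. Then $R\in\mathcal{N}^d(\Omega)$ if and only if for every compact $K\subset\Omega$, every $\alpha\in\mathbb{N}_0^s$ and every $n\in\mathbb{N}$ there exists $q\in\mathbb{N}$ such that for every $\phi\in C^\infty_b((0,1]\times\Omega,\mathcal{A}_0(\mathbb{R}^s))$ of type $[A_l^\infty]_{K,q}$: $$\sup_{x\in K}\big|\partial_x^\alpha\big(R(S_\varepsilon\phi(\varepsilon,x),x)\big)\big|=O(\varepsilon^n)\quad(\varepsilon\to0).$$
   Context: Fix $s\ge1$ and an open set $\Omega\subseteq\mathbb{R}^s$. $\mathcal{D}(\mathbb{R}^s)$ is the space of compactly supported smooth complex functions with its usual (LF) topology. Define $\mathcal{A}_0(\mathbb{R}^s)=\{\varphi\in\mathcal{D}(\mathbb{R}^s):\int\varphi(\xi)\,d\xi=1\}$ and for $q\in\mathbb{N}$, $\mathcal{A}_q(\mathbb{R}^s)=\{\varphi\in\mathcal{A}_0(\mathbb{R}^s):\int\xi^\beta\varphi(\xi)\,d\xi=0\text{ for }1\le|\beta|\le q\}$. Let $U(\Omega)=\{(\varphi,x)\in\mathcal{A}_0(\mathbb{R}^s)\times\Omega:\ \mathrm{supp}\,\varphi\subseteq\Omega-x\}$, and $\mathcal{E}^d(\Omega)=C^\infty(U(\Omega))$, the complex-valued functions on $U(\Omega)$ smooth in the sense of convenient calculus (Kriegl–Michor), $U(\Omega)$ viewed as a subset of the affine space $\mathcal{A}_0(\mathbb{R}^s)\times\mathbb{R}^s$. For $\varepsilon>0$,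 $(S_\varepsilon\varphi)(\xi)=\varepsilon^{-s}\varphi(\xi/\varepsilon)$. $C^\infty_b((0,1]\times\Omega,\mathcal{A}_q(\mathbb{R}^s))$ ($q\in\mathbb{N}_0$) is the set of smooth maps $\phi:(0,1]\times\Omega\to\mathcal{A}_q(\mathbb{R}^s)$ such that for every compact $K\subset\Omega$ and every $\alpha$, $\{\partial_x^\alpha\phi(\varepsilon,x):\varepsilon\in(0,1],x\in K\}$ is bounded in $\mathcal{D}(\mathbb{R}^s)$; for such $\phi$ and compact $K$, $(S_\varepsilon\phi(\varepsilon,x),x)\in U(\Omega)$ for $x\in K$ and all small $\varepsilon$. $\partial_x^\alpha$ acts on the function $x\mapsto R(S_\varepsilon\phi(\varepsilon,x),x)$. $R\in\mathcal{E}^d(\Omega)$ is moderate ($R\in\mathcal{E}^d_M(\Omega)$) if for every compact $K\subset\Omega$ and $\alpha\in\mathbb{N}_0^s$ there is $N$ such that for all $\phi\in C^\infty_b((0,1]\times\Omega,\mathcal{A}_0(\mathbb{R}^s))$: $\sup_{x\in K}|\partial_x^\alpha(R(S_\varepsilon\phi(\varepsilon,x),x))|=O(\varepsilon^{-N})$. $R\in\mathcal{E}^d_M(\Omega)$ is negligible ($R\in\mathcal{N}^d(\Omega)$) if for every compact $K\subset\Omega$, $\alpha\in\mathbb{N}_0^s$, $n\in\mathbb{N}$ there is $q\in\mathbb{N}$ such that for all $\phi\in C^\infty_b((0,1]\times\Omega,\mathcal{A}_q(\mathbb{R}^s))$: $\sup_{x\in K}|\partial_x^\alpha(R(S_\varepsilon\phi(\varepsilon,x),x))|=O(\varepsilon^{n})$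 as $\varepsilon\to0$. A map $\phi\in C^\infty_b((0,1]\times\Omega,\mathcal{A}_0(\mathbb{R}^s))$ is of type $[A_l^\infty]_{K,q}$ (for compact $K\subset\Omega$, $q\in\mathbb{N}$) if for all $\beta\in\mathbb{N}_0^s$ with $1\le|\beta|\le q$ and all $\gamma\in\mathbb{N}_0^s$: $\sup_{x\in K}\big|\int\xi^\beta\,\partial_x^\gamma\phi(\varepsilon,x)(\xi)\,d\xi\big|=O(\varepsilon^q)$ as $\varepsilon\to0$. *)

theory Defs
  imports "HOL-Analysis.Analysis" "HOL-Library.Multiset"
begin

text \<open>R^s is modelled by a Euclidean space 'a (s = DIM('a)).
 Multi-indices beta in N_0^s are multisets of basis vectors; |beta| = size beta.\<close>

definition multi_index :: "'a::euclidean_space multiset \<Rightarrow> bool" where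
  "multi_index \<beta> \<longleftrightarrow> set_mset \<beta> \<subseteq> Basis"

definition pdiff :: "'a::euclidean_space \<Rightarrow> ('a \<Rightarrow> 'b::real_normed_vector) \<Rightarrow> 'a \<Rightarrow> 'b" where
  "pdiff b f x = vector_derivative (\<lambda>t. f (x + t *\<^sub>R b)) (at 0)"

fun Dlist :: "'a::euclidean_space list \<Rightarrow> ('a \<Rightarrow> 'b::real_normed_vector) \<Rightarrow> 'a \<Rightarrow> 'b" where
  "Dlist [] f = f"
| "Dlist (b # ds) f = pdiff b (Dlist ds f)"

text \<open>partial^alpha (for smooth functions the order of differentiation is irrelevant)\<close>
definition mdiff :: "'a::euclidean_space multiset \<Rightarrow> ('a \<Rightarrow> 'b::real_normed_vector) \<Rightarrow> 'a \<Rightarrow> 'b" where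
  "mdiff \<alpha> f = Dlist (SOME ds. mset ds = \<alpha>) f"

definition monom :: "'a::euclidean_space multiset \<Rightarrow> 'a \<Rightarrow> complex" where
  "monom \<beta> \<xi> = (\<Prod>b\<in>#\<beta>. complex_of_real (\<xi> \<bullet> b))"

definition smooth_on :: "'a::euclidean_space set \<Rightarrow> ('a \<Rightarrow> 'b::real_normed_vector) \<Rightarrow> bool" where
  "smooth_on S f \<longleftrightarrow> (\<forall>ds. set ds \<subseteq> Basis \<longrightarrow>
      continuous_on S (Dlist ds f) \<and>
      (\<forall>b\<in>Basis. \<forall>x\<in>S. (\<lambda>t. Dlist ds f (x + t *\<^sub>R b)) differentiable (at 0)))"

definition tsupp :: "('a::euclidean_space \<Rightarrow> complex) \<Rightarrow> 'a set" where
  "tsupp \<phi> = closure {\<xi>. \<phi> \<xi> \<noteq> 0}"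

definition test_fun :: "('a::euclidean_space \<Rightarrow> complex) set" where
  "test_fun = {\<phi>. smooth_on UNIV \<phi> \<and> compact (tsupp \<phi>)}"

definition A :: "nat \<Rightarrow> ('a::euclidean_space \<Rightarrow> complex) set" where
  "A q = {\<phi> \<in> test_fun. integral UNIV \<phi> = 1 \<and>
      (\<forall>\<beta>. multi_index \<beta> \<and> 1 \<le> size \<beta> \<and> size \<beta> \<le> q \<longrightarrow>
          integral UNIV (\<lambda>\<xi>. monom \<beta> \<xi> * \<phi> \<xi>) = 0)}"

definition U :: "'a::euclidean_space set \<Rightarrow> (('a \<Rightarrow> complex) \<times> 'a) set" where
  "U \<Omega> = {(\<phi>, x). \<phi> \<in> A 0 \<and> x \<in> \<Omega> \<and> tsupp \<phi> \<subseteq> {y - x |y. y \<in> \<Omega>}}"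

definition D_bounded :: "('a::euclidean_space \<Rightarrow> complex) set \<Rightarrow> bool" where
  "D_bounded B \<longleftrightarrow> B \<subseteq> test_fun \<and> (\<exists>K. compact K \<and> (\<forall>f\<in>B. tsupp f \<subseteq> K)) \<and>
      (\<forall>ds. set ds \<subseteq> Basis \<longrightarrow> (\<exists>C. \<forall>f\<in>B. \<forall>\<xi>. norm (Dlist ds f \<xi>) \<le> C))"

text \<open>Convergence in the (LF) topology of D(R^s) along a countably generated filter:
  eventually supports in a fixed compact K, and uniform convergence of all derivatives.\<close>
definition D_tendsto :: "('b \<Rightarrow> ('a::euclidean_space \<Rightarrow> complex)) \<Rightarrow> ('a \<Rightarrow> complex) \<Rightarrow> 'b filter \<Rightarrow> bool" where
  "D_tendsto g L F \<longleftrightarrow> L \<in> test_fun \<and>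
     (\<exists>K. compact K \<and> (\<forall>\<^sub>F h in F. tsupp (g h) \<subseteq> K)) \<and>
     (\<forall>ds. set ds \<subseteq> Basis \<longrightarrow> uniform_limit UNIV (\<lambda>h. Dlist ds (g h)) (Dlist ds L) F)"

definition smooth_D_curve :: "(real \<Rightarrow> ('a::euclidean_space \<Rightarrow> complex)) \<Rightarrow> bool" where
  "smooth_D_curve c \<longleftrightarrow> (\<exists>cs :: nat \<Rightarrow> real \<Rightarrow> ('a \<Rightarrow> complex). cs 0 = c \<and>
     (\<forall>n t. cs n t \<in> test_fun \<and>
        D_tendsto (\<lambda>h. (\<lambda>\<xi>. (cs n (t + h) \<xi> - cs n t \<xi>) / complex_of_real h)) (cs (Suc n) t) (at 0)))"

definition smooth_curve :: "(real \<Rightarrow> 'b::real_normed_vector) \<Rightarrow> bool" where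
  "smooth_curve c \<longleftrightarrow> (\<exists>cs :: nat \<Rightarrow> real \<Rightarrow> 'b. cs 0 = c \<and>
     (\<forall>n t. (cs n has_vector_derivative cs (Suc n) t) (at t)))"

text \<open>E^d(Omega) = C^infinity(U(Omega)) in the convenient sense: smooth curves into U(Omega)
  (a subset of the affine space A_0 x R^s) are mapped to smooth curves.\<close>
definition Ed :: "'a::euclidean_space set \<Rightarrow> (('a \<Rightarrow> complex) \<Rightarrow> 'a \<Rightarrow> complex) set" where
  "Ed \<Omega> = {R. \<forall>c \<gamma>. smooth_D_curve c \<and> smooth_curve \<gamma> \<and> (\<forall>t. (c t, \<gamma> t) \<in> U \<Omega>)
                 \<longrightarrow> smooth_curve (\<lambda>t. R (c t) (\<gamma> t))}"

definition Seps :: "real \<Rightarrow> ('a::euclidean_space \<Rightarrow> complex) \<Rightarrow> 'a \<Rightarrow> complex" where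
  "Seps \<epsilon> \<phi> = (\<lambda>\<xi>. complex_of_real (inverse \<epsilon> ^ DIM('a)) * \<phi> (inverse \<epsilon> *\<^sub>R \<xi>))"

definition xdiff :: "'a::euclidean_space multiset \<Rightarrow> (real \<Rightarrow> 'a \<Rightarrow> ('a \<Rightarrow> complex)) \<Rightarrow> real \<Rightarrow> 'a \<Rightarrow> ('a \<Rightarrow> complex)" where
  "xdiff \<alpha> \<phi> \<epsilon> x = (\<lambda>\<xi>. mdiff \<alpha> (\<lambda>y. \<phi> \<epsilon> y \<xi>) x)"

definition Cb :: "'a::euclidean_space set \<Rightarrow> nat \<Rightarrow> (real \<Rightarrow> 'a \<Rightarrow> ('a \<Rightarrow> complex)) set" where
  "Cb \<Omega> q = {\<phi>.
     (\<forall>\<epsilon>\<in>{0<..1}. \<forall>x\<in>\<Omega>. \<phi> \<epsilon> x \<in> A q) \<and>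
     (\<forall>e y. smooth_curve e \<and> smooth_curve y \<and> (\<forall>t. e t \<in> {0<..1} \<and> y t \<in> \<Omega>)
            \<longrightarrow> smooth_D_curve (\<lambda>t. \<phi> (e t) (y t))) \<and>
     (\<forall>K \<alpha>. compact K \<and> K \<subseteq> \<Omega> \<and> multi_index \<alpha> \<longrightarrow>
            D_bounded {xdiff \<alpha> \<phi> \<epsilon> x |\<epsilon> x. \<epsilon> \<in> {0<..1} \<and> x \<in> K})}"

definition Rphi :: "(('a::euclidean_space \<Rightarrow> complex) \<Rightarrow> 'a \<Rightarrow> complex) \<Rightarrow> 'a multiset \<Rightarrow>
     (real \<Rightarrow> 'a \<Rightarrow> ('a \<Rightarrow> complex)) \<Rightarrow> real \<Rightarrow> 'a \<Rightarrow> complex" where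
  "Rphi R \<alpha> \<phi> \<epsilon> x = mdiff \<alpha> (\<lambda>y. R (Seps \<epsilon> (\<phi> \<epsilon> y)) y) x"

definition moderate :: "'a::euclidean_space set \<Rightarrow> (('a \<Rightarrow> complex) \<Rightarrow> 'a \<Rightarrow> complex) set" where
  "moderate \<Omega> = {R \<in> Ed \<Omega>. \<forall>K \<alpha>. compact K \<and> K \<subseteq> \<Omega> \<and> multi_index \<alpha> \<longrightarrow>
     (\<exists>N::nat. \<forall>\<phi>\<in>Cb \<Omega> 0. \<exists>C. \<forall>\<^sub>F \<epsilon> in at_right 0.
         \<forall>x\<in>K. norm (Rphi R \<alpha> \<phi> \<epsilon> x) \<le> C * inverse \<epsilon> ^ N)}"

definition negligible :: "'a::euclidean_space set \<Rightarrow> (('a \<Rightarrow> complex) \<Rightarrow> 'a \<Rightarrow> complex) set" where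
  "negligible \<Omega> = {R \<in> moderate \<Omega>. \<forall>K \<alpha> (n::nat). compact K \<and> K \<subseteq> \<Omega> \<and> multi_index \<alpha> \<and> n \<ge> 1 \<longrightarrow>
     (\<exists>q::nat. q \<ge> 1 \<and> (\<forall>\<phi>\<in>Cb \<Omega> q. \<exists>C. \<forall>\<^sub>F \<epsilon> in at_right 0.
         \<forall>x\<in>K. norm (Rphi R \<alpha> \<phi> \<epsilon> x) \<le> C * \<epsilon> ^ n))}"

definition typeA :: "'a::euclidean_space set \<Rightarrow> 'a set \<Rightarrow> nat \<Rightarrow> (real \<Rightarrow> 'a \<Rightarrow> ('a \<Rightarrow> complex)) \<Rightarrow> bool" where
  "typeA \<Omega> K q \<phi> \<longleftrightarrow> \<phi> \<in> Cb \<Omega> 0 \<and>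
     (\<forall>\<beta> \<gamma>. multi_index \<beta> \<and> 1 \<le> size \<beta> \<and> size \<beta> \<le> q \<and> multi_index \<gamma> \<longrightarrow>
        (\<exists>C. \<forall>\<^sub>F \<epsilon> in at_right 0. \<forall>x\<in>K.
            norm (integral UNIV (\<lambda>\<xi>. monom \<beta> \<xi> * xdiff \<gamma> \<phi> \<epsilon> x \<xi>)) \<le> C * \<epsilon> ^ q))"

end

theory Submission
  imports Defs
begin

text \<open>Functions that are smooth along smooth curves in an open subset of \<open>\<real>\<^sup>s\<close> are smooth (Boman), so all
  derivatives in the statement exist and commute. A family in \<open>A\<^sub>q\<close> has vanishing moments, which
  gives one direction. Conversely, let \<open>m\<^sub>\<beta>\<close> be the moments of \<open>\<phi>\<close> of type \<open>[A\<^sub>l\<^sup>\<infinity>]\<close> and subtract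
  \<open>m\<^sub>\<beta> \<psi>\<^sub>\<beta>\<close> with a dual basis \<open>\<psi>\<^sub>\<beta>\<close> of test functions to get a family in \<open>A\<^sub>q\<close>. All derivatives of
  \<open>m\<^sub>\<beta>\<close> are \<open>O(\<epsilon>\<^sup>q)\<close> on \<open>K\<close>, hence on neighbourhoods of \<open>K\<close> of size \<open>\<epsilon>\<close>. To compare the values of \<open>R\<close>
  on the two families at a point \<open>x\<close>, let the moments decrease linearly from \<open>m\<^sub>\<beta>(x)\<close> to \<open>0\<close> along a segment
  whose length is a power of \<open>\<epsilon>\<close>: this is again an admissible family, moderateness bounds the variation
  of \<open>R\<close> on the segment, and negligibility bounds the value at its end. No differentials of \<open>R\<close> in
  the first variable are needed. Derivatives in \<open>x\<close> then follow from difference quotients.\<close>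

section \<open>Smooth curves\<close>

text \<open>The obstacle is uniformity. Moderateness and negligibility fix the exponents
  \<open>N\<close> and \<open>q\<close> for all families at once, but the constants \<open>C\<close>
  depend on the family, and the definitions speak of whole families in \<open>Cb\<close>, never of a
  single test function. Hence the segments at all scales and points must belong to one family: the
  estimate is assumed to fail along a sequence of scales, and smooth functions of
  \<open>inverse \<epsilon>\<close> interpolate the coefficients found there. Such coefficients only
  have to be bounded, because membership in \<open>Cb\<close> bounds no derivative in \<epsilon>. As
  \<open>N\<close> is known before the family is built, the length of the segments can be fixed in
  advance, and with it \<open>q\<close>. Points outside K matter because the difference quotients
  for derivatives at K leave K. Boman's theorem enters because \<open>Ed\<close> supplies smoothness
  along curves only, while \<open>mdiff\<close> differentiates partially in an unspecified
  order.\<close>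

inductive_set sums_of :: "('c \<Rightarrow> 'b::real_normed_vector) set \<Rightarrow> ('c \<Rightarrow> 'b) set" for X where
  base: "f \<in> X \<Longrightarrow> f \<in> sums_of X"
| add: "f \<in> sums_of X \<Longrightarrow> g \<in> sums_of X \<Longrightarrow> (\<lambda>t. f t + g t) \<in> sums_of X"

text \<open>A choice function \<open>d\<close> of derivatives maps \<open>X\<close> into itself, so
  its iterates at \<open>f\<close> are the sequence that \<open>smooth_curve\<close> asks for.
  Smoothness thus reduces to finding an invariant set of functions.\<close>

lemma smooth_curve_coinduct:
  assumes f: "f \<in> X"
    and step: "\<And>g. g \<in> X \<Longrightarrow> \<exists>g'\<in>X. \<forall>t. (g has_vector_derivative g' t) (at t)"
  shows "smooth_curve f"
proof -
  obtain d where d: "\<And>g. g \<in> X \<Longrightarrow> d g \<in> X \<and> (\<forall>t. (g has_vector_derivative d g t) (at t))"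
    using step by metis
  have "(d ^^ n) f \<in> X" for n
    by (induction n) (use f d in auto)
  then show ?thesis
    unfolding smooth_curve_def
    by (intro exI[of _ "\<lambda>n. (d ^^ n) f"]) (use d in auto)
qed

text \<open>Product and chain rules produce sums of terms of the same shape. Closing under sums
  afterwards lets the invariant set be described by a single term.\<close>

lemma smooth_curve_coinduct_sums:
  assumes f: "f \<in> X"
    and step: "\<And>g. g \<in> X \<Longrightarrow> \<exists>g'\<in>sums_of X. \<forall>t. (g has_vector_derivative g' t) (at t)"
  shows "smooth_curve f"
proof (rule smooth_curve_coinduct[where X = "sums_of X"])
  show "f \<in> sums_of X" using f by (rule sums_of.base)
  fix g assume "g \<in> sums_of X"
  then show "\<exists>g'\<in>sums_of X. \<forall>t. (g has_vector_derivative g' t) (at t)"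
  proof induction
    case (base f) then show ?case using step by auto
  next
    case (add f g)
    then obtain f' g' where "f' \<in> sums_of X" "\<forall>t. (f has_vector_derivative f' t) (at t)"
      "g' \<in> sums_of X" "\<forall>t. (g has_vector_derivative g' t) (at t)" by blast
    then show ?case
      by (intro bexI[of _ "\<lambda>t. f' t + g' t"]) (auto intro: sums_of.add has_vector_derivative_add)
  qed
qed

lemma smooth_curve_derivative:
  assumes "smooth_curve c"
  shows "\<exists>c'. smooth_curve c' \<and> (\<forall>t. (c has_vector_derivative c' t) (at t))"
proof -
  obtain cs where cs: "cs 0 = c" "\<And>n t. (cs n has_vector_derivative cs (Suc n) t) (at t)"
    using assms unfolding smooth_curve_def by auto
  have "smooth_curve (cs 1)"
    unfolding smooth_curve_def by (rule exI[of _ "\<lambda>n. cs (Suc n)"]) (use cs in auto)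
  then show ?thesis using cs(2)[of 0] cs(1) by auto
qed

lemma smooth_curve_continuous:
  assumes "smooth_curve c" shows "continuous_on S c"
proof -
  obtain c' where "\<And>t. (c has_vector_derivative c' t) (at t)"
    using smooth_curve_derivative[OF assms] by blast
  then have "isCont c t" for t by (rule has_vector_derivative_continuous)
  then show ?thesis by (simp add: continuous_at_imp_continuous_on)
qed

lemma smooth_curve_const [simp]: "smooth_curve (\<lambda>t. k)"
  by (rule smooth_curve_coinduct[where X = "{\<lambda>t. k, \<lambda>t. 0}"])
     (auto intro!: derivative_eq_intros)

lemma smooth_curve_ident [simp]: "smooth_curve (\<lambda>t. t)"
  by (rule smooth_curve_coinduct[where X = "{\<lambda>t. t, \<lambda>t. 1, \<lambda>t. 0}"])
     (auto intro!: derivative_eq_intros)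

lemma smooth_curve_add:
  assumes "smooth_curve f" "smooth_curve g" shows "smooth_curve (\<lambda>t. f t + g t)"
proof (rule smooth_curve_coinduct[where X = "sums_of {f. smooth_curve f}"])
  show "(\<lambda>t. f t + g t) \<in> sums_of {f. smooth_curve f}"
    using assms by (auto intro: sums_of.intros)
  fix h :: "real \<Rightarrow> 'a" assume "h \<in> sums_of {f. smooth_curve f}"
  then show "\<exists>g'\<in>sums_of {f. smooth_curve f}. \<forall>t. (h has_vector_derivative g' t) (at t)"
  proof induction
    case (base f)
    then obtain f' where "smooth_curve f'" "\<forall>t. (f has_vector_derivative f' t) (at t)"
      using smooth_curve_derivative by blast
    then show ?case by (intro bexI[of _ f'] sums_of.base) auto
  next
    case (add f g)
    then obtain f' g' where "f' \<in> sums_of {f. smooth_curve f}" "\<forall>t. (f has_vector_derivative f' t) (at t)"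
      "g' \<in> sums_of {f. smooth_curve f}" "\<forall>t. (g has_vector_derivative g' t) (at t)" by blast
    then show ?case
      by (intro bexI[of _ "\<lambda>t. f' t + g' t"]) (auto intro: sums_of.add has_vector_derivative_add)
  qed
qed

lemma smooth_curve_bilinear:
  assumes "bounded_bilinear B" "smooth_curve f" "smooth_curve g"
  shows "smooth_curve (\<lambda>t. B (f t) (g t))"
proof (rule smooth_curve_coinduct_sums
    [where X = "{\<lambda>t. B (f t) (g t) |f g. smooth_curve f \<and> smooth_curve g}"])
  show "(\<lambda>t. B (f t) (g t)) \<in> {\<lambda>t. B (f t) (g t) |f g. smooth_curve f \<and> smooth_curve g}"
    using assms by auto
  fix h assume "h \<in> {\<lambda>t. B (f t) (g t) |f g. smooth_curve f \<and> smooth_curve g}"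
  then obtain f g where h: "h = (\<lambda>t. B (f t) (g t))" "smooth_curve f" "smooth_curve g" by auto
  obtain f' where f': "smooth_curve f'" "\<And>t. (f has_vector_derivative f' t) (at t)"
    using smooth_curve_derivative[OF h(2)] by blast
  obtain g' where g': "smooth_curve g'" "\<And>t. (g has_vector_derivative g' t) (at t)"
    using smooth_curve_derivative[OF h(3)] by blast
  have "(\<lambda>t. B (f t) (g' t)) \<in> {\<lambda>t. B (f t) (g t) |f g. smooth_curve f \<and> smooth_curve g}"
    "(\<lambda>t. B (f' t) (g t)) \<in> {\<lambda>t. B (f t) (g t) |f g. smooth_curve f \<and> smooth_curve g}"
    using h f' g' by blast+
  then have "(\<lambda>t. B (f t) (g' t) + B (f' t) (g t)) \<in> sums_of {\<lambda>t. B (f t) (g t) |f g. smooth_curve f \<and> smooth_curve g}"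
    by (intro sums_of.add sums_of.base)
  moreover have "(h has_vector_derivative B (f t) (g' t) + B (f' t) (g t)) (at t)" for t
    unfolding h(1) by (rule bounded_bilinear.has_vector_derivative[OF assms(1) f'(2) g'(2)])
  ultimately show "\<exists>h'\<in>sums_of {\<lambda>t. B (f t) (g t) |f g. smooth_curve f \<and> smooth_curve g}.
      \<forall>t. (h has_vector_derivative h' t) (at t)"
    by (intro bexI[of _ "\<lambda>t. B (f t) (g' t) + B (f' t) (g t)"]) auto
qed

lemmas smooth_curve_scaleR = smooth_curve_bilinear[OF bounded_bilinear_scaleR]
lemmas smooth_curve_mult = smooth_curve_bilinear[OF bounded_bilinear_mult]

lemma smooth_curve_linear:
  assumes "bounded_linear L" "smooth_curve f"
  shows "smooth_curve (\<lambda>t. L (f t))"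
proof (rule smooth_curve_coinduct[where X = "{\<lambda>t. L (f t) |f. smooth_curve f}"])
  show "(\<lambda>t. L (f t)) \<in> {\<lambda>t. L (f t) |f. smooth_curve f}" using assms by auto
  fix h assume "h \<in> {\<lambda>t. L (f t) |f. smooth_curve f}"
  then obtain f where h: "h = (\<lambda>t. L (f t))" "smooth_curve f" by auto
  obtain f' where f': "smooth_curve f'" "\<And>t. (f has_vector_derivative f' t) (at t)"
    using smooth_curve_derivative[OF h(2)] by blast
  show "\<exists>h'\<in>{\<lambda>t. L (f t) |f. smooth_curve f}. \<forall>t. (h has_vector_derivative h' t) (at t)"
    by (rule bexI[of _ "\<lambda>t. L (f' t)"])
      (use h f' in \<open>auto intro!: bounded_linear.has_vector_derivative[OF assms(1)]\<close>)
qed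

lemma smooth_curve_diff:
  assumes "smooth_curve f" "smooth_curve g" shows "smooth_curve (\<lambda>t. f t - g t)"
  using smooth_curve_add[OF assms(1) smooth_curve_linear[OF bounded_linear_minus[OF bounded_linear_ident] assms(2)]]
  by simp

lemma smooth_curve_sum:
  assumes "\<And>i. i \<in> I \<Longrightarrow> smooth_curve (f i)"
  shows "smooth_curve (\<lambda>t. \<Sum>i\<in>I. f i t)"
  using assms by (induction I rule: infinite_finite_induct) (auto intro: smooth_curve_add)

lemma smooth_curve_prod:
  fixes f :: "'i \<Rightarrow> real \<Rightarrow> 'a::{real_normed_field}"
  assumes "\<And>i. i \<in> I \<Longrightarrow> smooth_curve (f i)"
  shows "smooth_curve (\<lambda>t. \<Prod>i\<in>I. f i t)"
  using assms by (induction I rule: infinite_finite_induct) (auto intro: smooth_curve_mult)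

lemma smooth_curve_compose:
  assumes "smooth_curve g" "smooth_curve e"
  shows "smooth_curve (\<lambda>t. g (e t))"
proof -
  \<comment> \<open>The chain rule contributes a factor \<open>e'\<close>, which the coefficient
    \<open>h\<close> absorbs.\<close>
  define X where "X = {\<lambda>t. h t *\<^sub>R g (e t) |h (g::real\<Rightarrow>'a). smooth_curve h \<and> smooth_curve g}"
  obtain e' where e': "smooth_curve e'" "\<And>t. (e has_vector_derivative e' t) (at t)"
    using smooth_curve_derivative[OF assms(2)] by blast
  have "smooth_curve f" if "f \<in> X" for f
  proof (rule smooth_curve_coinduct_sums[OF that])
    fix k assume "k \<in> X"
    then obtain h g where k: "k = (\<lambda>t. h t *\<^sub>R g (e t))" "smooth_curve h" "smooth_curve g"
      by (auto simp: X_def)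
    obtain h' where h': "smooth_curve h'" "\<And>t. (h has_vector_derivative h' t) (at t)"
      using smooth_curve_derivative[OF k(2)] by blast
    obtain g' where g': "smooth_curve g'" "\<And>t. (g has_vector_derivative g' t) (at t)"
      using smooth_curve_derivative[OF k(3)] by blast
    have "((\<lambda>t. g (e t)) has_vector_derivative e' t *\<^sub>R g' (e t)) (at t)" for t
      using vector_diff_chain_at[OF e'(2) g'(2)] by (simp add: o_def)
    moreover have "(h has_real_derivative h' t) (at t)" for t
      using h' by (simp add: has_real_derivative_iff_has_vector_derivative)
    ultimately have "(k has_vector_derivative h t *\<^sub>R (e' t *\<^sub>R g' (e t)) + h' t *\<^sub>R g (e t)) (at t)" for t
      unfolding k(1) by (intro has_vector_derivative_scaleR)
    moreover have "(\<lambda>t. (h t * e' t) *\<^sub>R g' (e t)) \<in> X" "(\<lambda>t. h' t *\<^sub>R g (e t)) \<in> X"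
      using h' g' e' k smooth_curve_mult[of h e'] by (auto simp: X_def)
    ultimately show "\<exists>k'\<in>sums_of X. \<forall>t. (k has_vector_derivative k' t) (at t)"
      by (intro bexI[of _ "\<lambda>t. (h t * e' t) *\<^sub>R g' (e t) + h' t *\<^sub>R g (e t)"])
        (auto intro: sums_of.intros)
  qed
  moreover have "(\<lambda>t. 1 *\<^sub>R g (e t)) \<in> X"
    unfolding X_def using assms by (intro CollectI exI[of _ "\<lambda>_. 1"] exI[of _ g]) auto
  ultimately show ?thesis by fastforce
qed

lemma smooth_curve_affine:
  "smooth_curve g \<Longrightarrow> smooth_curve (\<lambda>t. g (a * t + b))"
  by (rule smooth_curve_compose[of g "\<lambda>t. a * t + b"]) (simp_all add: smooth_curve_add smooth_curve_mult)

lemma smooth_curve_inverse: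
  fixes e :: "real \<Rightarrow> real"
  assumes "smooth_curve e" and pos: "\<And>t. e t \<noteq> 0"
  shows "smooth_curve (\<lambda>t. inverse (e t))"
proof -
  \<comment> \<open>Differentiating \<open>inverse (e t) ^ j\<close> raises the exponent to
    \<open>Suc j\<close>; the factors \<open>j\<close> and \<open>e'\<close> go into
    \<open>h\<close>.\<close>
  define X where "X = {\<lambda>t. h t * inverse (e t) ^ j |h j. smooth_curve h}"
  obtain e' where e': "smooth_curve e'" "\<And>t. (e has_vector_derivative e' t) (at t)"
    using smooth_curve_derivative[OF assms(1)] by blast
  have "smooth_curve f" if "f \<in> X" for f
  proof (rule smooth_curve_coinduct_sums[OF that])
    fix k assume "k \<in> X"
    then obtain h j where k: "k = (\<lambda>t. h t * inverse (e t) ^ j)" "smooth_curve h"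
      by (auto simp: X_def)
    obtain h' where h': "smooth_curve h'" "\<And>t. (h has_vector_derivative h' t) (at t)"
      using smooth_curve_derivative[OF k(2)] by blast
    have hd [derivative_intros]: "(h has_real_derivative h' t) (at t)" "(e has_real_derivative e' t) (at t)" for t
      using h' e' by (simp_all add: has_real_derivative_iff_has_vector_derivative)
    have "(k has_real_derivative h' t * inverse (e t) ^ j + (- (real j) * h t * e' t) * inverse (e t) ^ Suc j) (at t)" for t
    proof -
      have "((\<lambda>t. inverse (e t) ^ j) has_real_derivative
          real j * (inverse (e t) ^ (j - 1) * - (inverse (e t) * e' t * inverse (e t)))) (at t)"
        using pos[of t] by (auto intro!: derivative_eq_intros)
      then have "((\<lambda>t. inverse (e t) ^ j) has_real_derivative - (real j * e' t * inverse (e t) ^ Suc j)) (at t)"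
        by (cases j) (simp_all add: algebra_simps)
      then have "(k has_real_derivative h' t * inverse (e t) ^ j + - (real j * e' t * inverse (e t) ^ Suc j) * h t) (at t)"
        unfolding k(1) by (intro DERIV_mult hd)
      then show ?thesis by (simp add: algebra_simps)
    qed
    moreover have "(\<lambda>t. h' t * inverse (e t) ^ j) \<in> X" using h' by (auto simp: X_def)
    moreover have "(\<lambda>t. (- (real j) * h t * e' t) * inverse (e t) ^ Suc j) \<in> X"
      unfolding X_def using smooth_curve_mult[OF smooth_curve_mult[OF smooth_curve_const[of "- real j"] k(2)] e'(1)]
      by (intro CollectI exI[of _ "\<lambda>t. - real j * h t * e' t"] exI[of _ "Suc j"]) auto
    ultimately show "\<exists>k'\<in>sums_of X. \<forall>t. (k has_vector_derivative k' t) (at t)"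
      unfolding has_real_derivative_iff_has_vector_derivative
      by (intro bexI[where x = "\<lambda>t. h' t * inverse (e t) ^ j + (- (real j) * h t * e' t) * inverse (e t) ^ Suc j"]
          allI sums_of.add sums_of.base)
  qed
  moreover have "(\<lambda>t. 1 * inverse (e t) ^ 1) \<in> X"
    unfolding X_def by (intro CollectI exI[of _ "\<lambda>_. 1"] exI[of _ 1]) auto
  ultimately show ?thesis by fastforce
qed

text \<open>Derivatives are unique, so those of the local representatives agree near each point and
  glue to \<open>f' s = g' s s\<close>, which is again locally smooth. The locally smooth functions
  are therefore an invariant set.\<close>

lemma smooth_curve_local:
  assumes "\<And>t0. \<exists>g. smooth_curve g \<and> (\<forall>\<^sub>F t in nhds t0. f t = g t)"
  shows "smooth_curve f"
proof (rule smooth_curve_coinduct[where X = "{f. \<forall>t0. \<exists>g. smooth_curve g \<and> (\<forall>\<^sub>F t in nhds t0. f t = g t)}"])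
  show "f \<in> {f. \<forall>t0. \<exists>g. smooth_curve g \<and> (\<forall>\<^sub>F t in nhds t0. f t = g t)}" using assms by auto
  fix f :: "real \<Rightarrow> 'a"
  assume "f \<in> {f. \<forall>t0. \<exists>g. smooth_curve g \<and> (\<forall>\<^sub>F t in nhds t0. f t = g t)}"
  then obtain g where g: "\<And>s. smooth_curve (g s)" "\<And>s. \<forall>\<^sub>F t in nhds s. f t = g s t" by (simp, metis)
  obtain g' where g': "\<And>s. smooth_curve (g' s)" "\<And>s t. (g s has_vector_derivative g' s t) (at t)"
    using smooth_curve_derivative[OF g(1)] by metis
  have *: "\<forall>\<^sub>F t in nhds s. (f has_vector_derivative g' s t) (at t)" for s
  proof -
    have "\<forall>\<^sub>F t in nhds s. \<forall>\<^sub>F u in nhds t. f u = g s u"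
      using g(2)[of s] by (simp add: eventually_eventually)
    then show ?thesis
    proof eventually_elim
      case (elim t)
      then have "f t = g s t" by (rule eventually_nhds_x_imp_x)
      moreover have "\<forall>\<^sub>F u in nhds t. u \<in> UNIV \<longrightarrow> g s u = f u"
        using elim by eventually_elim auto
      ultimately show ?case
        using g'(2)[of s t] has_vector_derivative_cong_ev[of UNIV "g s" f t] by auto
    qed
  qed
  define f' where "f' s = g' s s" for s
  have f': "(f has_vector_derivative f' s) (at s)" for s
    unfolding f'_def using eventually_nhds_x_imp_x[OF *] by auto
  have "\<forall>\<^sub>F t in nhds s. f' t = g' s t" for s
    using *[of s] by eventually_elim (use f' vector_derivative_unique_at in metis)
  then show "\<exists>f'\<in>{f. \<forall>t0. \<exists>g. smooth_curve g \<and> (\<forall>\<^sub>F t in nhds t0. f t = g t)}.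
       \<forall>t. (f has_vector_derivative f' t) (at t)"
    using f' g'(1) by (intro bexI[of _ f']) auto
qed

section \<open>Smooth cut-off functions\<close>

text \<open>The functions c x^(-j) exp(-1/x), extended by 0, form an invariant set up to sums:
  differentiation gives two of them, with exponents j + 1 and j + 2. At 0 the difference quotient
  tends to 0 because the exponential beats every power.\<close>

lemma smooth_curve_flat: "smooth_curve (\<lambda>x::real. if x \<le> 0 then 0 else exp (- inverse x))"
proof -
  define E where "E = (\<lambda>c (j::nat) x::real. if x \<le> 0 then 0 else c * inverse x ^ j * exp (- inverse x))"
  have der: "(E c j has_real_derivative E (- c * j) (Suc j) x + E c (j + 2) x) (at x)" for c j x
  proof -
    consider "x < 0" | "x > 0" | "x = 0" by linarith
    then show ?thesis
    proof cases
      case 1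
      have "((\<lambda>x. 0) has_real_derivative 0) (at x)" by simp
      then have "(E c j has_real_derivative 0) (at x)"
        by (rule has_field_derivative_transform_within_open[where S = "{..<0}"]) (use 1 in \<open>auto simp: E_def\<close>)
      then show ?thesis using 1 by (simp add: E_def)
    next
      case 2
      have "((\<lambda>x. c * inverse x ^ j * exp (- inverse x)) has_real_derivative
          E (- c * j) (Suc j) x + E c (j + 2) x) (at x)"
      proof -
        have "((\<lambda>x. inverse x ^ j) has_real_derivative
            real j * (inverse x ^ (j - 1) * - (inverse x * inverse x))) (at x)"
          using 2 by (auto intro!: derivative_eq_intros)
        then have "((\<lambda>x. inverse x ^ j) has_real_derivative - (real j * inverse x ^ Suc j)) (at x)"
          by (cases j) (simp_all add: algebra_simps)
        moreover have "((\<lambda>x. exp (- inverse x)) has_real_derivative exp (- inverse x) * (inverse x * inverse x)) (at x)"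
          using 2 by (auto intro!: derivative_eq_intros)
        ultimately have "((\<lambda>x. c * (inverse x ^ j * exp (- inverse x))) has_real_derivative
          c * (- (real j * inverse x ^ Suc j) * exp (- inverse x) +
             exp (- inverse x) * (inverse x * inverse x) * inverse x ^ j)) (at x)"
          by (intro DERIV_cmult DERIV_mult)
        then show ?thesis using 2 by (simp add: E_def algebra_simps)
      qed
      then show ?thesis
        by (rule has_field_derivative_transform_within_open[where S = "{0<..}"]) (use 2 in \<open>auto simp: E_def\<close>)
    next
      case 3
      have "((\<lambda>h. E c j h / h) \<longlongrightarrow> 0) (at_right 0)"
      proof -
        have "((\<lambda>u. c * (u ^ Suc j / exp u)) \<longlongrightarrow> c * 0) at_top"
          by (intro tendsto_mult tendsto_const tendsto_power_div_exp_0)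
        then have "((\<lambda>h. c * (inverse h ^ Suc j / exp (inverse h))) \<longlongrightarrow> c * 0) (at_right (0::real))"
          by (rule filterlim_compose) (rule filterlim_inverse_at_top_right)
        moreover have "\<forall>\<^sub>F h in at_right 0. E c j h / h = c * (inverse h ^ Suc j / exp (inverse h))"
          by (auto simp: eventually_at_right_less E_def exp_minus field_simps eventually_at_filter)
        ultimately have "((\<lambda>h. E c j h / h) \<longlongrightarrow> c * 0) (at_right 0)"
          using tendsto_cong by fast
        then show ?thesis by simp
      qed
      moreover have "((\<lambda>h. E c j h / h) \<longlongrightarrow> 0) (at_left 0)"
      proof -
        have "\<forall>\<^sub>F h in at_left 0. E c j h / h = 0"
          by (auto simp: E_def eventually_at_filter)
        then show ?thesis by (rule tendsto_eventually)
      qed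
      ultimately have "((\<lambda>h. E c j h / h) \<longlongrightarrow> 0) (at 0)"
        by (simp add: filterlim_split_at)
      moreover have "E c j 0 = 0" "E (- c * j) (Suc j) 0 + E c (j + 2) 0 = 0"
        by (simp_all add: E_def)
      ultimately show ?thesis using 3 by (simp add: DERIV_def)
    qed
  qed
  have "smooth_curve (E 1 0)"
  proof (rule smooth_curve_coinduct_sums[where X = "{E c j |c j. True}"])
    show "E 1 0 \<in> {E c j |c j. True}" by auto
    fix g assume "g \<in> {E c j |c j. True}"
    then obtain c j where "g = E c j" by auto
    then show "\<exists>g'\<in>sums_of {E c j |c j. True}. \<forall>t. (g has_vector_derivative g' t) (at t)"
      using der[of c j]
      by (intro bexI[of _ "\<lambda>x. E (- c * j) (Suc j) x + E c (j + 2) x"])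
        (auto simp: has_real_derivative_iff_has_vector_derivative intro: sums_of.intros)
  qed
  then show ?thesis by (simp add: E_def cong: if_cong)
qed

text \<open>The product of the flat functions of x and 1 - x is a bump on [0, 1]. Its normalised
  antiderivative \<open>\<sigma>\<close> is a smooth step from 0 to 1, and \<theta> multiplies a
  rising step with a falling one.\<close>

lemma smooth_plateau:
  obtains \<theta> :: "real \<Rightarrow> real" where "smooth_curve \<theta>" "\<And>t. 0 \<le> \<theta> t" "\<And>t. \<theta> t \<le> 1"
    "\<And>t. \<bar>t\<bar> \<le> 1/2 \<Longrightarrow> \<theta> t = 1" "\<And>t. \<bar>t\<bar> \<ge> 1 \<Longrightarrow> \<theta> t = 0"
proof -
  define e where "e = (\<lambda>x::real. if x \<le> 0 then 0 else exp (- inverse x))"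
  have e: "smooth_curve e" unfolding e_def by (rule smooth_curve_flat)
  define \<eta> where "\<eta> = (\<lambda>x. e x * e (1 - x))"
  have \<eta>s: "smooth_curve \<eta>"
    unfolding \<eta>_def using e smooth_curve_affine[OF e, of "-1" 1] by (auto intro: smooth_curve_mult)
  have \<eta>0: "\<eta> x \<ge> 0" "x \<le> 0 \<Longrightarrow> \<eta> x = 0" "x \<ge> 1 \<Longrightarrow> \<eta> x = 0" for x
    by (auto simp: \<eta>_def e_def)
  have cont: "continuous_on S \<eta>" for S using \<eta>s by (rule smooth_curve_continuous)
  have int: "\<eta> integrable_on {a..b}" for a b
    using cont by (rule integrable_continuous_real)
  \<comment> \<open>The lower limit -1 lies to the left of the support of \<eta>, so every x \<ge> 0
    is an interior point of the interval on which \<open>der\<close> differentiates the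
    integral.\<close>
  define J where "J x = integral {-1..x} \<eta>" for x
  have J0: "J x = 0" if "x \<le> 0" for x
  proof -
    have "J x = integral {-1..x} (\<lambda>_. 0)" unfolding J_def
      by (rule integral_cong) (use that \<eta>0 in auto)
    then show ?thesis by simp
  qed
  have der: "(J has_vector_derivative \<eta> x) (at x)" for x
  proof (cases "x < 0")
    case True
    have "((\<lambda>x. 0) has_vector_derivative 0) (at x)" by simp
    then have "(J has_vector_derivative 0) (at x)"
      by (rule has_vector_derivative_transform_within_open[where S = "{..<0}"]) (use True J0 in auto)
    then show ?thesis using \<eta>0 True by simp
  next
    case False
    have "(J has_vector_derivative \<eta> x) (at x within {-1..x+1})"
      unfolding J_def by (rule integral_has_vector_derivative[OF cont]) (use False in auto)
    then show ?thesis
      by (subst (asm) at_within_interior) (use False in \<open>auto simp: interior_atLeastAtMost_real\<close>)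
  qed
  have J1: "J x = J 1" if "x \<ge> 1" for x
  proof -
    have "integral {-1..x} \<eta> = integral {-1..1} \<eta> + integral {1..x} \<eta>"
      by (rule Henstock_Kurzweil_Integration.integral_combine[symmetric]) (use that int in auto)
    moreover have "integral {1..x} \<eta> = integral {1..x} (\<lambda>_. 0)"
      by (rule integral_cong) (use \<eta>0 in auto)
    ultimately show ?thesis by (simp add: J_def)
  qed
  have mono: "J x \<le> J y" if "x \<le> y" for x y
    using that
    by (intro deriv_nonneg_imp_mono[of x y J \<eta>])
      (use der \<eta>0 in \<open>auto simp: has_real_derivative_iff_has_vector_derivative\<close>)
  have pos: "J 1 > 0"
  proof -
    have "J 0 < J 1"
    proof (rule DERIV_pos_imp_increasing_open[of 0 1 J])
      fix x :: real assume "0 < x" "x < 1"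
      then show "\<exists>y. (J has_real_derivative y) (at x) \<and> 0 < y"
        using der[of x] by (intro exI[of _ "\<eta> x"]) (auto simp: has_real_derivative_iff_has_vector_derivative \<eta>_def e_def)
    next
      show "continuous_on {0..1} J"
        using der has_vector_derivative_continuous continuous_at_imp_continuous_on by blast
    qed auto
    then show ?thesis using J0[of 0] by simp
  qed
  have Js: "smooth_curve J"
    by (rule smooth_curve_coinduct[where X = "insert J {f. smooth_curve f}"])
      (use der \<eta>s smooth_curve_derivative in \<open>blast+\<close>)
  define \<sigma> where "\<sigma> x = J x / J 1" for x
  have \<sigma>s: "smooth_curve \<sigma>" unfolding \<sigma>_def divide_inverse using Js by (intro smooth_curve_mult) auto
  have J_bounds: "0 \<le> J x" "J x \<le> J 1" for x
    using mono[of "min 0 x" x] J0[of "min 0 x"] mono[of x "max x 1"] J1[of "max x 1"] by simp_all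
  have \<sigma>: "0 \<le> \<sigma> x" "\<sigma> x \<le> 1" "x \<le> 0 \<Longrightarrow> \<sigma> x = 0" "x \<ge> 1 \<Longrightarrow> \<sigma> x = 1" for x
    using J_bounds[of x] J0[of x] J1[of x] pos by (simp_all add: \<sigma>_def)
  define \<theta> where "\<theta> t = \<sigma> (2 - 2 * t) * \<sigma> (2 + 2 * t)" for t
  show ?thesis
  proof (rule that[of \<theta>])
    show "smooth_curve \<theta>" unfolding \<theta>_def
      using smooth_curve_affine[OF \<sigma>s, of "-2" 2] smooth_curve_affine[OF \<sigma>s, of "2" 2]
      by (intro smooth_curve_mult) (auto simp: algebra_simps)
    show "0 \<le> \<theta> t" "\<theta> t \<le> 1" for t
      unfolding \<theta>_def using \<sigma> by (simp_all add: mult_le_one)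
    show "\<theta> t = 1" if "\<bar>t\<bar> \<le> 1/2" for t
      using \<sigma>(4)[of "2 - 2 * t"] \<sigma>(4)[of "2 + 2 * t"] that unfolding \<theta>_def by simp
    show "\<theta> t = 0" if "\<bar>t\<bar> \<ge> 1" for t
      using \<sigma>(3)[of "2 - 2 * t"] \<sigma>(3)[of "2 + 2 * t"] that unfolding \<theta>_def by (auto simp: abs_if split: if_splits)
  qed
qed

text \<open>Every derivative vanishes for \<open>\<bar>t\<bar> > 1\<close> and is continuous, hence
  bounded on the whole line. The series of rescaled copies in \<open>special_curve\<close> relies on
  these bounds.\<close>

lemma smooth_curve_compact_support:
  fixes c :: "real \<Rightarrow> 'a::real_normed_vector"
  assumes "smooth_curve c" "\<And>t. \<bar>t\<bar> \<ge> 1 \<Longrightarrow> c t = 0"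
  shows "\<exists>cs B. cs 0 = c \<and> (\<forall>n t. (cs n has_vector_derivative cs (Suc n) t) (at t)) \<and>
    (\<forall>(n::nat) t. norm (cs n t) \<le> B n)"
proof -
  obtain cs where cs: "cs 0 = c" "\<And>n t. (cs n has_vector_derivative cs (Suc n) t) (at t)"
    using assms unfolding smooth_curve_def by auto
  have z: "cs n t = 0" if "\<bar>t\<bar> > 1" for n t
    using that
  proof (induction n arbitrary: t)
    case 0 then show ?case using assms cs by auto
  next
    case (Suc n)
    have "((\<lambda>x. 0) has_vector_derivative 0) (at t)" by simp
    then have "(cs n has_vector_derivative 0) (at t)"
      by (rule has_vector_derivative_transform_within_open[where S = "- {-1..1}"])
         (use Suc in \<open>auto simp: abs_if split: if_splits\<close>)
    then show ?case using cs(2) vector_derivative_unique_at by blast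
  qed
  have "\<exists>B. \<forall>t. norm (cs n t) \<le> B" for n
  proof -
    have "continuous_on {-1..1} (cs n)"
      using cs(2) by (meson continuous_at_imp_continuous_on has_vector_derivative_continuous)
    then have "bounded (cs n ` {-1..1})"
      by (intro compact_imp_bounded compact_continuous_image) auto
    then obtain B where B: "\<And>t. t \<in> {-1..1} \<Longrightarrow> norm (cs n t) \<le> B"
      unfolding bounded_iff by blast
    then have "norm (cs n t) \<le> max B 0" for t
    proof (cases "\<bar>t\<bar> > 1")
      case False
      then have "norm (cs n t) \<le> B" by (intro B) auto
      then show ?thesis by simp
    qed (simp add: z)
    then show ?thesis by blast
  qed
  then obtain B where "\<And>n t. norm (cs n t) \<le> B n" by metis
  then show ?thesis using cs by blast
qed

section \<open>Directional derivatives\<close>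

lemma real_mvt_bound:
  fixes g :: "real \<Rightarrow> 'b::real_normed_vector"
  assumes "0 \<le> h" "\<And>s. 0 \<le> s \<Longrightarrow> s \<le> h \<Longrightarrow> (g has_vector_derivative g' s) (at s)"
    and "\<And>s. 0 \<le> s \<Longrightarrow> s \<le> h \<Longrightarrow> norm (g' s) \<le> M"
  shows "norm (g h - g 0) \<le> M * h"
proof (cases "h = 0")
  case False
  have "norm (g h - g 0) \<le> M * h - M * 0"
  proof (rule differentiable_bound_general[where f' = g'])
    show "0 < h" using assms(1) False by simp
    show "continuous_on {0..h} g"
      by (rule continuous_at_imp_continuous_on) (use assms(2) has_vector_derivative_continuous in force)
    show "((*) M has_vector_derivative M) (at x)" for x
      by (auto intro!: derivative_eq_intros)
  qed (use assms in \<open>auto intro!: continuous_intros\<close>)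
  then show ?thesis by simp
qed simp

text \<open>The direction \<open>v\<close> is arbitrary, because polarization combines several
  directions. Differentiability is asked only at the points of \<open>S\<close>; the line through
  them may leave \<open>S\<close>.\<close>

definition diff_along :: "'a::euclidean_space set \<Rightarrow> 'a \<Rightarrow> ('a \<Rightarrow> 'b::real_normed_vector) \<Rightarrow> bool" where
  "diff_along S v f \<longleftrightarrow> (\<forall>x\<in>S. (\<lambda>t. f (x + t *\<^sub>R v)) differentiable (at 0))"

lemma pdiff_eqI: "((\<lambda>t. f (x + t *\<^sub>R v)) has_vector_derivative D) (at 0) \<Longrightarrow> pdiff v f x = D"
  unfolding pdiff_def by (rule vector_derivative_at)

lemma diff_alongI:
  assumes "\<And>x. x \<in> S \<Longrightarrow> ((\<lambda>t. f (x + t *\<^sub>R v)) has_vector_derivative D x) (at 0)"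
  shows "diff_along S v f"
  unfolding diff_along_def using differentiableI_vector[OF assms] by simp

lemma diff_along_at_0:
  "diff_along S v f \<Longrightarrow> x \<in> S \<Longrightarrow> ((\<lambda>t. f (x + t *\<^sub>R v)) has_vector_derivative pdiff v f x) (at 0)"
  unfolding diff_along_def pdiff_def by (simp only: vector_derivative_works[symmetric])

lemma has_vector_derivative_shift:
  assumes "(g has_vector_derivative D) (at (s + a))"
  shows "((\<lambda>t. g (t + a)) has_vector_derivative D) (at s)"
proof -
  have "((\<lambda>t. t + a) has_vector_derivative 1) (at s)" by (auto intro!: derivative_eq_intros)
  from vector_diff_chain_at[OF this assms] show ?thesis by (simp add: o_def)
qed

lemma diff_along_at:
  assumes "diff_along S v f" "x + s *\<^sub>R v \<in> S"
  shows "((\<lambda>t. f (x + t *\<^sub>R v)) has_vector_derivative pdiff v f (x + s *\<^sub>R v)) (at s)"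
proof -
  have "((\<lambda>t. f (x + s *\<^sub>R v + t *\<^sub>R v)) has_vector_derivative pdiff v f (x + s *\<^sub>R v)) (at (s + (- s)))"
    using diff_along_at_0[OF assms] by simp
  from has_vector_derivative_shift[OF this] show ?thesis by (simp add: algebra_simps)
qed

lemma diff_along_subset: "diff_along S v f \<Longrightarrow> T \<subseteq> S \<Longrightarrow> diff_along T v f"
  unfolding diff_along_def by blast

lemma eventually_along_in_open:
  fixes x v :: "'a::euclidean_space"
  assumes "open S" "x \<in> S" shows "\<forall>\<^sub>F t in nhds 0. x + t *\<^sub>R v \<in> S"
proof -
  have "((\<lambda>t. x + t *\<^sub>R v) \<longlongrightarrow> x + 0 *\<^sub>R v) (nhds 0)"
    by (intro tendsto_add tendsto_const tendsto_scaleR filterlim_ident)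
  then show ?thesis using assms by (simp add: topological_tendstoD)
qed

lemma pdiff_cong_open:
  assumes "open S" "x \<in> S" "\<And>y. y \<in> S \<Longrightarrow> f y = g y"
  shows "((\<lambda>t. f (x + t *\<^sub>R v)) has_vector_derivative D) (at 0) \<longleftrightarrow>
         ((\<lambda>t. g (x + t *\<^sub>R v)) has_vector_derivative D) (at 0)"
    and "pdiff v f x = pdiff v g x"
proof -
  show *: "((\<lambda>t. f (x + t *\<^sub>R v)) has_vector_derivative D) (at 0) \<longleftrightarrow>
         ((\<lambda>t. g (x + t *\<^sub>R v)) has_vector_derivative D) (at 0)" for D
  proof (rule has_vector_derivative_cong_ev)
    show "\<forall>\<^sub>F t in nhds 0. t \<in> UNIV \<longrightarrow> f (x + t *\<^sub>R v) = g (x + t *\<^sub>R v)"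
      using eventually_along_in_open[OF assms(1,2), of v] by eventually_elim (simp add: assms)
  qed (simp add: assms)
  show "pdiff v f x = pdiff v g x"
    unfolding pdiff_def vector_derivative_def using * by simp
qed

lemma diff_along_cong_open:
  assumes "open S" "\<And>y. y \<in> S \<Longrightarrow> f y = g y"
  shows "diff_along S v f \<longleftrightarrow> diff_along S v g"
proof
  assume "diff_along S v f"
  then show "diff_along S v g"
    using pdiff_cong_open(1)[of S _ f g, OF assms(1) _ assms(2)] diff_along_at_0[of S v f]
    by (intro diff_alongI[where D = "pdiff v f"]) simp
next
  assume "diff_along S v g"
  then show "diff_along S v f"
    using pdiff_cong_open(1)[of S _ f g, OF assms(1) _ assms(2)] diff_along_at_0[of S v g]
    by (intro diff_alongI[where D = "pdiff v g"]) simp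
qed

lemma along_bound:
  fixes f :: "'a::euclidean_space \<Rightarrow> 'b::real_normed_vector"
  assumes "0 \<le> h" "diff_along S v f"
    and "\<And>s. 0 \<le> s \<Longrightarrow> s \<le> h \<Longrightarrow> x + s *\<^sub>R v \<in> S"
    and "\<And>s. 0 \<le> s \<Longrightarrow> s \<le> h \<Longrightarrow> norm (pdiff v f (x + s *\<^sub>R v)) \<le> M"
  shows "norm (f (x + h *\<^sub>R v) - f x) \<le> M * h"
  using real_mvt_bound[of h "\<lambda>t. f (x + t *\<^sub>R v)" "\<lambda>s. pdiff v f (x + s *\<^sub>R v)" M]
    assms diff_along_at[OF assms(2)] by simp

lemma along_bound_abs:
  fixes f :: "'a::euclidean_space \<Rightarrow> 'b::real_normed_vector"
  assumes "diff_along S v f"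
    and "\<And>s. \<bar>s\<bar> \<le> \<bar>h\<bar> \<Longrightarrow> x + s *\<^sub>R v \<in> S"
    and "\<And>s. \<bar>s\<bar> \<le> \<bar>h\<bar> \<Longrightarrow> norm (pdiff v f (x + s *\<^sub>R v)) \<le> M"
  shows "norm (f (x + h *\<^sub>R v) - f x) \<le> M * \<bar>h\<bar>"
proof (cases "h \<ge> 0")
  case True
  then show ?thesis using along_bound[of h S v f x M] assms by simp
next
  case False
  define y where "y = x + h *\<^sub>R v"
  have y: "y + s *\<^sub>R v = x + (h + s) *\<^sub>R v" for s by (simp add: y_def algebra_simps)
  have "norm (f (y + (- h) *\<^sub>R v) - f y) \<le> M * (- h)"
  proof (rule along_bound[OF _ assms(1)])
    fix s assume "0 \<le> s" "s \<le> - h"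
    then have "\<bar>h + s\<bar> \<le> \<bar>h\<bar>" using False by simp
    then show "y + s *\<^sub>R v \<in> S" "norm (pdiff v f (y + s *\<^sub>R v)) \<le> M"
      unfolding y by (fact assms)+
  qed (use False in simp)
  moreover have "y + (- h) *\<^sub>R v = x" by (simp add: y_def)
  ultimately show ?thesis using False by (simp add: y_def norm_minus_commute)
qed

text \<open>The mean value inequality applied twice; this yields the constant \<open>M\<close> in
  place of the sharp \<open>M / 2\<close>, which is good enough and avoids integration.\<close>

lemma along_taylor:
  fixes f :: "'a::euclidean_space \<Rightarrow> 'b::real_normed_vector"
  assumes "diff_along S v f" "diff_along S v (pdiff v f)"
    and S: "\<And>s. \<bar>s\<bar> \<le> \<bar>h\<bar> \<Longrightarrow> x + s *\<^sub>R v \<in> S"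
    and M: "\<And>s. \<bar>s\<bar> \<le> \<bar>h\<bar> \<Longrightarrow> norm (pdiff v (pdiff v f) (x + s *\<^sub>R v)) \<le> M"
  shows "norm (f (x + h *\<^sub>R v) - f x - h *\<^sub>R pdiff v f x) \<le> M * h\<^sup>2"
proof -
  define T where "T = {x + s *\<^sub>R v |s. \<bar>s\<bar> \<le> \<bar>h\<bar>}"
  have M0: "M \<ge> 0" using order_trans[OF norm_ge_zero M[of 0]] by simp
  \<comment> \<open>The sign \<open>c\<close> turns a negative step into a step
    \<open>h \<ge> 0\<close> in the direction \<open>- v\<close>.\<close>
  have main: "norm (f (x + h *\<^sub>R (c *\<^sub>R v)) - f x - h *\<^sub>R (c *\<^sub>R pdiff v f x)) \<le> M * h\<^sup>2"
    if "h \<ge> 0" "\<bar>c\<bar> = 1" "\<And>s. \<bar>s\<bar> \<le> \<bar>h\<bar> \<Longrightarrow> x + s *\<^sub>R v \<in> S"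
    "\<And>s. \<bar>s\<bar> \<le> \<bar>h\<bar> \<Longrightarrow> norm (pdiff v (pdiff v f) (x + s *\<^sub>R v)) \<le> M" for c h :: real
  proof -
    define g where "g t = f (x + (t * c) *\<^sub>R v) - (t * c) *\<^sub>R pdiff v f x" for t
    define g' where "g' t = c *\<^sub>R (pdiff v f (x + (t * c) *\<^sub>R v) - pdiff v f x)" for t
    have "norm (g h - g 0) \<le> (M * h) * h"
    proof (rule real_mvt_bound[OF that(1)])
      fix s assume s: "0 \<le> s" "s \<le> h"
      have sc: "\<bar>s * c\<bar> \<le> \<bar>h\<bar>" using s that(2) by (simp add: abs_mult)
      have "((\<lambda>t. t * c) has_vector_derivative c) (at s)"
        by (auto intro!: derivative_eq_intros)
      from vector_diff_chain_at[OF this diff_along_at[OF assms(1) that(3)[OF sc]]]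
      have "((\<lambda>t. f (x + (t * c) *\<^sub>R v)) has_vector_derivative c *\<^sub>R pdiff v f (x + (s * c) *\<^sub>R v)) (at s)"
        by (simp add: o_def)
      moreover have "((\<lambda>t. (t * c) *\<^sub>R pdiff v f x) has_vector_derivative c *\<^sub>R pdiff v f x) (at s)"
        by (auto intro!: derivative_eq_intros)
      ultimately show "(g has_vector_derivative g' s) (at s)"
        unfolding g_def g'_def scaleR_diff_right by (rule has_vector_derivative_diff)
      have "norm (pdiff v f (x + (s * c) *\<^sub>R v) - pdiff v f x) \<le> M * \<bar>s * c\<bar>"
        by (rule along_bound_abs[OF assms(2)]) (use sc that in auto)
      also have "\<dots> \<le> M * h" using M0 s that(2) by (simp add: abs_mult mult_left_mono)
      finally show "norm (g' s) \<le> M * h" using that(2) by (simp add: g'_def)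
    qed
    then show ?thesis by (simp add: g_def power2_eq_square algebra_simps)
  qed
  show ?thesis
  proof (cases "h \<ge> 0")
    case True then show ?thesis using main[OF _ _ S M, of h 1] by simp
  next
    case False then show ?thesis using main[OF _ _ S M, of "- h" "- 1"] by simp
  qed
qed

section \<open>Pure directional derivatives and finite differences\<close>

text \<open>Only powers of a single directional derivative occur, with local bounds in place of
  continuity: this is what testing along curves yields directly. Mixed derivatives and their
  symmetry are derived from it by finite differences.\<close>

definition ray_smooth :: "'a::euclidean_space set \<Rightarrow> ('a \<Rightarrow> 'b::real_normed_vector) \<Rightarrow> bool" where
  "ray_smooth S f \<longleftrightarrow> (\<forall>v k. diff_along S v ((pdiff v ^^ k) f) \<and>
     (\<forall>x\<in>S. \<exists>r>0. \<exists>C. \<forall>y\<in>ball x r. norm ((pdiff v ^^ k) f y) \<le> C))"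

fun fdiff :: "nat \<Rightarrow> 'a::real_vector \<Rightarrow> ('a \<Rightarrow> 'b::real_vector) \<Rightarrow> 'a \<Rightarrow> 'b" where
  "fdiff 0 u f x = f x"
| "fdiff (Suc k) u f x = fdiff k u f (x + u) - fdiff k u f x"

lemma fdiff_binomial:
  "fdiff m u f x = (\<Sum>i\<le>m. ((-1) ^ (m - i) * real (m choose i)) *\<^sub>R f (x + real i *\<^sub>R u))"
proof (induction m arbitrary: x)
  case (Suc m)
  let ?c = "\<lambda>m i. (-1) ^ (m - i) * real (m choose i)"
  have "(\<Sum>i\<le>Suc m. ?c (Suc m) i *\<^sub>R f (x + real i *\<^sub>R u)) =
     (\<Sum>i\<le>Suc m. (if i = 0 then 0 else ?c m (i - 1)) *\<^sub>R f (x + real i *\<^sub>R u))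
     - (\<Sum>i\<le>Suc m. (if i = Suc m then 0 else ?c m i) *\<^sub>R f (x + real i *\<^sub>R u))"
    unfolding sum_subtractf[symmetric] scaleR_diff_left[symmetric]
  proof (intro sum.cong refl arg_cong2[of _ _ _ _ scaleR])
    fix i assume "i \<in> {..Suc m}"
    then consider "i = 0" | j where "i = Suc j" "j < m" | "i = Suc m" by (cases i) force+
    then show "?c (Suc m) i = (if i = 0 then 0 else ?c m (i - 1)) - (if i = Suc m then 0 else ?c m i)"
    proof cases
      case (2 j)
      then have "(-1) ^ (m - j) = - ((-1::real) ^ (m - Suc j))"
        by (metis Suc_diff_Suc power_Suc mult_minus1)
      then show ?thesis using 2 by (simp add: algebra_simps)
    qed auto
  qed
  also have "(\<Sum>i\<le>Suc m. (if i = 0 then 0 else ?c m (i - 1)) *\<^sub>R f (x + real i *\<^sub>R u))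
      = (\<Sum>i\<le>m. ?c m i *\<^sub>R f (x + u + real i *\<^sub>R u))"
    by (subst sum.atMost_Suc_shift) (simp add: algebra_simps)
  also have "(\<Sum>i\<le>Suc m. (if i = Suc m then 0 else ?c m i) *\<^sub>R f (x + real i *\<^sub>R u))
      = (\<Sum>i\<le>m. ?c m i *\<^sub>R f (x + real i *\<^sub>R u))"
    by (simp add: sum.atMost_Suc)
  finally show ?case using Suc by simp
qed simp

lemma fdiff_has_vector_derivative:
  assumes "diff_along S v f" "\<And>i. i \<le> m \<Longrightarrow> x + real i *\<^sub>R u + s *\<^sub>R v \<in> S"
  shows "((\<lambda>t. fdiff m u f (x + t *\<^sub>R v)) has_vector_derivative fdiff m u (pdiff v f) (x + s *\<^sub>R v)) (at s)"
  using assms(2)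
proof (induction m arbitrary: x)
  case 0
  then show ?case using diff_along_at[OF assms(1), of x s] by simp
next
  case (Suc m)
  have 1: "x + u + real i *\<^sub>R u + s *\<^sub>R v \<in> S" if "i \<le> m" for i
    using Suc.prems[of "Suc i"] that by (simp add: algebra_simps)
  have 2: "x + real i *\<^sub>R u + s *\<^sub>R v \<in> S" if "i \<le> m" for i
    using Suc.prems[of i] that by simp
  show ?case
    using has_vector_derivative_diff[OF Suc.IH[OF 1] Suc.IH[OF 2]] by (simp add: add_ac)
qed

text \<open>Each order of the difference is one application of the mean value inequality, which
  trades a derivative along \<open>v\<close> for a factor \<open>h\<close>.\<close>

lemma fdiff_bound:
  fixes f :: "'a::euclidean_space \<Rightarrow> 'b::real_normed_vector"
  assumes "0 \<le> (h::real)"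
    and "\<And>j. j < m \<Longrightarrow> diff_along S v ((pdiff v ^^ j) f)"
    and "\<And>s. 0 \<le> s \<Longrightarrow> s \<le> m * h \<Longrightarrow> x + s *\<^sub>R v \<in> S"
    and "\<And>y. y \<in> S \<Longrightarrow> norm ((pdiff v ^^ m) f y) \<le> C"
  shows "norm (fdiff m (h *\<^sub>R v) f x) \<le> C * h ^ m"
  using assms(2-4)
proof (induction m arbitrary: f x)
  case 0
  then show ?case using 0(2)[of 0] by simp
next
  case (Suc m)
  have "norm (fdiff m (h *\<^sub>R v) f (x + h *\<^sub>R v) - fdiff m (h *\<^sub>R v) f (x + 0 *\<^sub>R v)) \<le> (C * h ^ m) * h"
  proof (rule real_mvt_bound[OF assms(1)])
    fix s assume s: "0 \<le> s" "s \<le> h"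
    show "((\<lambda>t. fdiff m (h *\<^sub>R v) f (x + t *\<^sub>R v)) has_vector_derivative
        fdiff m (h *\<^sub>R v) (pdiff v f) (x + s *\<^sub>R v)) (at s)"
    proof (rule fdiff_has_vector_derivative)
      show "diff_along S v f" using Suc.prems(1)[of 0] by simp
      fix i assume "i \<le> m"
      then have "real i * h \<le> real m * h" using assms(1) by (intro mult_right_mono) auto
      then have "x + (real i * h + s) *\<^sub>R v \<in> S"
        using s assms(1) by (intro Suc.prems(2)) (auto simp: algebra_simps)
      then show "x + real i *\<^sub>R h *\<^sub>R v + s *\<^sub>R v \<in> S" by (simp add: algebra_simps)
    qed
    show "norm (fdiff m (h *\<^sub>R v) (pdiff v f) (x + s *\<^sub>R v)) \<le> C * h ^ m"
    proof (rule Suc.IH)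
      show "diff_along S v ((pdiff v ^^ j) (pdiff v f))" if "j < m" for j
        using Suc.prems(1)[of "Suc j"] that by (simp add: funpow_swap1)
      show "norm ((pdiff v ^^ m) (pdiff v f) y) \<le> C" if "y \<in> S" for y
        using Suc.prems(3)[OF that] by (simp add: funpow_swap1)
      fix s' assume "0 \<le> s'" "s' \<le> real m * h"
      then have "x + (s + s') *\<^sub>R v \<in> S"
        using s by (intro Suc.prems(2)) (auto simp: algebra_simps)
      then show "x + s *\<^sub>R v + s' *\<^sub>R v \<in> S" by (simp add: algebra_simps)
    qed
  qed
  then show ?case by (simp add: algebra_simps)
qed

text \<open>Induction on the order: the mean value inequality is applied to the difference minus its
  expected linear growth. Freezing the top derivative at \<open>x\<close> costs one further multiple
  of \<open>M\<close> at each order, which explains the factor \<open>k\<close>.\<close>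

lemma fdiff_error:
  fixes f :: "'a::euclidean_space \<Rightarrow> 'b::real_normed_vector"
  assumes "0 \<le> (h::real)"
    and "\<And>j. j \<le> k \<Longrightarrow> diff_along S v ((pdiff v ^^ j) f)"
    and "\<And>s. 0 \<le> s \<Longrightarrow> s \<le> k * h \<Longrightarrow> x + s *\<^sub>R v \<in> S"
    and "\<And>y. y \<in> S \<Longrightarrow> norm ((pdiff v ^^ Suc k) f y) \<le> M"
  shows "norm (fdiff k (h *\<^sub>R v) f x - h ^ k *\<^sub>R (pdiff v ^^ k) f x) \<le> k * M * h ^ Suc k"
  using assms(2-4)
proof (induction k arbitrary: f x)
  case (Suc k)
  define D where "D = (pdiff v ^^ Suc k) f"
  define g where "g t = fdiff k (h *\<^sub>R v) f (x + t *\<^sub>R v) - t *\<^sub>R (h ^ k *\<^sub>R D x)" for t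
  define g' where "g' t = fdiff k (h *\<^sub>R v) (pdiff v f) (x + t *\<^sub>R v) - h ^ k *\<^sub>R D x" for t
  have "norm (g h - g 0) \<le> ((k + 1) * M * h ^ Suc k) * h"
  proof (rule real_mvt_bound[OF assms(1)])
    fix s assume s: "0 \<le> s" "s \<le> h"
    have "((\<lambda>t. fdiff k (h *\<^sub>R v) f (x + t *\<^sub>R v)) has_vector_derivative
        fdiff k (h *\<^sub>R v) (pdiff v f) (x + s *\<^sub>R v)) (at s)"
    proof (rule fdiff_has_vector_derivative)
      show "diff_along S v f" using Suc.prems(1)[of 0] by simp
      fix i assume "i \<le> k"
      then have "real i * h \<le> real k * h" using assms(1) by (intro mult_right_mono) auto
      then have "x + (real i * h + s) *\<^sub>R v \<in> S"
        using s assms(1) by (intro Suc.prems(2)) (auto simp: algebra_simps)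
      then show "x + real i *\<^sub>R h *\<^sub>R v + s *\<^sub>R v \<in> S" by (simp add: algebra_simps)
    qed
    moreover have "((\<lambda>t. t *\<^sub>R (h ^ k *\<^sub>R D x)) has_vector_derivative h ^ k *\<^sub>R D x) (at s)"
      by (auto intro!: derivative_eq_intros)
    ultimately show "(g has_vector_derivative g' s) (at s)"
      unfolding g_def g'_def by (rule has_vector_derivative_diff)
    have xs: "x + s *\<^sub>R v + s' *\<^sub>R v \<in> S" if "0 \<le> s'" "s' \<le> k * h" for s'
    proof -
      have "x + (s + s') *\<^sub>R v \<in> S"
        using s that by (intro Suc.prems(2)) (auto simp: algebra_simps)
      then show "x + s *\<^sub>R v + s' *\<^sub>R v \<in> S" by (simp add: algebra_simps)
    qed
    have "norm (fdiff k (h *\<^sub>R v) (pdiff v f) (x + s *\<^sub>R v) - h ^ k *\<^sub>R (pdiff v ^^ k) (pdiff v f) (x + s *\<^sub>R v))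
       \<le> k * M * h ^ Suc k"
    proof (rule Suc.IH)
      show "diff_along S v ((pdiff v ^^ j) (pdiff v f))" if "j \<le> k" for j
        using Suc.prems(1)[of "Suc j"] that by (simp add: funpow_swap1)
      show "norm ((pdiff v ^^ Suc k) (pdiff v f) y) \<le> M" if "y \<in> S" for y
        using Suc.prems(3)[OF that] by (simp add: funpow_swap1)
    qed (rule xs)
    moreover have "norm (D (x + s *\<^sub>R v) - D x) \<le> M * s"
    proof (rule along_bound[OF s(1)])
      show "diff_along S v D" unfolding D_def by (rule Suc.prems) simp
      fix s' assume s': "0 \<le> s'" "s' \<le> s"
      show "x + s' *\<^sub>R v \<in> S"
        by (rule Suc.prems) (use s s' assms(1) in \<open>auto simp: algebra_simps intro: order_trans[of _ h]\<close>)
      then show "norm (pdiff v D (x + s' *\<^sub>R v)) \<le> M"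
        unfolding D_def using Suc.prems(3) by simp
    qed
    moreover have M0: "M \<ge> 0"
      using order_trans[OF norm_ge_zero Suc.prems(3)[OF Suc.prems(2)[of 0]]] assms(1) by (simp del: funpow.simps)
    ultimately have "norm (g' s) \<le> k * M * h ^ Suc k + h ^ k * (M * h)"
    proof -
      assume a: "norm (fdiff k (h *\<^sub>R v) (pdiff v f) (x + s *\<^sub>R v) - h ^ k *\<^sub>R (pdiff v ^^ k) (pdiff v f) (x + s *\<^sub>R v))
       \<le> k * M * h ^ Suc k" and b: "norm (D (x + s *\<^sub>R v) - D x) \<le> M * s"
      have "M * s \<le> M * h" using M0 s by (intro mult_left_mono) auto
      then have c: "norm (h ^ k *\<^sub>R (D (x + s *\<^sub>R v) - D x)) \<le> h ^ k * (M * h)"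
        using b assms(1) by (simp add: mult_left_mono)
      have "g' s = (fdiff k (h *\<^sub>R v) (pdiff v f) (x + s *\<^sub>R v) - h ^ k *\<^sub>R (pdiff v ^^ k) (pdiff v f) (x + s *\<^sub>R v))
          + h ^ k *\<^sub>R (D (x + s *\<^sub>R v) - D x)"
        unfolding g'_def D_def by (simp add: funpow_swap1 algebra_simps)
      then show ?thesis using norm_triangle_le[OF add_mono[OF a c]] by simp
    qed
    then show "norm (g' s) \<le> (k + 1) * M * h ^ Suc k" by (simp add: algebra_simps)
  qed
  then show ?case by (simp add: g_def D_def algebra_simps)
qed simp

subsection \<open>Mixed differences by polarization\<close>

text \<open>Subsets that contain \<open>j\<close> are paired with those that do not. Both the
  cancellation in \<open>polarization_fdiff\<close> and the recursion for iterated differences come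
  from this pairing.\<close>

lemma alternating_sum_insert:
  fixes F :: "'i set \<Rightarrow> 'b::real_vector"
  assumes "finite I" "j \<notin> I"
  shows "(\<Sum>A\<in>Pow (insert j I). (-1) ^ card A *\<^sub>R F A) = (\<Sum>A\<in>Pow I. (-1) ^ card A *\<^sub>R (F A - F (insert j A)))"
proof -
  have "Pow (insert j I) = Pow I \<union> insert j ` Pow I" by (rule Pow_insert)
  moreover have "Pow I \<inter> insert j ` Pow I = {}" using assms by auto
  ultimately have "(\<Sum>A\<in>Pow (insert j I). (-1) ^ card A *\<^sub>R F A) =
    (\<Sum>A\<in>Pow I. (-1) ^ card A *\<^sub>R F A) + (\<Sum>A\<in>insert j ` Pow I. (-1) ^ card A *\<^sub>R F A)"
    using assms by (simp add: sum.union_disjoint)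
  also have "(\<Sum>A\<in>insert j ` Pow I. (-1) ^ card A *\<^sub>R F A) = (\<Sum>A\<in>Pow I. - ((-1) ^ card A *\<^sub>R F (insert j A)))"
  proof (subst sum.reindex)
    show "inj_on (insert j) (Pow I)" using assms by (auto simp: inj_on_def)
    show "sum ((\<lambda>A. (- 1) ^ card A *\<^sub>R F A) \<circ> insert j) (Pow I) = (\<Sum>A\<in>Pow I. - ((-1) ^ card A *\<^sub>R F (insert j A)))"
    proof (intro sum.cong refl)
      fix A assume "A \<in> Pow I"
      then have "finite A" "j \<notin> A" using assms by (auto intro: finite_subset)
      then show "((\<lambda>A. (- 1) ^ card A *\<^sub>R F A) \<circ> insert j) A = - ((-1) ^ card A *\<^sub>R F (insert j A))"
        by simp
    qed
  qed
  finally show ?thesis by (simp add: sum_negf sum_subtractf scaleR_diff_right)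
qed

text \<open>Djokovic's identity: in the expansion of the pure differences on the right, all terms with a
  given node \<open>i \<ge> 1\<close> cancel in pairs \<open>A\<close>, \<open>A \<union> {i}\<close>, because the weight \<open>1 - i / j\<close> of \<open>u j\<close> vanishes for \<open>j = i\<close>.\<close>

lemma polarization_fdiff:
  fixes f :: "'a::real_vector \<Rightarrow> 'b::real_vector" and u :: "nat \<Rightarrow> 'a"
  shows "(-1) ^ m *\<^sub>R (\<Sum>A\<in>Pow {1..m}. (-1) ^ card A *\<^sub>R f (x + sum u A)) =
    (\<Sum>A\<in>Pow {1..m}. (-1) ^ card A *\<^sub>R fdiff m (- (\<Sum>j\<in>A. (1 / real j) *\<^sub>R u j)) f (x + sum u A))"
proof -
  define c where "c i = (-1) ^ (m - i) * real (m choose i)" for i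
  define P where "P i A = f (x + sum u A + real i *\<^sub>R (- (\<Sum>j\<in>A. (1 / real j) *\<^sub>R u j)))" for i A
  have zero: "(\<Sum>A\<in>Pow {1..m}. (-1) ^ card A *\<^sub>R P i A) = 0" if "i \<in> {1..m}" for i
  proof -
    define I where "I = {1..m} - {i}"
    have I: "{1..m} = insert i I" "finite I" "i \<notin> I" using that by (auto simp: I_def)
    have "P i (insert i A) = P i A" if "A \<in> Pow I" for A
    proof -
      have "finite A" "i \<notin> A" using that I by (auto intro: finite_subset)
      then show ?thesis using \<open>i \<in> {1..m}\<close> by (simp add: P_def scaleR_add_right algebra_simps)
    qed
    then show ?thesis unfolding I(1) by (subst alternating_sum_insert[OF I(2,3)]) simp
  qed
  have "(\<Sum>A\<in>Pow {1..m}. (-1) ^ card A *\<^sub>R fdiff m (- (\<Sum>j\<in>A. (1 / real j) *\<^sub>R u j)) f (x + sum u A))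
    = (\<Sum>A\<in>Pow {1..m}. \<Sum>i\<le>m. c i *\<^sub>R ((-1) ^ card A *\<^sub>R P i A))"
    unfolding fdiff_binomial c_def P_def scaleR_sum_right
    by (intro sum.cong refl) (simp add: mult.commute)
  also have "\<dots> = (\<Sum>i\<le>m. c i *\<^sub>R (\<Sum>A\<in>Pow {1..m}. (-1) ^ card A *\<^sub>R P i A))"
    by (subst sum.swap) (simp only: scaleR_sum_right)
  \<comment> \<open>Of the binomial expansion only the node 0 survives, and its coefficient is
    \<open>(-1) ^ m\<close>.\<close>
  also have "\<dots> = (\<Sum>i\<in>{0}. c i *\<^sub>R (\<Sum>A\<in>Pow {1..m}. (-1) ^ card A *\<^sub>R P i A))"
    by (rule sum.mono_neutral_right) (use zero in auto)
  finally show ?thesis by (simp add: c_def P_def)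
qed

lemma fdiff_alternating_sum:
  "(\<Sum>A\<in>Pow {1..k}. (-1) ^ card A *\<^sub>R f (x + real (card A) *\<^sub>R u)) = (-1) ^ k *\<^sub>R fdiff k u f x"
proof (induction k arbitrary: x)
  case (Suc k)
  have I: "{1..Suc k} = insert (Suc k) {1..k}" by auto
  have "(\<Sum>A\<in>Pow {1..Suc k}. (-1) ^ card A *\<^sub>R f (x + real (card A) *\<^sub>R u)) =
    (\<Sum>A\<in>Pow {1..k}. (-1) ^ card A *\<^sub>R (f (x + real (card A) *\<^sub>R u) - f (x + real (card (insert (Suc k) A)) *\<^sub>R u)))"
    unfolding I by (subst alternating_sum_insert) auto
  also have "\<dots> = (\<Sum>A\<in>Pow {1..k}. (-1) ^ card A *\<^sub>R f (x + real (card A) *\<^sub>R u) -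
      (-1) ^ card A *\<^sub>R f (x + u + real (card A) *\<^sub>R u))"
  proof (intro sum.cong refl)
    fix A assume "A \<in> Pow {1..k}"
    then have "finite A" "Suc k \<notin> A" by (auto intro: finite_subset)
    then have "card (insert (Suc k) A) = Suc (card A)" by simp
    then show "(-1) ^ card A *\<^sub>R (f (x + real (card A) *\<^sub>R u) - f (x + real (card (insert (Suc k) A)) *\<^sub>R u)) =
      (-1) ^ card A *\<^sub>R f (x + real (card A) *\<^sub>R u) - (-1) ^ card A *\<^sub>R f (x + u + real (card A) *\<^sub>R u)"
      by (simp add: algebra_simps)
  qed
  also have "\<dots> = (-1) ^ Suc k *\<^sub>R fdiff (Suc k) u f x"
    unfolding sum_subtractf Suc by (simp add: algebra_simps)
  finally show ?case .
qed simp

text \<open>A \<open>v\<close>-difference of a \<open>k\<close>-fold \<open>w\<close>-difference is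
  a mixed difference with increments \<open>w\<close>, ..., \<open>w\<close>, \<open>v\<close>.
  Polarization turns it into pure differences of order \<open>Suc k\<close>, which pure derivatives
  control: this is the bridge from pure to mixed derivatives.\<close>

lemma fdiff_mixed:
  fixes f :: "'a::real_vector \<Rightarrow> 'b::real_normed_vector"
  shows "norm (fdiff k w f (x + v) - fdiff k w f x) \<le>
    (\<Sum>A\<in>Pow {1..Suc k}. norm (fdiff (Suc k) (- (\<Sum>j\<in>A. (1 / real j) *\<^sub>R (if j \<le> k then w else v)))
        f (x + (\<Sum>j\<in>A. if j \<le> k then w else v))))"
proof -
  define u where "u = (\<lambda>j. if j \<le> k then w else v)"
  have I: "{1..Suc k} = insert (Suc k) {1..k}" by auto
  have "(\<Sum>A\<in>Pow {1..Suc k}. (-1) ^ card A *\<^sub>R f (x + sum u A)) =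
    (\<Sum>A\<in>Pow {1..k}. (-1) ^ card A *\<^sub>R (f (x + sum u A) - f (x + sum u (insert (Suc k) A))))"
    unfolding I by (subst alternating_sum_insert) auto
  also have "\<dots> = (\<Sum>A\<in>Pow {1..k}. (-1) ^ card A *\<^sub>R f (x + real (card A) *\<^sub>R w) -
      (-1) ^ card A *\<^sub>R f (x + v + real (card A) *\<^sub>R w))"
  proof (intro sum.cong refl)
    fix A assume A: "A \<in> Pow {1..k}"
    then have "finite A" "Suc k \<notin> A" by (auto intro: finite_subset)
    moreover have "sum u A = sum (\<lambda>_. w) A" by (rule sum.cong) (use A in \<open>auto simp: u_def\<close>)
    ultimately have "sum u A = real (card A) *\<^sub>R w" "sum u (insert (Suc k) A) = v + real (card A) *\<^sub>R w"
      by (simp_all add: u_def sum_constant_scaleR)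
    then show "(-1) ^ card A *\<^sub>R (f (x + sum u A) - f (x + sum u (insert (Suc k) A))) =
      (-1) ^ card A *\<^sub>R f (x + real (card A) *\<^sub>R w) - (-1) ^ card A *\<^sub>R f (x + v + real (card A) *\<^sub>R w)"
      by (simp add: scaleR_diff_right add.assoc)
  qed
  also have "\<dots> = (-1) ^ k *\<^sub>R fdiff k w f x - (-1) ^ k *\<^sub>R fdiff k w f (x + v)"
    unfolding sum_subtractf fdiff_alternating_sum ..
  also have "\<dots> = (-1) ^ Suc k *\<^sub>R (fdiff k w f (x + v) - fdiff k w f x)" by (simp add: algebra_simps)
  finally have "norm (fdiff k w f (x + v) - fdiff k w f x)
     = norm ((-1) ^ Suc k *\<^sub>R (\<Sum>A\<in>Pow {1..Suc k}. (-1) ^ card A *\<^sub>R f (x + sum u A)))"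
    by (simp add: power_abs)
  also have "\<dots> \<le> (\<Sum>A\<in>Pow {1..Suc k}. norm ((-1) ^ card A *\<^sub>R fdiff (Suc k) (- (\<Sum>j\<in>A. (1 / real j) *\<^sub>R u j)) f (x + sum u A)))"
    unfolding polarization_fdiff by (rule norm_sum)
  finally show ?thesis by (simp only: norm_scaleR power_abs abs_minus abs_one power_one mult_1 u_def)
qed

section \<open>Existence and symmetry of mixed derivatives\<close>

lemma ray_smooth_diff_along: "ray_smooth S f \<Longrightarrow> diff_along S v ((pdiff v ^^ k) f)"
  by (simp add: ray_smooth_def)

lemma ray_smooth_diff_along_0: "ray_smooth S f \<Longrightarrow> diff_along S v f"
  using ray_smooth_diff_along[of S f v 0] by simp

lemma ray_smooth_locally_bounded:
  assumes "open S" "ray_smooth S f" "x \<in> S" "finite D"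
  obtains r C where "r > 0" "ball x r \<subseteq> S"
    "\<And>v y. v \<in> D \<Longrightarrow> y \<in> ball x r \<Longrightarrow> norm ((pdiff v ^^ k) f y) \<le> C"
proof -
  have "\<exists>r>0. \<exists>C. ball x r \<subseteq> S \<and> (\<forall>v\<in>D. \<forall>y\<in>ball x r. norm ((pdiff v ^^ k) f y) \<le> C)"
    using assms(4)
  proof induction
    case empty
    show ?case using open_contains_ball assms by auto
  next
    case (insert v D)
    then obtain r C where r: "r > 0" "ball x r \<subseteq> S" "\<forall>v\<in>D. \<forall>y\<in>ball x r. norm ((pdiff v ^^ k) f y) \<le> C"
      by blast
    obtain r' C' where r': "r' > 0" "\<forall>y\<in>ball x r'. norm ((pdiff v ^^ k) f y) \<le> C'"
      using assms(2,3) unfolding ray_smooth_def by blast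
    show ?case
    proof (rule exI[of _ "min r r'"], intro conjI exI[of _ "max C C'"] ballI)
      show "min r r' > 0" using r r' by simp
      show "ball x (min r r') \<subseteq> S" using r(2) by auto
      fix u y assume "u \<in> insert v D" "y \<in> ball x (min r r')"
      then show "norm ((pdiff u ^^ k) f y) \<le> max C C'" using r(3) r'(2) by (auto simp: le_max_iff_disj)
    qed
  qed
  then show ?thesis using that by blast
qed

text \<open>The same \<open>h\<close> serves as the step of the differences along \<open>w\<close>
  and as the increment along \<open>v\<close>. Up to \<open>O(h ^ Suc k)\<close>,
  \<open>h ^ k\<close> times the increment of the derivative is the increment of the
  \<open>k\<close>-th difference, by \<open>fdiff_error\<close>; the latter is itself
  \<open>O(h ^ Suc k)\<close> by \<open>fdiff_mixed\<close> and \<open>fdiff_bound\<close>. Dividing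
  by \<open>h ^ k\<close> leaves \<open>O(h)\<close>.\<close>

lemma ray_smooth_Lipschitz:
  fixes f :: "'a::euclidean_space \<Rightarrow> 'b::real_normed_vector"
  assumes S: "open S" and f: "ray_smooth S f" and x0: "x0 \<in> S"
  obtains r C where "r > 0" "\<And>x h. x \<in> ball x0 r \<Longrightarrow> \<bar>h\<bar> < r \<Longrightarrow>
    norm ((pdiff w ^^ k) f (x + h *\<^sub>R v) - (pdiff w ^^ k) f x) \<le> C * \<bar>h\<bar>"
proof -
  define m where "m = Suc k"
  define u where "u = (\<lambda>j. if j \<le> k then w else v)"
  define V where "V A = - (\<Sum>j\<in>A. (1 / real j) *\<^sub>R u j)" for A
  obtain R C where R: "R > 0" "ball x0 R \<subseteq> S" and C:
    "\<And>d y. d \<in> insert w (V ` Pow {1..m}) \<Longrightarrow> y \<in> ball x0 R \<Longrightarrow> norm ((pdiff d ^^ m) f y) \<le> C"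
    using ray_smooth_locally_bounded[OF S f x0, of "insert w (V ` Pow {1..m})" m] by auto
  define Q where "Q = real m * (norm w + norm v)"
  have Q0: "Q \<ge> 0" "norm w \<le> Q" "norm v \<le> Q" "real m \<ge> 1"
    by (auto simp: Q_def m_def algebra_simps)
  have un: "norm (u j) \<le> norm w + norm v" for j by (simp add: u_def)
  have sumQ: "norm (sum u A) \<le> Q" "norm (V A) \<le> Q" if A: "A \<in> Pow {1..m}" for A
  proof -
    have cA: "card A \<le> m" using A card_mono[of "{1..m}" A] by simp
    have "norm (sum u A) \<le> (\<Sum>j\<in>A. norm w + norm v)"
      by (rule order_trans[OF norm_sum sum_mono]) (rule un)
    also have "\<dots> \<le> Q" using cA by (simp add: Q_def mult_right_mono)
    finally show "norm (sum u A) \<le> Q" .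
    have "norm (V A) \<le> (\<Sum>j\<in>A. norm w + norm v)" unfolding V_def norm_minus_cancel
    proof (rule order_trans[OF norm_sum sum_mono])
      fix j assume "j \<in> A"
      then have "1 \<le> j" using A by auto
      then have "norm ((1 / real j) *\<^sub>R u j) \<le> 1 * norm (u j)"
        unfolding norm_scaleR by (intro mult_right_mono) auto
      then show "norm ((1 / real j) *\<^sub>R u j) \<le> norm w + norm v" using un[of j] by simp
    qed
    also have "\<dots> \<le> Q" using cA by (simp add: Q_def mult_right_mono)
    finally show "norm (V A) \<le> Q" .
  qed
  \<comment> \<open>\<open>Q\<close> dominates all partial sums of increments and all polarized
    directions. With this \<open>r\<close>, a point of the ball of radius \<open>2 * r\<close> that
    is moved by at most \<open>r * ((1 + real m) * Q)\<close> stays in the ball of radius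
    \<open>R\<close>.\<close>
  define r where "r = min (R / 4) (R / (4 * (1 + (1 + real m) * Q)))"
  have den: "4 * (1 + (1 + real m) * Q) > 0" using Q0(1) by (intro mult_pos_pos add_pos_nonneg) auto
  then have r: "r > 0" using R by (simp add: r_def)
  have rr: "r \<le> R / 4" "r * ((1 + real m) * Q) \<le> R / 4"
  proof -
    have "r \<le> R / (4 * (1 + (1 + real m) * Q))" by (simp add: r_def)
    then have "r * (4 * (1 + (1 + real m) * Q)) \<le> R" using den by (simp add: pos_le_divide_eq)
    then show "r * ((1 + real m) * Q) \<le> R / 4" using r by (simp add: algebra_simps)
    show "r \<le> R / 4" unfolding r_def by (rule min.cobounded1)
  qed
  have inball: "y \<in> ball x0 R" if "x \<in> ball x0 (2 * r)" "norm (y - x) \<le> h * ((1 + real m) * Q)" "0 \<le> h" "h \<le> r" for x y h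
  proof -
    have "h * ((1 + real m) * Q) \<le> r * ((1 + real m) * Q)" using that Q0 by (intro mult_right_mono) auto
    then have "norm (y - x) \<le> R / 4" using that(2) rr(2) by linarith
    moreover have "dist x0 x < R / 2" using that rr by simp
    ultimately show ?thesis using R(1) dist_triangle[of x0 y x] by (simp add: dist_norm norm_minus_commute)
  qed
  have C0: "C \<ge> 0" using order_trans[OF norm_ge_zero C[of w x0]] R by simp
  define K where "K = 2 ^ m * C + 2 * (real k * C)"
  \<comment> \<open>Proved on the ball of radius \<open>2 * r\<close>, because the case
    \<open>h < 0\<close> is obtained below by exchanging the two end points.\<close>
  have main: "norm ((pdiff w ^^ k) f (x + h *\<^sub>R v) - (pdiff w ^^ k) f x) \<le> K * h"
    if x: "x \<in> ball x0 (2 * r)" and h: "0 < h" "h \<le> r" for x h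
  proof -
    have da: "diff_along (ball x0 R) d ((pdiff d ^^ j) f)" for d j
      using ray_smooth_diff_along[OF f] R(2) by (rule diff_along_subset)
    have e: "norm (fdiff k (h *\<^sub>R w) f y - h ^ k *\<^sub>R (pdiff w ^^ k) f y) \<le> k * C * h ^ Suc k"
      if y: "norm (y - x) \<le> h * Q" for y
    proof (rule fdiff_error[where S = "ball x0 R"])
      show "norm ((pdiff w ^^ Suc k) f z) \<le> C" if "z \<in> ball x0 R" for z
        using C[of w z] that by (simp add: m_def)
      fix s assume s: "0 \<le> s" "s \<le> k * h"
      have "norm (y + s *\<^sub>R w - x) \<le> norm (y - x) + norm (s *\<^sub>R w)"
        using norm_triangle_ineq[of "y - x" "s *\<^sub>R w"] by (simp add: algebra_simps)
      also have "norm (s *\<^sub>R w) \<le> (m * h) * Q"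
        unfolding norm_scaleR using s h Q0 by (intro mult_mono) (auto simp: m_def algebra_simps)
      finally have "norm (y + s *\<^sub>R w - x) \<le> h * ((1 + real m) * Q)"
        using y by (simp add: algebra_simps)
      then show "y + s *\<^sub>R w \<in> ball x0 R" using inball[OF x] h by simp
    qed (use h da in auto)
    have "norm (h *\<^sub>R v) \<le> h * Q" using h Q0 by (simp add: mult_left_mono)
    then have e1: "norm (fdiff k (h *\<^sub>R w) f (x + h *\<^sub>R v) - h ^ k *\<^sub>R (pdiff w ^^ k) f (x + h *\<^sub>R v)) \<le> k * C * h ^ Suc k"
      by (intro e) simp
    have e2: "norm (fdiff k (h *\<^sub>R w) f x - h ^ k *\<^sub>R (pdiff w ^^ k) f x) \<le> k * C * h ^ Suc k"
      by (intro e) (use h Q0 in simp)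
    have sc: "(if j \<le> k then h *\<^sub>R w else h *\<^sub>R v) = h *\<^sub>R u j" for j by (simp add: u_def)
    have Vh: "- (\<Sum>j\<in>A. (1 / real j) *\<^sub>R h *\<^sub>R u j) = h *\<^sub>R V A" for A
      by (simp add: V_def scaleR_sum_right scaleR_left_commute)
    have "norm (fdiff k (h *\<^sub>R w) f (x + h *\<^sub>R v) - fdiff k (h *\<^sub>R w) f x)
      \<le> (\<Sum>A\<in>Pow {1..m}. norm (fdiff m (h *\<^sub>R V A) f (x + h *\<^sub>R sum u A)))"
      using fdiff_mixed[of k "h *\<^sub>R w" f x "h *\<^sub>R v"]
      unfolding sc Vh m_def[symmetric] scaleR_sum_right[symmetric] .
    also have "\<dots> \<le> (\<Sum>A\<in>Pow {1..m}. C * h ^ m)"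
    proof (rule sum_mono)
      fix A assume A: "A \<in> Pow {1..m}"
      show "norm (fdiff m (h *\<^sub>R V A) f (x + h *\<^sub>R sum u A)) \<le> C * h ^ m"
      proof (rule fdiff_bound[where S = "ball x0 R"])
        show "norm ((pdiff (V A) ^^ m) f y) \<le> C" if "y \<in> ball x0 R" for y
          using C[of "V A" y] that A by blast
        fix s assume s: "0 \<le> s" "s \<le> m * h"
        have "norm (x + h *\<^sub>R sum u A + s *\<^sub>R V A - x) \<le> norm (h *\<^sub>R sum u A) + norm (s *\<^sub>R V A)"
          using norm_triangle_ineq[of "h *\<^sub>R sum u A" "s *\<^sub>R V A"] by (simp add: algebra_simps)
        also have "norm (h *\<^sub>R sum u A) \<le> h * Q"
          using sumQ[OF A] h by (simp add: mult_left_mono)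
        also have "norm (s *\<^sub>R V A) \<le> (m * h) * Q"
          unfolding norm_scaleR using s h Q0 sumQ[OF A] by (intro mult_mono) auto
        finally have "norm (x + h *\<^sub>R sum u A + s *\<^sub>R V A - x) \<le> h * ((1 + real m) * Q)"
          by (simp add: algebra_simps)
        then show "x + h *\<^sub>R sum u A + s *\<^sub>R V A \<in> ball x0 R" using inball[OF x] h by simp
      qed (use h da in auto)
    qed
    also have "\<dots> = 2 ^ m * C * h ^ m" by (simp add: card_Pow)
    finally have e3: "norm (fdiff k (h *\<^sub>R w) f (x + h *\<^sub>R v) - fdiff k (h *\<^sub>R w) f x) \<le> 2 ^ m * C * h ^ m" .
    define a b c d where "a = fdiff k (h *\<^sub>R w) f (x + h *\<^sub>R v)" and "b = h ^ k *\<^sub>R (pdiff w ^^ k) f (x + h *\<^sub>R v)"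
      and "c = fdiff k (h *\<^sub>R w) f x" and "d = h ^ k *\<^sub>R (pdiff w ^^ k) f x"
    have "b - d = (a - c) + (c - d) - (a - b)" by simp
    then have "norm (b - d) \<le> norm (a - c) + norm (c - d) + norm (a - b)"
      by (metis norm_triangle_ineq norm_triangle_le_diff add_mono order_refl)
    also have "\<dots> \<le> 2 ^ m * C * h ^ m + k * C * h ^ Suc k + k * C * h ^ Suc k"
      using e1 e2 e3 unfolding a_def b_def c_def d_def by (intro add_mono)
    also have "\<dots> = h ^ k * (K * h)" by (simp add: K_def m_def algebra_simps)
    finally have "h ^ k * norm ((pdiff w ^^ k) f (x + h *\<^sub>R v) - (pdiff w ^^ k) f x) \<le> h ^ k * (K * h)"
      using h by (simp add: b_def d_def flip: scaleR_diff_right)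
    then show ?thesis using h by (simp add: mult_le_cancel_left)
  qed
  define r' where "r' = min r (r / (1 + norm v))"
  have nv: "1 + norm v > 0" by (simp add: add_pos_nonneg)
  show ?thesis
  proof (rule that[of r' K])
    show "r' > 0" using r nv by (simp add: r'_def)
    fix x h assume x: "x \<in> ball x0 r'" and h: "\<bar>h\<bar> < r'"
    have xr: "x \<in> ball x0 r" using x by (simp add: r'_def)
    have hr: "\<bar>h\<bar> < r" "\<bar>h\<bar> * (1 + norm v) < r" using h nv by (simp_all add: r'_def pos_less_divide_eq)
    consider "h > 0" | "h = 0" | "h < 0" by linarith
    then show "norm ((pdiff w ^^ k) f (x + h *\<^sub>R v) - (pdiff w ^^ k) f x) \<le> K * \<bar>h\<bar>"
    proof cases
      case 1
      then show ?thesis using main[of x h] xr hr r by simp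
    next
      case 3
      define y where "y = x + h *\<^sub>R v"
      have "norm (h *\<^sub>R v) < r" using hr(2) by (simp add: algebra_simps)
      then have "dist x y < r" by (simp add: y_def dist_norm)
      then have "y \<in> ball x0 (2 * r)" using xr dist_triangle[of x0 y x] by simp
      then have "norm ((pdiff w ^^ k) f (y + (- h) *\<^sub>R v) - (pdiff w ^^ k) f y) \<le> K * (- h)"
        using 3 hr by (intro main) auto
      moreover have "y + (- h) *\<^sub>R v = x" by (simp add: y_def)
      ultimately show ?thesis using 3 by (simp add: y_def norm_minus_commute)
    qed simp
  qed
qed

text \<open>An interchange of limits. How small \<open>\<tau>\<close> must be may depend on
  \<open>s\<close>, but two values of \<open>d\<close> can be compared through a common
  \<open>\<tau>\<close>, so \<open>d\<close> is Cauchy as \<open>s\<close> tends to 0. Completeness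
  gives its limit, and \<open>Q\<close> shares it.\<close>

lemma common_limit:
  fixes Q d :: "real \<Rightarrow> 'b::banach"
  assumes "r > 0" "\<And>s. 0 < \<bar>s\<bar> \<Longrightarrow> \<bar>s\<bar> < r \<Longrightarrow> \<forall>\<^sub>F \<tau> in at 0. norm (Q \<tau> - d s) \<le> C * \<bar>s\<bar>"
  obtains l where "(Q \<longlongrightarrow> l) (at 0)" "(d \<longlongrightarrow> l) (at 0)"
proof -
  have dd: "norm (d s - d s') \<le> C * \<bar>s\<bar> + C * \<bar>s'\<bar>"
    if "0 < \<bar>s\<bar>" "\<bar>s\<bar> < r" "0 < \<bar>s'\<bar>" "\<bar>s'\<bar> < r" for s s'
  proof -
    have "\<forall>\<^sub>F \<tau> in at (0::real). norm (d s - d s') \<le> C * \<bar>s\<bar> + C * \<bar>s'\<bar>"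
      using assms(2)[OF that(1,2)] assms(2)[OF that(3,4)]
    proof eventually_elim
      case (elim \<tau>)
      have "norm (d s - d s') \<le> norm (Q \<tau> - d s) + norm (Q \<tau> - d s')"
        using norm_triangle_ineq4[of "Q \<tau> - d s'" "Q \<tau> - d s"] by simp
      then show ?case using elim by simp
    qed
    then show ?thesis by simp
  qed
  define C' where "C' = \<bar>C\<bar> + 1"
  have C': "C' > 0" "C * \<bar>s\<bar> \<le> C' * \<bar>s\<bar>" for s by (auto simp: C'_def intro: mult_right_mono)
  define e where "e n = (r / 2) * (1 / real (Suc n))" for n
  have e: "0 < e n" "e n < r" for n using assms(1) by (auto simp: e_def divide_simps)
  have e0: "e \<longlonglongrightarrow> 0"
  proof -
    have "(\<lambda>n. (r / 2) * (1 / real (Suc n))) \<longlonglongrightarrow> (r / 2) * 0"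
      by (intro tendsto_mult tendsto_const LIMSEQ_Suc[OF lim_1_over_n])
    then show ?thesis unfolding e_def[abs_def] by simp
  qed
  have "Cauchy (\<lambda>n. d (e n))"
  proof (rule metric_CauchyI)
    fix \<epsilon> :: real assume "\<epsilon> > 0"
    then have "\<forall>\<^sub>F n in sequentially. e n < \<epsilon> / (2 * C')"
      using e0 C' by (intro order_tendstoD(2)[OF e0]) simp
    then obtain N where N: "\<And>n. n \<ge> N \<Longrightarrow> e n < \<epsilon> / (2 * C')" by (auto simp: eventually_sequentially)
    have "dist (d (e m)) (d (e n)) < \<epsilon>" if "m \<ge> N" "n \<ge> N" for m n
    proof -
      have "dist (d (e m)) (d (e n)) \<le> C' * e m + C' * e n"
        using order_trans[OF dd[of "e m" "e n"] add_mono[OF C'(2)[of "e m"] C'(2)[of "e n"]]] e[of m] e[of n]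
        by (auto simp: abs_of_pos dist_norm)
      moreover have "C' * e m < \<epsilon> / 2" "C' * e n < \<epsilon> / 2"
        using N[OF that(1)] N[OF that(2)] C'(1) by (simp_all add: field_simps)
      ultimately show ?thesis by simp
    qed
    then show "\<exists>M. \<forall>m\<ge>M. \<forall>n\<ge>M. dist (d (e m)) (d (e n)) < \<epsilon>" by blast
  qed
  then obtain l where l: "(\<lambda>n. d (e n)) \<longlonglongrightarrow> l" using Cauchy_convergent convergent_def by blast
  have dl: "norm (d s - l) \<le> C' * \<bar>s\<bar>" if "0 < \<bar>s\<bar>" "\<bar>s\<bar> < r" for s
  proof (rule tendsto_le[OF sequentially_bot])
    show "(\<lambda>n. C' * \<bar>s\<bar> + C' * e n) \<longlonglongrightarrow> C' * \<bar>s\<bar>"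
      using tendsto_add[OF tendsto_const tendsto_mult[OF tendsto_const e0], of "C' * \<bar>s\<bar>" C'] by simp
    show "(\<lambda>n. norm (d s - d (e n))) \<longlonglongrightarrow> norm (d s - l)"
      by (intro tendsto_norm tendsto_diff tendsto_const l)
    show "\<forall>\<^sub>F n in sequentially. norm (d s - d (e n)) \<le> C' * \<bar>s\<bar> + C' * e n"
    proof (rule always_eventually, rule allI)
      fix n show "norm (d s - d (e n)) \<le> C' * \<bar>s\<bar> + C' * e n"
        using order_trans[OF dd[of s "e n"] add_mono[OF C'(2)[of s] C'(2)[of "e n"]]] that e[of n]
        by (auto simp: abs_of_pos)
    qed
  qed
  show ?thesis
  proof (rule that)
    show "(d \<longlongrightarrow> l) (at 0)"
    proof (rule metric_LIM_I)
      fix \<epsilon> :: real assume \<epsilon>: "\<epsilon> > 0"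
      show "\<exists>s>0. \<forall>x. x \<noteq> 0 \<and> dist x 0 < s \<longrightarrow> dist (d x) l < \<epsilon>"
      proof (intro exI[of _ "min r (\<epsilon> / C')"] conjI allI impI)
        show "min r (\<epsilon> / C') > 0" using assms(1) \<epsilon> C'(1) by simp
        fix x :: real assume x: "x \<noteq> 0 \<and> dist x 0 < min r (\<epsilon> / C')"
        then have "C' * \<bar>x\<bar> < \<epsilon>" using C'(1) by (simp add: pos_less_divide_eq mult.commute)
        then show "dist (d x) l < \<epsilon>" using dl[of x] x by (simp add: dist_norm)
      qed
    qed
    show "(Q \<longlongrightarrow> l) (at 0)"
    proof (rule tendstoI)
      fix \<epsilon> :: real assume \<epsilon>: "\<epsilon> > 0"
      define s where "s = min (r / 2) (\<epsilon> / (4 * C'))"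
      have s: "0 < s" "s < r" "C' * s \<le> \<epsilon> / 4"
        using assms(1) \<epsilon> C'(1) by (auto simp: s_def min_def field_simps)
      have "\<forall>\<^sub>F \<tau> in at 0. norm (Q \<tau> - d s) \<le> C * \<bar>s\<bar>" using s by (intro assms(2)) auto
      then show "\<forall>\<^sub>F \<tau> in at 0. dist (Q \<tau>) l < \<epsilon>"
      proof eventually_elim
        case (elim \<tau>)
        have "norm (Q \<tau> - l) \<le> norm (Q \<tau> - d s) + norm (d s - l)"
          using norm_triangle_ineq[of "Q \<tau> - d s" "d s - l"] by simp
        also have "\<dots> \<le> C' * s + C' * s"
          using add_mono[OF order_trans[OF elim C'(2)] dl[of s]] s by simp
        finally show ?case using s \<epsilon> by (simp add: dist_norm)
      qed
    qed
  qed
qed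

lemma has_vector_derivative_at_0_iff:
  fixes f :: "'a::real_vector \<Rightarrow> 'b::real_normed_vector"
  shows
  "((\<lambda>t. f (x + t *\<^sub>R v)) has_vector_derivative D) (at 0) \<longleftrightarrow>
   ((\<lambda>t. (f (x + t *\<^sub>R v) - f x) /\<^sub>R t) \<longlongrightarrow> D) (at (0::real))"
proof -
  have "((\<lambda>t. f (x + t *\<^sub>R v)) has_vector_derivative D) (at 0) \<longleftrightarrow>
    ((\<lambda>h. norm (f (x + h *\<^sub>R v) - f x - h *\<^sub>R D) / norm h) \<longlongrightarrow> 0) (at (0::real))"
    unfolding has_vector_derivative_def has_derivative_at
    by (simp add: bounded_linear_scaleR_left)
  also have "\<dots> \<longleftrightarrow> ((\<lambda>h. norm ((f (x + h *\<^sub>R v) - f x) /\<^sub>R h - D)) \<longlongrightarrow> 0) (at (0::real))"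
  proof (rule tendsto_cong)
    have "\<forall>\<^sub>F h in at (0::real). h \<noteq> 0" by (simp add: eventually_at_filter)
    then show "\<forall>\<^sub>F h in at (0::real). norm (f (x + h *\<^sub>R v) - f x - h *\<^sub>R D) / norm h
        = norm ((f (x + h *\<^sub>R v) - f x) /\<^sub>R h - D)"
    proof eventually_elim
      case (elim h)
      then have "(f (x + h *\<^sub>R v) - f x) /\<^sub>R h - D = (f (x + h *\<^sub>R v) - f x - h *\<^sub>R D) /\<^sub>R h"
        by (simp add: scaleR_diff_right)
      then show ?case by (simp add: divide_inverse_commute)
    qed
  qed
  also have "\<dots> \<longleftrightarrow> ((\<lambda>t. (f (x + t *\<^sub>R v) - f x) /\<^sub>R t) \<longlongrightarrow> D) (at (0::real))"
    unfolding tendsto_norm_zero_iff LIM_zero_iff ..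
  finally show ?thesis .
qed

text \<open>Taylor's formula along \<open>w\<close>, applied to the increment of \<open>g\<close>
  over \<open>\<tau> *\<^sub>R v\<close>, has remainder
  \<open>C * \<bar>\<tau>\<bar> * s\<^sup>2\<close>, because the second \<open>w\<close>-derivative
  is Lipschitz along \<open>v\<close>. So the difference quotients of \<open>pdiff w g\<close> along
  \<open>v\<close> and of \<open>pdiff v g\<close> along \<open>w\<close> satisfy the hypothesis of
  \<open>common_limit\<close>, which gives existence and equality of both mixed derivatives.\<close>

lemma pdiff_commute_step:
  fixes g :: "'a::euclidean_space \<Rightarrow> 'b::banach"
  assumes S: "open S" and x0: "x0 \<in> S"
    and g: "diff_along S w g" "diff_along S w (pdiff w g)" "diff_along S v g"
    and r: "r > 0" and lip: "\<And>x h. x \<in> ball x0 r \<Longrightarrow> \<bar>h\<bar> < r \<Longrightarrow>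
      norm (pdiff w (pdiff w g) (x + h *\<^sub>R v) - pdiff w (pdiff w g) x) \<le> C * \<bar>h\<bar>"
  shows "((\<lambda>t. pdiff w g (x0 + t *\<^sub>R v)) has_vector_derivative pdiff v (pdiff w g) x0) (at 0)"
    and "((\<lambda>t. pdiff v g (x0 + t *\<^sub>R w)) has_vector_derivative pdiff v (pdiff w g) x0) (at 0)"
proof -
  obtain R where R: "R > 0" "ball x0 R \<subseteq> S" "R \<le> r"
  proof -
    obtain R0 where "R0 > 0" "ball x0 R0 \<subseteq> S" using S x0 open_contains_ball by blast
    moreover have "ball x0 (min R0 r) \<subseteq> ball x0 R0" by (rule subset_ball) simp
    ultimately show ?thesis using that[of "min R0 r"] r by (meson min_less_iff_conj min.cobounded2 order_trans)
  qed
  define \<rho> where "\<rho> = R / (2 * (1 + norm v + norm w))"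
  have den: "2 * (1 + norm v + norm w) > 0" by (intro mult_pos_pos add_pos_nonneg) auto
  have \<rho>: "\<rho> > 0" using R(1) den by (simp add: \<rho>_def)
  have \<rho>R: "\<rho> * (2 * (1 + norm v + norm w)) = R" using den by (simp add: \<rho>_def)
  then have \<rho>2: "\<rho> + (\<rho> * norm v + \<rho> * norm w) = R / 2" by (simp add: algebra_simps)
  have \<rho>r: "\<rho> < r"
  proof -
    have "0 \<le> \<rho> * norm v + \<rho> * norm w" using \<rho> by simp
    then show ?thesis using \<rho>2 R(1,3) by linarith
  qed
  have inb: "x0 + s *\<^sub>R w + \<tau> *\<^sub>R v \<in> ball x0 R" if "\<bar>s\<bar> \<le> \<rho>" "\<bar>\<tau>\<bar> \<le> \<rho>" for s \<tau>
  proof -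
    have "norm (s *\<^sub>R w + \<tau> *\<^sub>R v) \<le> norm (s *\<^sub>R w) + norm (\<tau> *\<^sub>R v)" by (rule norm_triangle_ineq)
    also have "\<dots> \<le> \<rho> * norm w + \<rho> * norm v"
      unfolding norm_scaleR using that by (intro add_mono mult_right_mono) auto
    also have "\<dots> < R" using \<rho>2 \<rho> R(1) by linarith
    finally have "dist (x0 + (s *\<^sub>R w + \<tau> *\<^sub>R v)) x0 < R" by (simp add: dist_norm)
    then show ?thesis by (simp add: dist_commute add.assoc)
  qed
  \<comment> \<open>For \<open>y\<close> on this segment both \<open>y\<close> and
    \<open>y + \<tau> *\<^sub>R v\<close> lie in \<open>S\<close>. Along \<open>w\<close> the
    segment is a neighbourhood of each of its points, which is all that derivatives along
    \<open>w\<close> see.\<close>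
  define T where "T = {x0 + s *\<^sub>R w |s. \<bar>s\<bar> < \<rho>}"
  define Q where "Q \<tau> = (pdiff w g (x0 + \<tau> *\<^sub>R v) - pdiff w g x0) /\<^sub>R \<tau>" for \<tau>
  define d where "d s = (pdiff v g (x0 + s *\<^sub>R w) - pdiff v g x0) /\<^sub>R s" for s
  have taylor: "norm ((g (x0 + s *\<^sub>R w + \<tau> *\<^sub>R v) - g (x0 + s *\<^sub>R w)) - (g (x0 + \<tau> *\<^sub>R v) - g x0)
      - s *\<^sub>R (pdiff w g (x0 + \<tau> *\<^sub>R v) - pdiff w g x0)) \<le> (C * \<bar>\<tau>\<bar>) * s\<^sup>2"
    if s: "\<bar>s\<bar> < \<rho>" and \<tau>: "\<bar>\<tau>\<bar> < \<rho>" for s \<tau>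
  proof -
    define q where "q y = g (y + \<tau> *\<^sub>R v) - g y" for y
    define q1 where "q1 y = pdiff w g (y + \<tau> *\<^sub>R v) - pdiff w g y" for y
    define q2 where "q2 y = pdiff w (pdiff w g) (y + \<tau> *\<^sub>R v) - pdiff w (pdiff w g) y" for y
    have TS: "y \<in> S" "y + \<tau> *\<^sub>R v \<in> S" "y \<in> ball x0 r" if y: "y \<in> T" for y
    proof -
      obtain s where "y = x0 + s *\<^sub>R w" "\<bar>s\<bar> < \<rho>" using y by (auto simp: T_def)
      then have "y \<in> ball x0 R" "y + \<tau> *\<^sub>R v \<in> ball x0 R"
        using inb[of s 0] inb[of s \<tau>] \<tau> \<rho> by auto
      then show "y \<in> S" "y + \<tau> *\<^sub>R v \<in> S" "y \<in> ball x0 r" using R(2,3) by auto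
    qed
    have d1: "((\<lambda>t. q (y + t *\<^sub>R w)) has_vector_derivative q1 y) (at 0)" if "y \<in> T" for y
      using has_vector_derivative_diff[OF diff_along_at_0[OF g(1) TS(2)[OF that]] diff_along_at_0[OF g(1) TS(1)[OF that]]]
      by (simp add: q_def q1_def add_ac)
    have d2: "((\<lambda>t. q1 (y + t *\<^sub>R w)) has_vector_derivative q2 y) (at 0)" if "y \<in> T" for y
      using has_vector_derivative_diff[OF diff_along_at_0[OF g(2) TS(2)[OF that]] diff_along_at_0[OF g(2) TS(1)[OF that]]]
      by (simp add: q1_def q2_def add_ac)
    have p1: "pdiff w q y = q1 y" if "y \<in> T" for y using d1[OF that] by (rule pdiff_eqI)
    have d2': "((\<lambda>t. pdiff w q (y + t *\<^sub>R w)) has_vector_derivative q2 y) (at 0)" if y: "y \<in> T" for y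
    proof -
      obtain s where s: "y = x0 + s *\<^sub>R w" "\<bar>s\<bar> < \<rho>" using y by (auto simp: T_def)
      have "\<forall>\<^sub>F t in nhds 0. \<bar>s + t\<bar> < \<rho>"
      proof -
        have "((\<lambda>t. \<bar>s + t\<bar>) \<longlongrightarrow> \<bar>s + 0\<bar>) (nhds 0)" by (intro tendsto_intros filterlim_ident)
        then show ?thesis using s by (intro order_tendstoD(2)) auto
      qed
      then have "\<forall>\<^sub>F t in nhds 0. y + t *\<^sub>R w \<in> T"
        by eventually_elim (auto simp: T_def s algebra_simps intro!: exI[of _ "s + _"])
      then have ev: "\<forall>\<^sub>F t in nhds 0. t \<in> UNIV \<longrightarrow> q1 (y + t *\<^sub>R w) = pdiff w q (y + t *\<^sub>R w)"
        by eventually_elim (simp add: p1)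
      show ?thesis
        using has_vector_derivative_cong_ev[OF ev] d2[OF y] p1[OF y] by simp
    qed
    have "norm (q (x0 + s *\<^sub>R w) - q x0 - s *\<^sub>R pdiff w q x0) \<le> (C * \<bar>\<tau>\<bar>) * s\<^sup>2"
    proof (rule along_taylor[where S = T])
      show "diff_along T w q" by (rule diff_alongI) (rule d1)
      show "diff_along T w (pdiff w q)" by (rule diff_alongI) (rule d2')
      fix s' assume "\<bar>s'\<bar> \<le> \<bar>s\<bar>"
      then show T: "x0 + s' *\<^sub>R w \<in> T" using s by (auto simp: T_def)
      have "pdiff w (pdiff w q) (x0 + s' *\<^sub>R w) = q2 (x0 + s' *\<^sub>R w)" by (rule pdiff_eqI) (rule d2'[OF T])
      then show "norm (pdiff w (pdiff w q) (x0 + s' *\<^sub>R w)) \<le> C * \<bar>\<tau>\<bar>"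
        unfolding q2_def using lip[of "x0 + s' *\<^sub>R w" \<tau>] TS(3)[OF T] \<tau> \<rho>r by simp
    qed
    moreover have "x0 \<in> T" unfolding T_def using \<rho> by (intro CollectI exI[of _ 0]) auto
    ultimately show ?thesis unfolding p1[OF \<open>x0 \<in> T\<close>] by (simp add: q_def q1_def)
  qed
  \<comment> \<open>The summand 1 pays for replacing the double quotient \<open>E \<tau>\<close> by
    its limit \<open>d s\<close>, from which it differs by less than \<open>\<bar>s\<bar>\<close>
    for small \<open>\<tau>\<close>.\<close>
  have ev: "\<forall>\<^sub>F \<tau> in at 0. norm (Q \<tau> - d s) \<le> (\<bar>C\<bar> + 1) * \<bar>s\<bar>" if s: "0 < \<bar>s\<bar>" "\<bar>s\<bar> < \<rho>" for s
  proof -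
    define E where "E \<tau> = ((g (x0 + s *\<^sub>R w + \<tau> *\<^sub>R v) - g (x0 + s *\<^sub>R w)) /\<^sub>R \<tau> - (g (x0 + \<tau> *\<^sub>R v) - g x0) /\<^sub>R \<tau>) /\<^sub>R s" for \<tau>
    have "x0 + s *\<^sub>R w \<in> S" using inb[of s 0] s \<rho> R(2) by auto
    then have lim1: "((\<lambda>t. (g (x0 + s *\<^sub>R w + t *\<^sub>R v) - g (x0 + s *\<^sub>R w)) /\<^sub>R t) \<longlongrightarrow> pdiff v g (x0 + s *\<^sub>R w)) (at 0)"
      using diff_along_at_0[OF g(3)] unfolding has_vector_derivative_at_0_iff by blast
    have lim2: "((\<lambda>t. (g (x0 + t *\<^sub>R v) - g x0) /\<^sub>R t) \<longlongrightarrow> pdiff v g x0) (at 0)"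
      using diff_along_at_0[OF g(3) x0] unfolding has_vector_derivative_at_0_iff .
    have "(E \<longlongrightarrow> d s) (at 0)"
      unfolding E_def[abs_def] d_def by (intro tendsto_scaleR tendsto_const tendsto_diff lim1 lim2)
    then have "\<forall>\<^sub>F \<tau> in at 0. dist (E \<tau>) (d s) < \<bar>s\<bar>" using s(1) by (rule tendstoD)
    moreover have "\<forall>\<^sub>F \<tau> in at 0. \<bar>\<tau>\<bar> < \<rho> \<and> \<tau> \<noteq> 0"
      using \<rho> by (auto simp: eventually_at dist_norm)
    ultimately show ?thesis
    proof eventually_elim
      case (elim \<tau>)
      have "s *\<^sub>R (\<tau> *\<^sub>R (E \<tau> - Q \<tau>)) = (g (x0 + s *\<^sub>R w + \<tau> *\<^sub>R v) - g (x0 + s *\<^sub>R w)) - (g (x0 + \<tau> *\<^sub>R v) - g x0)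
      - s *\<^sub>R (pdiff w g (x0 + \<tau> *\<^sub>R v) - pdiff w g x0)"
      proof -
        have "s * (\<tau> * (inverse s * inverse \<tau>)) = (s * inverse s) * (\<tau> * inverse \<tau>)" by (simp only: mult_ac)
        also have "\<dots> = 1" using elim s by simp
        finally have "s * (\<tau> * (inverse s * inverse \<tau>)) = 1" .
        then show ?thesis using elim by (simp add: E_def Q_def scaleR_diff_right)
      qed
      then have "\<bar>s\<bar> * (\<bar>\<tau>\<bar> * norm (E \<tau> - Q \<tau>)) \<le> (C * \<bar>\<tau>\<bar>) * s\<^sup>2"
        using taylor[of s \<tau>] elim s by (metis norm_scaleR)
      also have "\<dots> = \<bar>s\<bar> * (\<bar>\<tau>\<bar> * (C * \<bar>s\<bar>))"
      proof -
        have "s\<^sup>2 = \<bar>s\<bar> * \<bar>s\<bar>" by (simp add: power2_eq_square)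
        then show ?thesis by (simp only: mult_ac)
      qed
      finally have "norm (E \<tau> - Q \<tau>) \<le> C * \<bar>s\<bar>" using elim s by (simp add: mult_le_cancel_left)
      also have "\<dots> \<le> \<bar>C\<bar> * \<bar>s\<bar>" by (intro mult_right_mono) auto
      finally have "norm (E \<tau> - Q \<tau>) \<le> \<bar>C\<bar> * \<bar>s\<bar>" .
      moreover have "norm (Q \<tau> - d s) \<le> norm (E \<tau> - d s) + norm (E \<tau> - Q \<tau>)"
        using norm_triangle_ineq4[of "E \<tau> - d s" "E \<tau> - Q \<tau>"] by simp
      ultimately show ?case using elim by (simp add: dist_norm algebra_simps)
    qed
  qed
  obtain l where l: "(Q \<longlongrightarrow> l) (at 0)" "(d \<longlongrightarrow> l) (at 0)"
    using common_limit[OF \<rho> ev] by blast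
  have 1: "((\<lambda>t. pdiff w g (x0 + t *\<^sub>R v)) has_vector_derivative l) (at 0)"
    unfolding has_vector_derivative_at_0_iff using l(1) unfolding Q_def[abs_def] .
  then have "pdiff v (pdiff w g) x0 = l" by (rule pdiff_eqI)
  moreover have "((\<lambda>t. pdiff v g (x0 + t *\<^sub>R w)) has_vector_derivative l) (at 0)"
    unfolding has_vector_derivative_at_0_iff using l(2) unfolding d_def[abs_def] .
  ultimately show "((\<lambda>t. pdiff w g (x0 + t *\<^sub>R v)) has_vector_derivative pdiff v (pdiff w g) x0) (at 0)"
    and "((\<lambda>t. pdiff v g (x0 + t *\<^sub>R w)) has_vector_derivative pdiff v (pdiff w g) x0) (at 0)"
    using 1 by simp_all
qed

text \<open>Induction on \<open>k\<close>: if the \<open>k\<close>-th \<open>w\<close>-derivative is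
  differentiable along \<open>v\<close>, then \<open>pdiff_commute_step\<close>, with the Lipschitz
  bound for order \<open>k + 2\<close>, gives the same for order \<open>k + 1\<close> and moves
  \<open>pdiff v\<close> past one more \<open>pdiff w\<close>.\<close>

lemma ray_smooth_funpow_pdiff:
  fixes f :: "'a::euclidean_space \<Rightarrow> 'b::banach"
  assumes S: "open S" and f: "ray_smooth S f"
  shows "diff_along S v ((pdiff w ^^ k) f)"
    and "x \<in> S \<Longrightarrow> (pdiff w ^^ k) (pdiff v f) x = pdiff v ((pdiff w ^^ k) f) x"
    and "diff_along S w ((pdiff w ^^ k) (pdiff v f))"
proof -
  have step: "((\<lambda>t. (pdiff w ^^ Suc k) f (x + t *\<^sub>R v)) has_vector_derivative pdiff v ((pdiff w ^^ Suc k) f) x) (at 0)"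
    "((\<lambda>t. pdiff v ((pdiff w ^^ k) f) (x + t *\<^sub>R w)) has_vector_derivative pdiff v ((pdiff w ^^ Suc k) f) x) (at 0)"
    if da: "diff_along S v ((pdiff w ^^ k) f)" and x: "x \<in> S" for k x
  proof -
    obtain r C where r: "r > 0" and lip: "\<And>y h. y \<in> ball x r \<Longrightarrow> \<bar>h\<bar> < r \<Longrightarrow>
      norm ((pdiff w ^^ Suc (Suc k)) f (y + h *\<^sub>R v) - (pdiff w ^^ Suc (Suc k)) f y) \<le> C * \<bar>h\<bar>"
      using ray_smooth_Lipschitz[OF S f x] by blast
    have "diff_along S w ((pdiff w ^^ k) f)" "diff_along S w (pdiff w ((pdiff w ^^ k) f))"
      using ray_smooth_diff_along[OF f, of w k] ray_smooth_diff_along[OF f, of w "Suc k"] by simp_all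
    from pdiff_commute_step[OF S x this da r, of C] lip
    show "((\<lambda>t. (pdiff w ^^ Suc k) f (x + t *\<^sub>R v)) has_vector_derivative pdiff v ((pdiff w ^^ Suc k) f) x) (at 0)"
      "((\<lambda>t. pdiff v ((pdiff w ^^ k) f) (x + t *\<^sub>R w)) has_vector_derivative pdiff v ((pdiff w ^^ Suc k) f) x) (at 0)"
      by simp_all
  qed
  have da: "diff_along S v ((pdiff w ^^ k) f)" for k
  proof (induction k)
    case 0 show ?case using ray_smooth_diff_along_0[OF f] by simp
  next
    case (Suc k) show ?case by (rule diff_alongI) (rule step(1)[OF Suc])
  qed
  then show "diff_along S v ((pdiff w ^^ k) f)" .
  have eq: "(pdiff w ^^ k) (pdiff v f) x = pdiff v ((pdiff w ^^ k) f) x" if "x \<in> S" for k x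
    using that
  proof (induction k arbitrary: x)
    case (Suc k)
    have "(pdiff w ^^ Suc k) (pdiff v f) x = pdiff w (pdiff v ((pdiff w ^^ k) f)) x"
      using pdiff_cong_open(2)[OF S Suc.prems Suc.IH] by simp
    also have "\<dots> = pdiff v ((pdiff w ^^ Suc k) f) x"
      by (rule pdiff_eqI) (rule step(2)[OF da Suc.prems])
    finally show ?case .
  qed simp
  then show "x \<in> S \<Longrightarrow> (pdiff w ^^ k) (pdiff v f) x = pdiff v ((pdiff w ^^ k) f) x" .
  have "diff_along S w (pdiff v ((pdiff w ^^ k) f))" for k
    by (rule diff_alongI) (rule step(2)[OF da])
  then show "diff_along S w ((pdiff w ^^ k) (pdiff v f))"
    using diff_along_cong_open[OF S, of "(pdiff w ^^ k) (pdiff v f)" "pdiff v ((pdiff w ^^ k) f)"] eq by simp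
qed

text \<open>By commutation the iterated \<open>w\<close>-derivatives of \<open>pdiff v f\<close> are
  limits of difference quotients along \<open>v\<close>, and the Lipschitz estimate bounds these
  locally. So the class contains all mixed derivatives of its members.\<close>

theorem ray_smooth_pdiff:
  fixes f :: "'a::euclidean_space \<Rightarrow> 'b::banach"
  assumes S: "open S" and f: "ray_smooth S f"
  shows "ray_smooth S (pdiff v f)"
  unfolding ray_smooth_def
proof (intro allI conjI ballI)
  fix w k
  show "diff_along S w ((pdiff w ^^ k) (pdiff v f))" by (rule ray_smooth_funpow_pdiff[OF assms])
  fix x assume x: "x \<in> S"
  obtain r C where r: "r > 0" and lip: "\<And>y h. y \<in> ball x r \<Longrightarrow> \<bar>h\<bar> < r \<Longrightarrow>
      norm ((pdiff w ^^ k) f (y + h *\<^sub>R v) - (pdiff w ^^ k) f y) \<le> C * \<bar>h\<bar>"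
    using ray_smooth_Lipschitz[OF S f x] by blast
  obtain R where R: "R > 0" "ball x R \<subseteq> S" using S x open_contains_ball by blast
  have "norm ((pdiff w ^^ k) (pdiff v f) y) \<le> C" if y: "y \<in> ball x (min r R)" for y
  proof -
    have yS: "y \<in> S" using y R by auto
    have "((\<lambda>t. ((pdiff w ^^ k) f (y + t *\<^sub>R v) - (pdiff w ^^ k) f y) /\<^sub>R t) \<longlongrightarrow> pdiff v ((pdiff w ^^ k) f) y) (at 0)"
      using diff_along_at_0[OF ray_smooth_funpow_pdiff(1)[OF S f] yS] unfolding has_vector_derivative_at_0_iff .
    then have "norm (pdiff v ((pdiff w ^^ k) f) y) \<le> C"
    proof (rule tendsto_upperbound[OF tendsto_norm])
      have "\<forall>\<^sub>F t in at 0. \<bar>t\<bar> < r \<and> t \<noteq> 0" using r by (auto simp: eventually_at dist_norm)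
      then show "\<forall>\<^sub>F t in at 0. norm (((pdiff w ^^ k) f (y + t *\<^sub>R v) - (pdiff w ^^ k) f y) /\<^sub>R t) \<le> C"
      proof eventually_elim
        case (elim t)
        then show ?case using lip[of y t] y by (simp add: divide_simps mult.commute)
      qed
    qed simp
    then show ?thesis using ray_smooth_funpow_pdiff(2)[OF S f yS] by simp
  qed
  then show "\<exists>r>0. \<exists>C. \<forall>y\<in>ball x r. norm ((pdiff w ^^ k) (pdiff v f) y) \<le> C"
    using r R by (intro exI[of _ "min r R"] conjI exI[of _ C] ballI) (simp, blast)
qed

lemma ray_smooth_pdiff_commute:
  fixes f :: "'a::euclidean_space \<Rightarrow> 'b::banach"
  assumes "open S" "ray_smooth S f" "x \<in> S"
  shows "pdiff w (pdiff v f) x = pdiff v (pdiff w f) x"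
  using ray_smooth_funpow_pdiff(2)[OF assms, where w = w and k = 1 and v = v] by simp

lemma ray_smooth_Dlist:
  fixes f :: "'a::euclidean_space \<Rightarrow> 'b::banach"
  assumes "open S" "ray_smooth S f"
  shows "ray_smooth S (Dlist ds f)"
  by (induction ds) (use assms ray_smooth_pdiff in auto)

lemma Dlist_cong_open:
  assumes "open S" "\<And>x. x \<in> S \<Longrightarrow> f x = g x" "x \<in> S"
  shows "Dlist ds f x = Dlist ds g x"
  using assms(3)
proof (induction ds arbitrary: x)
  case (Cons b ds)
  then show ?case using pdiff_cong_open(2)[OF assms(1) Cons.prems Cons.IH] by simp
qed (use assms in simp)

text \<open>\<open>mdiff\<close> differentiates in some unspecified order of its multiset; for
  ray-smooth functions this makes the choice irrelevant.\<close>

lemma Dlist_perm: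
  fixes f :: "'a::euclidean_space \<Rightarrow> 'b::banach"
  assumes S: "open S" and f: "ray_smooth S f" and "mset ds = mset ds'" "x \<in> S"
  shows "Dlist ds f x = Dlist ds' f x"
  using assms(3,4)
proof (induction ds arbitrary: ds' x)
  case (Cons b ds)
  then have "b \<in> set ds'" by (metis list.set_intros(1) set_mset_mset)
  then obtain xs ys where ds': "ds' = xs @ b # ys" by (metis split_list)
  have move: "Dlist (xs @ b # ys) f x = Dlist (b # xs @ ys) f x" if "x \<in> S" for x
    using that
  proof (induction xs arbitrary: x)
    case (Cons a xs)
    have "Dlist ((a # xs) @ b # ys) f x = pdiff a (Dlist (b # xs @ ys) f) x"
      using pdiff_cong_open(2)[OF S Cons.prems Cons.IH] by simp
    also have "\<dots> = pdiff b (pdiff a (Dlist (xs @ ys) f)) x"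
      using ray_smooth_pdiff_commute[OF S ray_smooth_Dlist[OF S f] Cons.prems] by simp
    finally show ?case by simp
  qed simp
  have "mset ds = mset (xs @ ys)" using Cons.prems(1) ds' by simp
  then have "Dlist ds f y = Dlist (xs @ ys) f y" if "y \<in> S" for y using Cons.IH that by blast
  then have "Dlist (b # ds) f x = Dlist (b # xs @ ys) f x"
    using pdiff_cong_open(2)[OF S Cons.prems(2), of "Dlist ds f" "Dlist (xs @ ys) f"] by simp
  then show ?case using move[OF Cons.prems(2)] ds' by simp
qed simp

lemma mdiff_eq_Dlist:
  fixes f :: "'a::euclidean_space \<Rightarrow> 'b::banach"
  assumes "open S" "ray_smooth S f" "x \<in> S"
  shows "mdiff (mset ds) f x = Dlist ds f x"
  unfolding mdiff_def
proof (rule Dlist_perm[OF assms(1,2) _ assms(3)])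
  show "mset (SOME ds'. mset ds' = mset ds) = mset ds" by (rule someI[of _ ds]) simp
qed

text \<open>Walking from \<open>x0\<close> to a nearby point one coordinate at a time, under bounded
  partial derivatives, gives a Lipschitz estimate at \<open>x0\<close>.\<close>

lemma ray_smooth_continuous_on:
  fixes f :: "'a::euclidean_space \<Rightarrow> 'b::real_normed_vector"
  assumes S: "open S" and f: "ray_smooth S f"
  shows "continuous_on S f"
proof (rule continuous_at_imp_continuous_on, rule ballI)
  fix x0 assume x0: "x0 \<in> S"
  obtain r C where r: "r > 0" "ball x0 r \<subseteq> S" and C:
    "\<And>v y. v \<in> Basis \<Longrightarrow> y \<in> ball x0 r \<Longrightarrow> norm ((pdiff v ^^ 1) f y) \<le> C"
    using ray_smooth_locally_bounded[OF S f x0 finite_Basis, of 1] by blast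
  have C0: "C \<ge> 0" using order_trans[OF norm_ge_zero C[OF SOME_Basis, of x0]] r by simp
  define D where "D = real DIM('a)"
  have D: "D \<ge> 1" using DIM_positive[where 'a='a] unfolding D_def by linarith
  \<comment> \<open>\<open>B\<close> is the set of coordinates already moved. Every intermediate
    point stays within \<open>D * norm z\<close> of \<open>x0\<close>, hence in the ball.\<close>
  have step: "norm (f (x0 + (\<Sum>b\<in>B. (z \<bullet> b) *\<^sub>R b)) - f x0) \<le> C * (real (card B) * norm z)"
    if "finite B" "B \<subseteq> Basis" "D * norm z < r" for z B
    using that(1,2)
  proof induction
    case (insert b B)
    define p where "p = x0 + (\<Sum>b\<in>B. (z \<bullet> b) *\<^sub>R b)"
    have zb: "\<bar>z \<bullet> b\<bar> \<le> norm z" if "b \<in> Basis" for b using Basis_le_norm that by blast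
    have "norm (f (p + (z \<bullet> b) *\<^sub>R b) - f p) \<le> C * \<bar>z \<bullet> b\<bar>"
    proof (rule along_bound_abs[where S = "ball x0 r"])
      show "diff_along (ball x0 r) b f"
        by (rule diff_along_subset[OF ray_smooth_diff_along_0[OF f] r(2)])
      fix s assume s: "\<bar>s\<bar> \<le> \<bar>z \<bullet> b\<bar>"
      have "norm (p + s *\<^sub>R b - x0) \<le> norm (\<Sum>b\<in>B. (z \<bullet> b) *\<^sub>R b) + norm (s *\<^sub>R b)"
        unfolding p_def using norm_triangle_ineq[of "\<Sum>b\<in>B. (z \<bullet> b) *\<^sub>R b" "s *\<^sub>R b"] by (simp add: algebra_simps)
      also have "norm (\<Sum>b\<in>B. (z \<bullet> b) *\<^sub>R b) \<le> (\<Sum>b\<in>B. norm z)"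
        by (rule order_trans[OF norm_sum sum_mono]) (use insert zb in auto)
      also have "norm (s *\<^sub>R b) \<le> norm z" using s zb[of b] insert.prems by simp
      also have "(\<Sum>b\<in>B. norm z) + norm z = real (card (insert b B)) * norm z"
        using insert by (simp add: algebra_simps)
      also have "\<dots> \<le> D * norm z" unfolding D_def
        using card_mono[OF finite_Basis insert.prems] by (intro mult_right_mono) auto
      finally show "p + s *\<^sub>R b \<in> ball x0 r" using that(3) by (simp add: dist_norm norm_minus_commute)
      then show "norm (pdiff b f (p + s *\<^sub>R b)) \<le> C" using C[of b] insert.prems by simp
    qed
    also have "\<dots> \<le> C * norm z" using C0 zb[of b] insert.prems by (intro mult_left_mono) auto
    finally have 1: "norm (f (p + (z \<bullet> b) *\<^sub>R b) - f p) \<le> C * norm z" .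
    have 2: "norm (f p - f x0) \<le> C * (real (card B) * norm z)" using insert unfolding p_def by simp
    have eq: "x0 + (\<Sum>b\<in>insert b B. (z \<bullet> b) *\<^sub>R b) = p + (z \<bullet> b) *\<^sub>R b"
      using insert by (simp add: p_def algebra_simps)
    show ?case unfolding eq using norm_triangle_le[OF add_mono[OF 1 2]] insert by (simp add: algebra_simps)
  qed simp
  show "isCont f x0"
    unfolding isCont_def
  proof (rule metric_LIM_I)
    fix \<epsilon> :: real assume \<epsilon>: "\<epsilon> > 0"
    show "\<exists>s>0. \<forall>x. x \<noteq> x0 \<and> dist x x0 < s \<longrightarrow> dist (f x) (f x0) < \<epsilon>"
    proof (intro exI[of _ "min (r / D) (\<epsilon> / ((C + 1) * D))"] conjI allI impI)
      show "0 < min (r / D) (\<epsilon> / ((C + 1) * D))" using r \<epsilon> C0 D by simp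
      fix x assume x: "x \<noteq> x0 \<and> dist x x0 < min (r / D) (\<epsilon> / ((C + 1) * D))"
      define z where "z = x - x0"
      have z: "D * norm z < r" "(C + 1) * (D * norm z) < \<epsilon>"
      proof -
        have "norm z < r / D" "norm z < \<epsilon> / ((C + 1) * D)" using x by (simp_all add: z_def dist_norm)
        moreover have "(C + 1) * D > 0" using C0 D by (intro mult_pos_pos) auto
        ultimately have "norm z * D < r" "norm z * ((C + 1) * D) < \<epsilon>"
          using D by (simp_all only: pos_less_divide_eq)
        then show "D * norm z < r" "(C + 1) * (D * norm z) < \<epsilon>" by (simp_all only: mult_ac)
      qed
      have "norm (f (x0 + (\<Sum>b\<in>Basis. (z \<bullet> b) *\<^sub>R b)) - f x0) \<le> C * (D * norm z)"
        using step[OF finite_Basis order_refl z(1)] by (simp add: D_def)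
      also have "\<dots> \<le> (C + 1) * (D * norm z)" using D by (intro mult_right_mono) auto
      finally show "dist (f x) (f x0) < \<epsilon>"
        using z(2) by (simp add: euclidean_representation dist_norm z_def)
    qed
  qed
qed

lemma ray_smooth_imp_smooth_on:
  fixes f :: "'a::euclidean_space \<Rightarrow> 'b::banach"
  assumes "open S" "ray_smooth S f"
  shows "smooth_on S f"
  unfolding smooth_on_def
  using ray_smooth_continuous_on[OF assms(1) ray_smooth_Dlist[OF assms]]
    ray_smooth_diff_along_0[OF ray_smooth_Dlist[OF assms]]
  by (auto simp: diff_along_def)

section \<open>Smoothness along curves\<close>

text \<open>Smoothness in the sense of convenient calculus, the form in which \<open>Ed\<close> and
  \<open>Cb\<close> supply it. Only curves that stay in \<open>S\<close> for all times are
  tested.\<close>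

definition curve_smooth :: "'a::euclidean_space set \<Rightarrow> ('a \<Rightarrow> 'b::real_normed_vector) \<Rightarrow> bool" where
  "curve_smooth S f \<longleftrightarrow> (\<forall>c. smooth_curve c \<and> (\<forall>t. c t \<in> S) \<longrightarrow> smooth_curve (\<lambda>t. f (c t)))"

lemma smooth_curve_scaleR_const:
  "smooth_curve f \<Longrightarrow> smooth_curve (\<lambda>t. f t *\<^sub>R k)"
  by (rule smooth_curve_scaleR) auto

text \<open>Termwise differentiation at every order \<open>k\<close>: the summable majorants
  \<open>M k\<close> do not depend on \<open>t\<close>, so all differentiated series converge
  uniformly.\<close>

lemma smooth_curve_series:
  fixes g :: "nat \<Rightarrow> nat \<Rightarrow> real \<Rightarrow> 'a::banach"
  assumes der: "\<And>n k t. (g n k has_vector_derivative g n (Suc k) t) (at t)"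
    and bound: "\<And>n k t. norm (g n k t) \<le> M k n" and summable: "\<And>k. summable (M k)"
  shows "smooth_curve (\<lambda>t. \<Sum>n. g n 0 t)"
proof -
  have sums: "summable (\<lambda>n. g n k t)" for k t
    by (rule summable_comparison_test'[OF summable[of k], of 0]) (use bound in auto)
  have "((\<lambda>t. \<Sum>n. g n k t) has_vector_derivative (\<Sum>n. g n (Suc k) t)) (at t)" for k t
  proof -
    have ul: "uniform_limit UNIV (\<lambda>n x. \<Sum>i<n. g i (Suc k) x) (\<lambda>x. \<Sum>i. g i (Suc k) x) sequentially"
      by (rule Weierstrass_m_test[OF bound summable])
    have "\<exists>G. \<forall>x\<in>UNIV. (\<lambda>n. g n k x) sums G x \<and>
        (G has_derivative (\<lambda>h. h *\<^sub>R (\<Sum>i. g i (Suc k) x))) (at x within UNIV)"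
    proof (rule has_derivative_series[where f' = "\<lambda>n x h. h *\<^sub>R g n (Suc k) x" and S = UNIV])
      show "(g n k has_derivative (\<lambda>h. h *\<^sub>R g n (Suc k) x)) (at x within UNIV)" for n x
        using der[of n k x] by (simp add: has_vector_derivative_def)
      show "(\<lambda>n. g n k 0) sums (\<Sum>n. g n k 0)" using sums by (rule summable_sums)
      fix e :: real assume "e > 0"
      from uniform_limitD[OF ul this]
      show "\<forall>\<^sub>F n in sequentially. \<forall>x\<in>UNIV. \<forall>h. norm ((\<Sum>i<n. h *\<^sub>R g i (Suc k) x) - h *\<^sub>R (\<Sum>i. g i (Suc k) x)) \<le> e * norm h"
      proof eventually_elim
        case (elim n)
        have "norm ((\<Sum>i<n. h *\<^sub>R g i (Suc k) x) - h *\<^sub>R (\<Sum>i. g i (Suc k) x)) \<le> e * norm h" for x h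
        proof -
          have "(\<Sum>i<n. h *\<^sub>R g i (Suc k) x) - h *\<^sub>R (\<Sum>i. g i (Suc k) x) = h *\<^sub>R ((\<Sum>i<n. g i (Suc k) x) - (\<Sum>i. g i (Suc k) x))"
            by (simp add: scaleR_sum_right scaleR_diff_right)
          moreover have "norm ((\<Sum>i<n. g i (Suc k) x) - (\<Sum>i. g i (Suc k) x)) \<le> e"
            using elim by (simp add: dist_norm less_imp_le)
          ultimately show ?thesis by (simp add: mult.commute[of e] mult_left_mono)
        qed
        then show ?case by blast
      qed
    qed auto
    then obtain G where G: "\<And>x. (\<lambda>n. g n k x) sums G x"
      "\<And>x. (G has_derivative (\<lambda>h. h *\<^sub>R (\<Sum>i. g i (Suc k) x))) (at x)" by auto
    have "G = (\<lambda>t. \<Sum>n. g n k t)" using G(1) sums_unique by blast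
    then show ?thesis using G(2)[of t] by (simp add: has_vector_derivative_def)
  qed
  then show ?thesis unfolding smooth_curve_def by (intro exI[of _ "\<lambda>k t. \<Sum>n. g n k t"]) auto
qed

text \<open>A straight line may leave \<open>S\<close>. Multiplying its parameter by a plateau keeps
  it bounded and leaves it unchanged near 0, so the resulting curve is admissible in
  \<open>curve_smooth\<close>.\<close>

lemma curve_smooth_along:
  fixes f :: "'a::euclidean_space \<Rightarrow> 'b::real_normed_vector"
  assumes S: "open S" and f: "curve_smooth S f" and x: "x \<in> S"
  obtains g r where "smooth_curve g" "r > 0" "\<And>t. \<bar>t\<bar> < r \<Longrightarrow> g t = f (x + t *\<^sub>R v)"
proof -
  obtain \<theta> :: "real \<Rightarrow> real" where \<theta>: "smooth_curve \<theta>" "\<And>t. 0 \<le> \<theta> t" "\<And>t. \<theta> t \<le> 1"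
    "\<And>t. \<bar>t\<bar> \<le> 1/2 \<Longrightarrow> \<theta> t = 1" "\<And>t. \<bar>t\<bar> \<ge> 1 \<Longrightarrow> \<theta> t = 0" by (rule smooth_plateau) blast
  obtain R where R: "R > 0" "ball x R \<subseteq> S" using S x open_contains_ball by blast
  define \<rho> where "\<rho> = R / (1 + norm v)"
  have nv: "1 + norm v > 0" by (simp add: add_pos_nonneg)
  have \<rho>: "\<rho> > 0" "\<rho> * (1 + norm v) = R" using R nv by (simp_all add: \<rho>_def)
  define c where "c t = x + (t * \<theta> (inverse \<rho> * t + 0)) *\<^sub>R v" for t
  have "smooth_curve c"
    unfolding c_def by (intro smooth_curve_add smooth_curve_scaleR_const smooth_curve_mult
      smooth_curve_affine[OF \<theta>(1)]) auto
  moreover have "c t \<in> S" for t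
  proof -
    have "\<bar>t * \<theta> (inverse \<rho> * t + 0)\<bar> \<le> \<rho>"
    proof (cases "\<bar>t\<bar> \<ge> \<rho>")
      case True
      then have "\<theta> (inverse \<rho> * t + 0) = 0" using \<rho> by (intro \<theta>(5)) (simp add: abs_mult field_simps)
      then show ?thesis using \<rho> by simp
    next
      case False
      then show ?thesis using \<theta>(2,3)[of "inverse \<rho> * t + 0"] mult_mono[of "\<bar>t\<bar>" \<rho> "\<theta> (inverse \<rho> * t + 0)" 1] \<rho>
        by (simp add: abs_mult)
    qed
    then have "norm ((t * \<theta> (inverse \<rho> * t + 0)) *\<^sub>R v) \<le> \<rho> * norm v"
      unfolding norm_scaleR by (rule mult_right_mono) simp
    also have "\<dots> < R" using \<rho> by (simp add: algebra_simps)
    finally show ?thesis using R by (auto simp: c_def dist_norm)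
  qed
  ultimately have "smooth_curve (\<lambda>t. f (c t))" using f unfolding curve_smooth_def by blast
  moreover have "f (c t) = f (x + t *\<^sub>R v)" if "\<bar>t\<bar> < \<rho> / 2" for t
  proof -
    have "\<theta> (inverse \<rho> * t + 0) = 1" using that \<rho> by (intro \<theta>(4)) (simp add: abs_mult field_simps)
    then show ?thesis by (simp add: c_def)
  qed
  ultimately show ?thesis using that[of "\<lambda>t. f (c t)" "\<rho> / 2"] \<rho> by simp
qed

text \<open>While a curve runs along a line with constant velocity, the time derivatives of its
  composition with \<open>f\<close> are rescaled pure directional derivatives. The induction over
  the order yields existence of the next derivative together with the values.\<close>

lemma iterated_derivative_along:
  fixes f :: "'a::euclidean_space \<Rightarrow> 'b::real_normed_vector"
  assumes g: "\<And>n t. (cs n has_vector_derivative cs (Suc n) t) (at t)"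
    and r: "\<And>t. \<bar>t - t0\<bar> < r \<Longrightarrow> cs 0 t = f (x + (a0 * (t - t0)) *\<^sub>R v)" and l: "a0 \<noteq> 0"
    and t: "\<bar>t - t0\<bar> < r"
  shows "cs n t = a0 ^ n *\<^sub>R (pdiff v ^^ n) f (x + (a0 * (t - t0)) *\<^sub>R v)"
    and "(\<lambda>s. (pdiff v ^^ n) f (x + (a0 * (t - t0)) *\<^sub>R v + s *\<^sub>R v)) differentiable (at 0)"
proof -
  have main: "((\<lambda>s. (pdiff v ^^ n) f (x + (a0 * (t - t0)) *\<^sub>R v + s *\<^sub>R v))
      has_vector_derivative inverse a0 ^ Suc n *\<^sub>R cs (Suc n) t) (at 0)"
    if IH: "\<And>t. \<bar>t - t0\<bar> < r \<Longrightarrow> cs n t = a0 ^ n *\<^sub>R (pdiff v ^^ n) f (x + (a0 * (t - t0)) *\<^sub>R v)"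
      and t: "\<bar>t - t0\<bar> < r" for n t
  proof -
    have "((\<lambda>s. t + inverse a0 * s) has_vector_derivative inverse a0) (at 0)"
      by (auto intro!: derivative_eq_intros)
    moreover have "(cs n has_vector_derivative cs (Suc n) t) (at (t + inverse a0 * 0))" using g by simp
    ultimately have "((\<lambda>s. cs n (t + inverse a0 * s)) has_vector_derivative inverse a0 *\<^sub>R cs (Suc n) t) (at 0)"
      by (rule vector_diff_chain_at[of "\<lambda>s. t + inverse a0 * s" _ _ "cs n", unfolded o_def])
    from bounded_linear.has_vector_derivative[OF bounded_linear_scaleR_right this, of "inverse a0 ^ n"]
    have d: "((\<lambda>s. inverse a0 ^ n *\<^sub>R cs n (t + inverse a0 * s)) has_vector_derivative inverse a0 ^ Suc n *\<^sub>R cs (Suc n) t) (at 0)"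
      by (simp add: mult.commute)
    have eq: "inverse a0 ^ n *\<^sub>R cs n (t + inverse a0 * s) = (pdiff v ^^ n) f (x + (a0 * (t - t0)) *\<^sub>R v + s *\<^sub>R v)"
      if "\<bar>t + inverse a0 * s - t0\<bar> < r" for s
    proof -
      have "a0 * (t + inverse a0 * s - t0) = a0 * (t - t0) + s" using l by (simp add: algebra_simps)
      then show ?thesis using IH[OF that] l
        by (simp add: scaleR_add_left add.assoc power_mult_distrib[symmetric])
    qed
    have "((\<lambda>s. \<bar>t + inverse a0 * s - t0\<bar>) \<longlongrightarrow> \<bar>t + inverse a0 * 0 - t0\<bar>) (nhds 0)"
      by (intro tendsto_intros filterlim_ident)
    then have "\<forall>\<^sub>F s in nhds 0. \<bar>t + inverse a0 * s - t0\<bar> < r"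
      using t by (intro order_tendstoD(2)) auto
    then have ev: "\<forall>\<^sub>F s in nhds 0. s \<in> UNIV \<longrightarrow> inverse a0 ^ n *\<^sub>R cs n (t + inverse a0 * s) = (pdiff v ^^ n) f (x + (a0 * (t - t0)) *\<^sub>R v + s *\<^sub>R v)"
      by eventually_elim (use eq in blast)
    from eventually_nhds_x_imp_x[OF ev] show ?thesis
      using has_vector_derivative_cong_ev[OF ev] d by simp
  qed
  have val: "cs n t = a0 ^ n *\<^sub>R (pdiff v ^^ n) f (x + (a0 * (t - t0)) *\<^sub>R v)" if "\<bar>t - t0\<bar> < r" for n t
    using that
  proof (induction n arbitrary: t)
    case (Suc n)
    have "pdiff v ((pdiff v ^^ n) f) (x + (a0 * (t - t0)) *\<^sub>R v) = inverse a0 ^ Suc n *\<^sub>R cs (Suc n) t"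
      by (rule pdiff_eqI) (rule main[OF Suc.IH Suc.prems])
    then show ?case using l by (simp add: power_mult_distrib[symmetric] mult_ac)
  qed (use r in simp)
  then show "cs n t = a0 ^ n *\<^sub>R (pdiff v ^^ n) f (x + (a0 * (t - t0)) *\<^sub>R v)" using t by blast
  show "(\<lambda>s. (pdiff v ^^ n) f (x + (a0 * (t - t0)) *\<^sub>R v + s *\<^sub>R v)) differentiable (at 0)"
    using main[OF val t] by (rule differentiableI_vector)
qed

section \<open>Boman's theorem\<close>

text \<open>For n \<ge> k + 1 one has n^2 - n k \<ge> n, so a geometric series dominates. In
  \<open>special_curve\<close> the k-th derivative of the n-th segment grows like the k-th power of
  the inverse width \<open>4 * 2 ^ n\<close>; the decay 2^(-n^2) of the data beats this for every
  k.\<close>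

lemma summable_power_gaussian: "summable (\<lambda>n. B * (4 * 2 ^ n) ^ k * (1/2::real) ^ (n\<^sup>2))"
proof -
  have "summable (\<lambda>n. (B * 4 ^ k) * ((2::real) ^ (n * k) * (1/2) ^ (n\<^sup>2)))"
  proof (rule summable_mult, rule summable_comparison_test'[of "\<lambda>n. (1/2) ^ n" "Suc k"])
    show "summable (\<lambda>n. (1/2::real) ^ n)" by (rule summable_geometric) simp
    fix n assume "n \<ge> Suc k"
    then have "n * (k + 1) \<le> n * n" by (intro mult_left_mono) auto
    then have "n\<^sup>2 = n * k + (n\<^sup>2 - n * k)" "n \<le> n\<^sup>2 - n * k" by (simp_all add: power2_eq_square algebra_simps)
    then have "(2::real) ^ (n * k) * (1/2) ^ (n\<^sup>2) = (2 ^ (n * k) * (1/2) ^ (n * k)) * (1/2) ^ (n\<^sup>2 - n * k)"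
      by (metis power_add mult.assoc)
    also have "(2::real) ^ (n * k) * (1/2) ^ (n * k) = 1" by (simp flip: power_mult_distrib)
    also have "1 * (1/2) ^ (n\<^sup>2 - n * k) = (1/2::real) ^ (n\<^sup>2 - n * k)" by simp
    also have "\<dots> \<le> (1/2) ^ n" using \<open>n \<le> n\<^sup>2 - n * k\<close> by (intro power_decreasing) auto
    finally show "norm ((2::real) ^ (n * k) * (1/2) ^ (n\<^sup>2)) \<le> (1/2) ^ n" by simp
  qed
  then show ?thesis by (simp add: power_mult_distrib power_mult mult_ac)
qed

text \<open>The special curve lemma: a smooth curve can follow infinitely many short line segments, the
  \<open>n\<close>-th one through \<open>x + y n\<close> with velocity \<open>\<mu> n / w n\<close> times \<open>v\<close> at time \<open>2\<^sup>-\<^sup>n\<close> with \<open>w n = 2\<^sup>-\<^sup>n / 4\<close>,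
  provided that \<open>y n\<close> and \<open>\<mu> n\<close> decrease fast enough.\<close>

lemma special_curve:
  fixes x v :: "'a::euclidean_space"
  assumes \<kappa>: "\<kappa> > 0" and y: "\<And>n. norm (y n) \<le> \<kappa> * (1/2) ^ (n\<^sup>2)"
  obtains c where "smooth_curve c" "\<And>t. norm (c t - x) \<le> 2 * \<kappa> * (1 + norm v)"
    "\<And>n t. \<bar>t - (1/2) ^ n\<bar> < (1/2) ^ n / 8 \<Longrightarrow>
       c t = x + y n + (\<kappa> * (1/2) ^ (n\<^sup>2) * (4 * 2 ^ n) * (t - (1/2) ^ n)) *\<^sub>R v"
proof -
  obtain \<theta> :: "real \<Rightarrow> real" where \<theta>: "smooth_curve \<theta>" "\<And>t. 0 \<le> \<theta> t" "\<And>t. \<theta> t \<le> 1"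
    "\<And>t. \<bar>t\<bar> \<le> 1/2 \<Longrightarrow> \<theta> t = 1" "\<And>t. \<bar>t\<bar> \<ge> 1 \<Longrightarrow> \<theta> t = 0" by (rule smooth_plateau) blast
  obtain a B where a: "a 0 = \<theta>" "\<And>n t. (a n has_vector_derivative a (Suc n) t) (at t)" "\<And>(n::nat) t. norm (a n t) \<le> B n"
    using smooth_curve_compact_support[OF \<theta>(1,5)] by blast
  have "smooth_curve (\<lambda>t. t * \<theta> t)" by (intro smooth_curve_mult \<theta>(1) smooth_curve_ident)
  then obtain a' B' where a': "a' 0 = (\<lambda>t. t * \<theta> t)" "\<And>n t. (a' n has_vector_derivative a' (Suc n) t) (at t)" "\<And>(n::nat) t. norm (a' n t) \<le> B' n"
    using smooth_curve_compact_support[of "\<lambda>t. t * \<theta> t"] \<theta>(5) by auto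
  define W where "W n = 4 * (2::real) ^ n" for n
  have W: "W n > 0" for n by (simp add: W_def)
  define z where "z n t = W n * (t - (1/2) ^ n)" for n t
  define \<mu> where "\<mu> n = \<kappa> * (1/2::real) ^ (n\<^sup>2)" for n
  have \<mu>: "\<mu> n > 0" for n using \<kappa> by (simp add: \<mu>_def)
  \<comment> \<open>The \<open>k\<close>-th derivative of the \<open>n\<close>-th summand
    \<open>\<theta> (z n t) *\<^sub>R (y n + (\<mu> n * z n t) *\<^sub>R v)\<close>:
    \<open>a\<close> and \<open>a'\<close> are the derivative sequences of the plateau and of the
    plateau times its argument, and each differentiation of \<open>z n\<close> gives a factor
    \<open>W n\<close>.\<close>
  define g where "g n k t = W n ^ k *\<^sub>R (a k (z n t) *\<^sub>R y n + (\<mu> n * a' k (z n t)) *\<^sub>R v)" for n k t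
  have zd: "(z n has_vector_derivative W n) (at t)" for n t
    unfolding z_def by (auto intro!: derivative_eq_intros)
  have comp: "((\<lambda>t. b k (z n t)) has_vector_derivative W n * b (Suc k) (z n t)) (at t)"
    if "\<And>n t. (b n has_vector_derivative b (Suc n) t) (at t)" for b :: "nat \<Rightarrow> real \<Rightarrow> real" and k n t
    using vector_diff_chain_at[OF zd that] by (simp add: o_def)
  have der: "(g n k has_vector_derivative g n (Suc k) t) (at t)" for n k t
  proof -
    have "((\<lambda>t. a k (z n t) *\<^sub>R y n) has_vector_derivative (W n * a (Suc k) (z n t)) *\<^sub>R y n) (at t)"
      by (rule bounded_linear.has_vector_derivative[OF bounded_linear_scaleR_left comp[where b = a, OF a(2)]])
    moreover have "((\<lambda>t. (\<mu> n * a' k (z n t)) *\<^sub>R v) has_vector_derivative (\<mu> n * (W n * a' (Suc k) (z n t))) *\<^sub>R v) (at t)"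
      by (rule bounded_linear.has_vector_derivative[OF bounded_linear_scaleR_left
            bounded_linear.has_vector_derivative[OF bounded_linear_mult_right comp[where b = a', OF a'(2)]]])
    ultimately have "(g n k has_vector_derivative W n ^ k *\<^sub>R ((W n * a (Suc k) (z n t)) *\<^sub>R y n
        + (\<mu> n * (W n * a' (Suc k) (z n t))) *\<^sub>R v)) (at t)"
      unfolding g_def
      by (intro bounded_linear.has_vector_derivative[OF bounded_linear_scaleR_right] has_vector_derivative_add)
    then show ?thesis by (simp add: g_def scaleR_add_right algebra_simps)
  qed
  define M where "M k n = (B k + B' k * norm v) * \<kappa> * (4 * 2 ^ n) ^ k * (1/2::real) ^ (n\<^sup>2)" for k n
  have bound: "norm (g n k t) \<le> M k n" for n k t
  proof -
    have "norm (a k (z n t) *\<^sub>R y n) \<le> B k * \<mu> n" unfolding norm_scaleR \<mu>_def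
      using a(3)[of k "z n t"] y[of n] order_trans[OF norm_ge_zero a(3)[of k "z n t"]] by (intro mult_mono) auto
    moreover have "norm ((\<mu> n * a' k (z n t)) *\<^sub>R v) \<le> (\<mu> n * B' k) * norm v"
      using a'(3)[of k "z n t"] \<mu>[of n] by (simp add: abs_mult mult_right_mono)
    ultimately have "norm (a k (z n t) *\<^sub>R y n + (\<mu> n * a' k (z n t)) *\<^sub>R v) \<le> (B k + B' k * norm v) * \<mu> n"
      using norm_triangle_le[OF add_mono] by (fastforce simp: algebra_simps)
    then have "norm (g n k t) \<le> W n ^ k * ((B k + B' k * norm v) * \<mu> n)"
      using W[of n] by (simp add: g_def mult_left_mono)
    then show ?thesis by (simp add: M_def W_def \<mu>_def mult_ac)
  qed
  have summ: "summable (M k)" for k unfolding M_def by (rule summable_power_gaussian)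
  define c where "c t = x + (\<Sum>n. g n 0 t)" for t
  have g0: "g n 0 t = \<theta> (z n t) *\<^sub>R (y n + (\<mu> n * z n t) *\<^sub>R v)" for n t
    by (simp add: g_def a(1) a'(1) algebra_simps)
  have zl: "\<bar>z n t\<bar> \<ge> 1" if "\<bar>t - (1/2) ^ n\<bar> \<ge> (1/2) ^ n / 4" for n t
  proof -
    have "1 = W n * ((1/2) ^ n / 4)" by (simp add: W_def power_mult_distrib[symmetric])
    also have "\<dots> \<le> W n * \<bar>t - (1/2) ^ n\<bar>" using that W[of n] by (intro mult_left_mono) auto
    finally show ?thesis using W[of n] by (simp add: z_def abs_mult)
  qed
  show ?thesis
  proof (rule that[of c])
    show "smooth_curve c" unfolding c_def
      by (intro smooth_curve_add smooth_curve_const smooth_curve_series[where g = g and M = M, OF der bound summ])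
  next
    fix t
    have gb: "norm (g n 0 t) \<le> \<kappa> * (1 + norm v) * (1/2) ^ n" for n
    proof (cases "\<bar>z n t\<bar> \<ge> 1")
      case True
      then show ?thesis using \<theta>(5)[OF True] \<kappa> by (simp add: g0)
    next
      case False
      have "norm (y n + (\<mu> n * z n t) *\<^sub>R v) \<le> norm (y n) + \<mu> n * \<bar>z n t\<bar> * norm v"
        using \<mu>[of n] norm_triangle_ineq[of "y n" "(\<mu> n * z n t) *\<^sub>R v"] by (simp add: abs_mult)
      also have "\<mu> n * \<bar>z n t\<bar> * norm v \<le> \<mu> n * 1 * norm v" using False \<mu>[of n]
        by (intro mult_right_mono mult_left_mono) auto
      also have "norm (y n) + \<mu> n * 1 * norm v \<le> \<mu> n * (1 + norm v)" using y[of n] by (simp add: \<mu>_def algebra_simps)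
      also have "\<dots> \<le> (\<kappa> * (1/2) ^ n) * (1 + norm v)" unfolding \<mu>_def
        using \<kappa> by (intro mult_right_mono mult_left_mono power_decreasing) (auto simp: power2_eq_square)
      finally have 1: "norm (y n + (\<mu> n * z n t) *\<^sub>R v) \<le> (\<kappa> * (1/2) ^ n) * (1 + norm v)" by simp
      have "norm (g n 0 t) \<le> 1 * norm (y n + (\<mu> n * z n t) *\<^sub>R v)"
        unfolding g0 norm_scaleR using \<theta>(2,3)[of "z n t"] by (intro mult_right_mono) auto
      then show ?thesis using 1 by (simp add: mult_ac)
    qed
    have "norm (\<Sum>n. g n 0 t) \<le> (\<Sum>n. \<kappa> * (1 + norm v) * (1/2) ^ n)"
      by (rule norm_suminf_le[OF gb]) (intro summable_mult summable_geometric, simp)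
    also have "\<dots> = \<kappa> * (1 + norm v) * (1 / (1 - 1/2))"
      by (subst suminf_mult) (auto simp: suminf_geometric intro!: summable_geometric)
    finally show "norm (c t - x) \<le> 2 * \<kappa> * (1 + norm v)" by (simp add: c_def)
  next
    fix n t assume t: "\<bar>t - (1/2) ^ n\<bar> < (1/2::real) ^ n / 8"
    have zt: "\<bar>z n t\<bar> \<le> 1/2"
    proof -
      have "W n * \<bar>t - (1/2) ^ n\<bar> \<le> W n * ((1/2) ^ n / 8)" using t W[of n] by (intro mult_left_mono) auto
      also have "\<dots> = 1/2" by (simp add: W_def power_mult_distrib[symmetric])
      finally show ?thesis using W[of n] by (simp add: z_def abs_mult)
    qed
    \<comment> \<open>The time window around each 2^(-m) has a quarter of its centre as half-width,
      so different windows do not meet.\<close>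
    have "g m 0 t = 0" if "m \<noteq> n" for m
    proof -
      have "\<bar>t - (1/2) ^ m\<bar> \<ge> (1/2) ^ m / 4"
      proof (cases "m < n")
        case True
        then have "(1/2::real) ^ n \<le> (1/2) ^ Suc m" by (intro power_decreasing) auto
        then have "(1/2::real) ^ n * 2 \<le> (1/2) ^ m" by simp
        moreover have "(1/2::real) ^ m > 0" by simp
        ultimately show ?thesis using t by linarith
      next
        case False
        then have "(1/2::real) ^ m \<le> (1/2) ^ Suc n" using that by (intro power_decreasing) auto
        then have "(1/2::real) ^ m * 2 \<le> (1/2) ^ n" by simp
        moreover have "(1/2::real) ^ n > 0" "(1/2::real) ^ m > 0" by simp_all
        ultimately show ?thesis using t by linarith
      qed
      then show ?thesis using \<theta>(5)[OF zl] by (simp add: g0)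
    qed
    then have "(\<Sum>m. g m 0 t) = (\<Sum>m\<in>{n}. g m 0 t)" by (intro suminf_finite) auto
    then have "c t = x + g n 0 t" by (simp add: c_def)
    also have "g n 0 t = y n + (\<mu> n * z n t) *\<^sub>R v" using \<theta>(4)[OF zt] by (simp add: g0)
    finally show "c t = x + y n + (\<kappa> * (1/2) ^ (n\<^sup>2) * (4 * 2 ^ n) * (t - (1/2) ^ n)) *\<^sub>R v"
      by (simp add: \<mu>_def z_def W_def mult_ac add.assoc)
  qed
qed

text \<open>If the \<open>k\<close>-th derivative along \<open>v\<close> were unbounded near
  \<open>x\<close>, there would be points \<open>p n\<close> at distance less than \<kappa> 2^(-n^2)
  where it exceeds \<open>n / L n ^ k\<close>. A special curve passes through them at times 2^(-n)
  with velocity \<open>L n *\<^sub>R v\<close>, so the \<open>k\<close>-th time derivative of the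
  composition exceeds n there, although it is continuous on [0, 1].\<close>

theorem curve_smooth_imp_ray_smooth:
  fixes f :: "'a::euclidean_space \<Rightarrow> 'b::real_normed_vector"
  assumes S: "open S" and f: "curve_smooth S f"
  shows "ray_smooth S f"
  unfolding ray_smooth_def
proof (intro allI conjI ballI)
  fix v k
  show "diff_along S v ((pdiff v ^^ k) f)"
    unfolding diff_along_def
  proof
    fix x assume x: "x \<in> S"
    obtain g r where g: "smooth_curve g" "r > 0" "\<And>t. \<bar>t\<bar> < r \<Longrightarrow> g t = f (x + t *\<^sub>R v)"
      using curve_smooth_along[OF S f x] by blast
    obtain cs where cs: "cs 0 = g" "\<And>n t. (cs n has_vector_derivative cs (Suc n) t) (at t)"
      using g(1) unfolding smooth_curve_def by blast
    show "(\<lambda>t. (pdiff v ^^ k) f (x + t *\<^sub>R v)) differentiable (at 0)"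
      using iterated_derivative_along(2)[where cs = cs, OF cs(2), of 0 r f x 1 v 0 k] g cs(1) by simp
  qed
  fix x assume x: "x \<in> S"
  show "\<exists>r>0. \<exists>C. \<forall>y\<in>ball x r. norm ((pdiff v ^^ k) f y) \<le> C"
  proof (rule ccontr)
    assume "\<not> ?thesis"
    then have unb: "\<And>r C. r > 0 \<Longrightarrow> \<exists>y\<in>ball x r. norm ((pdiff v ^^ k) f y) > C" by (meson not_less)
    obtain R where R: "R > 0" "ball x R \<subseteq> S" using S x open_contains_ball by blast
    \<comment> \<open>Makes the bound \<open>2 * \<kappa> * (1 + norm v)\<close> of
      \<open>special_curve\<close> equal to \<open>R / 2\<close>, so the curve stays in
      \<open>S\<close>.\<close>
    define \<kappa> where "\<kappa> = R / (4 * (1 + norm v))"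
    have nv: "1 + norm v > 0" by (simp add: add_pos_nonneg)
    have "R / d * d = R" if "d > 0" for d :: real using that by simp
    from this[of "4 * (1 + norm v)"] have "\<kappa> * (4 * (1 + norm v)) = R"
      using nv unfolding \<kappa>_def by (simp only: mult_pos_pos zero_less_numeral)
    moreover have "\<kappa> > 0" using R nv by (simp add: \<kappa>_def)
    ultimately have \<kappa>: "\<kappa> > 0" "2 * \<kappa> * (1 + norm v) = R / 2" by (simp_all add: algebra_simps)
    define L where "L n = \<kappa> * (1/2::real) ^ (n\<^sup>2) * (4 * 2 ^ n)" for n
    have L: "L n > 0" for n using \<kappa> by (simp add: L_def)
    have "\<exists>p\<in>ball x (\<kappa> * (1/2) ^ (n\<^sup>2)). norm ((pdiff v ^^ k) f p) > real n / L n ^ k" for n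
      using \<kappa> by (intro unb) simp
    then obtain p where p: "\<And>n. p n \<in> ball x (\<kappa> * (1/2) ^ (n\<^sup>2))"
      "\<And>n. norm ((pdiff v ^^ k) f (p n)) > real n / L n ^ k" by metis
    have "norm (p n - x) \<le> \<kappa> * (1/2) ^ (n\<^sup>2)" for n
      using p(1)[of n] by (simp add: dist_norm norm_minus_commute)
    then obtain c where c: "smooth_curve c" "\<And>t. norm (c t - x) \<le> 2 * \<kappa> * (1 + norm v)"
      "\<And>n t. \<bar>t - (1/2) ^ n\<bar> < (1/2) ^ n / 8 \<Longrightarrow>
       c t = x + (p n - x) + (\<kappa> * (1/2) ^ (n\<^sup>2) * (4 * 2 ^ n) * (t - (1/2) ^ n)) *\<^sub>R v"
      using special_curve[OF \<kappa>(1), of "\<lambda>n. p n - x" x v] by blast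
    have "c t \<in> S" for t
      using c(2)[of t] \<kappa>(2) R by (auto simp: dist_norm norm_minus_commute subset_iff)
    then have "smooth_curve (\<lambda>t. f (c t))" using f c(1) unfolding curve_smooth_def by blast
    then obtain cs where cs: "cs 0 = (\<lambda>t. f (c t))" "\<And>n t. (cs n has_vector_derivative cs (Suc n) t) (at t)"
      unfolding smooth_curve_def by blast
    have val: "cs k ((1/2) ^ n) = L n ^ k *\<^sub>R (pdiff v ^^ k) f (p n)" for n
    proof -
      have "cs 0 t = f (p n + (L n * (t - (1/2) ^ n)) *\<^sub>R v)" if "\<bar>t - (1/2) ^ n\<bar> < (1/2) ^ n / 8" for t
        using c(3)[OF that] by (simp add: cs(1) L_def)
      then show ?thesis
        using iterated_derivative_along(1)[where cs = cs, OF cs(2), of "(1/2) ^ n" "(1/2) ^ n / 8" f "p n" "L n" v "(1/2) ^ n" k] L[of n]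
        by simp
    qed
    have "continuous_on {0..1} (cs k)"
      using cs(2) has_vector_derivative_continuous continuous_at_imp_continuous_on by blast
    then have "bounded (cs k ` {0..1})" by (intro compact_imp_bounded compact_continuous_image) auto
    then obtain C where C: "\<And>t. t \<in> {0..1} \<Longrightarrow> norm (cs k t) \<le> C" unfolding bounded_iff by blast
    obtain n where n: "real n > C" using reals_Archimedean2 by blast
    have "(1/2::real) ^ n \<in> {0..1}" by (simp add: power_le_one)
    then have "L n ^ k * norm ((pdiff v ^^ k) f (p n)) \<le> C"
      using C[of "(1/2) ^ n"] L[of n] by (simp add: val)
    moreover have "real n < L n ^ k * norm ((pdiff v ^^ k) f (p n))"
      using p(2)[of n] L[of n] by (simp add: pos_divide_less_eq mult.commute)
    ultimately show False using n by simp
  qed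
qed

section \<open>Test functions and their moments\<close>

lemma smooth_on_diff_along:
  "smooth_on S f \<Longrightarrow> set ds \<subseteq> Basis \<Longrightarrow> b \<in> Basis \<Longrightarrow> diff_along S b (Dlist ds f)"
  unfolding smooth_on_def diff_along_def by blast

text \<open>Since \<open>S\<close> is open, a formula for all iterated derivatives on
  \<open>S\<close> transfers continuity and differentiability as well; the closure properties below
  supply such formulas.\<close>

lemma smooth_on_cong_Dlist:
  assumes "open S" and D: "\<And>ds x. set ds \<subseteq> Basis \<Longrightarrow> x \<in> S \<Longrightarrow> Dlist ds f x = F ds x"
    and cont: "\<And>ds. set ds \<subseteq> Basis \<Longrightarrow> continuous_on S (F ds)"
    and diff: "\<And>ds b. set ds \<subseteq> Basis \<Longrightarrow> b \<in> Basis \<Longrightarrow> diff_along S b (F ds)"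
  shows "smooth_on S f"
  unfolding smooth_on_def
proof (intro allI impI conjI)
  fix ds :: "'a list" assume ds: "set ds \<subseteq> Basis"
  show "continuous_on S (Dlist ds f)"
    using continuous_on_cong[of S S "Dlist ds f" "F ds"] D[OF ds] cont[OF ds] by simp
  show "\<forall>b\<in>Basis. \<forall>x\<in>S. (\<lambda>t. Dlist ds f (x + t *\<^sub>R b)) differentiable (at 0)"
    using diff_along_cong_open[OF assms(1), of "Dlist ds f" "F ds"] D[OF ds] diff[OF ds] unfolding diff_along_def by simp
qed

lemma Dlist_add:
  assumes S: "open S" and "smooth_on S f" "smooth_on S g"
  shows "set ds \<subseteq> Basis \<Longrightarrow> x \<in> S \<Longrightarrow> Dlist ds (\<lambda>x. f x + g x) x = Dlist ds f x + Dlist ds g x"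
    and "smooth_on S (\<lambda>x. f x + g x)"
proof -
  have der: "((\<lambda>t. Dlist ds f (x + t *\<^sub>R b) + Dlist ds g (x + t *\<^sub>R b)) has_vector_derivative
      pdiff b (Dlist ds f) x + pdiff b (Dlist ds g) x) (at 0)"
    if "set ds \<subseteq> Basis" "b \<in> Basis" "x \<in> S" for ds b x
    using diff_along_at_0[OF smooth_on_diff_along[OF assms(2) that(1,2)] that(3)]
      diff_along_at_0[OF smooth_on_diff_along[OF assms(3) that(1,2)] that(3)]
    by (rule has_vector_derivative_add)
  have D: "Dlist ds (\<lambda>x. f x + g x) x = Dlist ds f x + Dlist ds g x" if "set ds \<subseteq> Basis" "x \<in> S" for ds x
    using that
  proof (induction ds arbitrary: x)
    case (Cons b ds)
    have "Dlist (b # ds) (\<lambda>x. f x + g x) x = pdiff b (\<lambda>x. Dlist ds f x + Dlist ds g x) x"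
      using pdiff_cong_open(2)[OF S Cons.prems(2) Cons.IH] Cons.prems by simp
    also have "\<dots> = pdiff b (Dlist ds f) x + pdiff b (Dlist ds g) x"
      by (rule pdiff_eqI, rule der) (use Cons.prems in auto)
    finally show ?case by simp
  qed simp
  then show "set ds \<subseteq> Basis \<Longrightarrow> x \<in> S \<Longrightarrow> Dlist ds (\<lambda>x. f x + g x) x = Dlist ds f x + Dlist ds g x" .
  show "smooth_on S (\<lambda>x. f x + g x)"
  proof (rule smooth_on_cong_Dlist[OF S D])
    fix ds :: "'a list" assume ds: "set ds \<subseteq> Basis"
    show "continuous_on S (\<lambda>x. Dlist ds f x + Dlist ds g x)"
      using assms ds by (intro continuous_on_add) (auto simp: smooth_on_def)
    show "diff_along S b (\<lambda>x. Dlist ds f x + Dlist ds g x)" if "b \<in> Basis" for b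
      by (rule diff_alongI) (rule der[OF ds that])
  qed
qed

lemma Dlist_linear:
  assumes S: "open S" and f: "smooth_on S f" and L: "bounded_linear L"
  shows "set ds \<subseteq> Basis \<Longrightarrow> x \<in> S \<Longrightarrow> Dlist ds (\<lambda>x. L (f x)) x = L (Dlist ds f x)"
    and "smooth_on S (\<lambda>x. L (f x))"
proof -
  have der: "((\<lambda>t. L (Dlist ds f (x + t *\<^sub>R b))) has_vector_derivative L (pdiff b (Dlist ds f) x)) (at 0)"
    if "set ds \<subseteq> Basis" "b \<in> Basis" "x \<in> S" for ds b x
    using diff_along_at_0[OF smooth_on_diff_along[OF f that(1,2)] that(3)]
    by (rule bounded_linear.has_vector_derivative[OF L])
  have D: "Dlist ds (\<lambda>x. L (f x)) x = L (Dlist ds f x)" if "set ds \<subseteq> Basis" "x \<in> S" for ds x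
    using that
  proof (induction ds arbitrary: x)
    case (Cons b ds)
    have "Dlist (b # ds) (\<lambda>x. L (f x)) x = pdiff b (\<lambda>x. L (Dlist ds f x)) x"
      using pdiff_cong_open(2)[OF S Cons.prems(2) Cons.IH] Cons.prems by simp
    also have "\<dots> = L (pdiff b (Dlist ds f) x)"
      by (rule pdiff_eqI, rule der) (use Cons.prems in auto)
    finally show ?case by simp
  qed simp
  then show "set ds \<subseteq> Basis \<Longrightarrow> x \<in> S \<Longrightarrow> Dlist ds (\<lambda>x. L (f x)) x = L (Dlist ds f x)" .
  show "smooth_on S (\<lambda>x. L (f x))"
  proof (rule smooth_on_cong_Dlist[OF S D])
    fix ds :: "'a list" assume ds: "set ds \<subseteq> Basis"
    show "continuous_on S (\<lambda>x. L (Dlist ds f x))"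
      using f ds by (intro bounded_linear.continuous_on[OF L]) (auto simp: smooth_on_def)
    show "diff_along S b (\<lambda>x. L (Dlist ds f x))" if "b \<in> Basis" for b
      by (rule diff_alongI) (rule der[OF ds that])
  qed
qed

lemma Dlist_scale:
  assumes f: "smooth_on UNIV f"
  shows "set ds \<subseteq> Basis \<Longrightarrow> Dlist ds (\<lambda>x. f (a *\<^sub>R x)) x = a ^ length ds *\<^sub>R Dlist ds f (a *\<^sub>R x)"
    and "smooth_on UNIV (\<lambda>x. f (a *\<^sub>R x))"
proof -
  have der: "((\<lambda>t. k *\<^sub>R Dlist ds f (a *\<^sub>R (x + t *\<^sub>R b))) has_vector_derivative (k * a) *\<^sub>R pdiff b (Dlist ds f) (a *\<^sub>R x)) (at 0)"
    if "set ds \<subseteq> Basis" "b \<in> Basis" for ds b x k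
  proof -
    have 1: "((\<lambda>t. a * t) has_vector_derivative a) (at 0)" by (auto intro!: derivative_eq_intros)
    have "((\<lambda>t. Dlist ds f (a *\<^sub>R x + t *\<^sub>R b)) has_vector_derivative pdiff b (Dlist ds f) (a *\<^sub>R x)) (at (a * 0))"
      using diff_along_at_0[OF smooth_on_diff_along[OF f that]] by simp
    from bounded_linear.has_vector_derivative[OF bounded_linear_scaleR_right vector_diff_chain_at[OF 1 this], of k]
    show ?thesis by (simp add: o_def algebra_simps)
  qed
  have D: "Dlist ds (\<lambda>x. f (a *\<^sub>R x)) x = a ^ length ds *\<^sub>R Dlist ds f (a *\<^sub>R x)" if "set ds \<subseteq> Basis" for ds x
    using that
  proof (induction ds arbitrary: x)
    case (Cons b ds)
    have "Dlist (b # ds) (\<lambda>x. f (a *\<^sub>R x)) x = pdiff b (\<lambda>x. a ^ length ds *\<^sub>R Dlist ds f (a *\<^sub>R x)) x"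
      using pdiff_cong_open(2)[OF open_UNIV UNIV_I Cons.IH] Cons.prems by simp
    also have "\<dots> = (a ^ length ds * a) *\<^sub>R pdiff b (Dlist ds f) (a *\<^sub>R x)"
      by (rule pdiff_eqI, rule der) (use Cons.prems in auto)
    finally show ?case by (simp add: mult.commute)
  qed simp
  then show "set ds \<subseteq> Basis \<Longrightarrow> Dlist ds (\<lambda>x. f (a *\<^sub>R x)) x = a ^ length ds *\<^sub>R Dlist ds f (a *\<^sub>R x)" .
  show "smooth_on UNIV (\<lambda>x. f (a *\<^sub>R x))"
  proof (rule smooth_on_cong_Dlist[OF open_UNIV D])
    fix ds :: "'a list" assume ds: "set ds \<subseteq> Basis"
    have "continuous_on UNIV (Dlist ds f)" using f ds by (auto simp: smooth_on_def)
    then have "continuous_on UNIV (\<lambda>x. Dlist ds f (a *\<^sub>R x))"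
      by (rule continuous_on_compose2) (auto intro!: continuous_intros)
    then show "continuous_on UNIV (\<lambda>x. a ^ length ds *\<^sub>R Dlist ds f (a *\<^sub>R x))"
      by (intro continuous_intros)
    show "diff_along UNIV b (\<lambda>x. a ^ length ds *\<^sub>R Dlist ds f (a *\<^sub>R x))" if "b \<in> Basis" for b
      by (rule diff_alongI) (rule der[OF ds that])
  qed
qed

lemma Dlist_zero: "Dlist ds (\<lambda>x. 0) = (\<lambda>x. 0)"
  by (induction ds) (auto simp: pdiff_def)

lemma smooth_on_const: "smooth_on S (\<lambda>x. k)"
proof -
  have "Dlist ds (\<lambda>x. k) = (\<lambda>x. if ds = [] then k else 0)" for ds :: "'a list"
    by (induction ds) (auto simp: pdiff_def fun_eq_iff)
  then show ?thesis by (simp add: smooth_on_def)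
qed

section \<open>Supports and the space of test functions\<close>

lemma tsupp_0: "\<xi> \<notin> tsupp \<phi> \<Longrightarrow> \<phi> \<xi> = 0"
  unfolding tsupp_def using closure_subset[of "{\<xi>. \<phi> \<xi> \<noteq> 0}"] by auto

lemma tsupp_subsetI: "closed K \<Longrightarrow> (\<And>\<xi>. \<xi> \<notin> K \<Longrightarrow> \<phi> \<xi> = 0) \<Longrightarrow> tsupp \<phi> \<subseteq> K"
  unfolding tsupp_def by (rule closure_minimal) auto

lemma Dlist_outside_tsupp:
  assumes "\<xi> \<notin> tsupp \<phi>" shows "Dlist ds \<phi> \<xi> = 0"
proof -
  have "Dlist ds \<phi> \<xi> = Dlist ds (\<lambda>_. 0) \<xi>"
    by (rule Dlist_cong_open[of "- tsupp \<phi>"]) (use assms tsupp_0 in \<open>auto simp: tsupp_def\<close>)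
  then show ?thesis by (simp add: Dlist_zero)
qed

lemma test_fun_smooth: "\<phi> \<in> test_fun \<Longrightarrow> smooth_on UNIV \<phi>"
  and test_fun_compact: "\<phi> \<in> test_fun \<Longrightarrow> compact (tsupp \<phi>)"
  by (auto simp: test_fun_def)

lemma test_funI:
  assumes "smooth_on UNIV \<phi>" "compact K" "\<And>\<xi>. \<xi> \<notin> K \<Longrightarrow> \<phi> \<xi> = 0"
  shows "\<phi> \<in> test_fun"
proof -
  have "tsupp \<phi> \<subseteq> K" using assms by (intro tsupp_subsetI compact_imp_closed)
  then have "compact (tsupp \<phi>)"
    using compact_Int_closed[OF assms(2), of "tsupp \<phi>"] by (simp add: tsupp_def Int_absorb1)
  then show ?thesis using assms by (simp add: test_fun_def)
qed

lemma test_fun_add: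
  assumes "f \<in> test_fun" "g \<in> test_fun" shows "(\<lambda>\<xi>. f \<xi> + g \<xi>) \<in> test_fun"
proof (rule test_funI)
  show "smooth_on UNIV (\<lambda>\<xi>. f \<xi> + g \<xi>)"
    by (rule Dlist_add(2)[OF open_UNIV assms[THEN test_fun_smooth]])
  show "compact (tsupp f \<union> tsupp g)" using assms test_fun_compact by blast
qed (simp add: tsupp_0)

lemma test_fun_cmult:
  assumes "f \<in> test_fun" shows "(\<lambda>\<xi>. k * f \<xi>) \<in> test_fun"
proof (rule test_funI)
  show "smooth_on UNIV (\<lambda>\<xi>. k * f \<xi>)"
    by (rule Dlist_linear(2)[OF open_UNIV test_fun_smooth[OF assms] bounded_linear_mult_right])
  show "compact (tsupp f)" using assms by (rule test_fun_compact)
qed (simp add: tsupp_0)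

lemma test_fun_sum:
  "(\<And>i. i \<in> I \<Longrightarrow> f i \<in> test_fun) \<Longrightarrow> (\<lambda>\<xi>. \<Sum>i\<in>I. f i \<xi>) \<in> test_fun"
proof (induction I rule: infinite_finite_induct)
  case empty
  show ?case by (rule test_funI[where K = "{}"]) (auto intro: smooth_on_const)
next
  case (infinite I)
  have "(\<lambda>\<xi>::'b. 0) \<in> test_fun" by (rule test_funI[where K = "{}"]) (auto intro: smooth_on_const)
  then show ?case using infinite by simp
qed (auto intro: test_fun_add)

lemma Dlist_test_add:
  "f \<in> test_fun \<Longrightarrow> g \<in> test_fun \<Longrightarrow> set ds \<subseteq> Basis \<Longrightarrow>
    Dlist ds (\<lambda>\<xi>. f \<xi> + g \<xi>) = (\<lambda>\<xi>. Dlist ds f \<xi> + Dlist ds g \<xi>)"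
  by (rule ext) (rule Dlist_add(1)[OF open_UNIV test_fun_smooth test_fun_smooth _ UNIV_I])

lemma Dlist_test_cmult:
  "f \<in> test_fun \<Longrightarrow> set ds \<subseteq> Basis \<Longrightarrow> Dlist ds (\<lambda>\<xi>. k * f \<xi>) = (\<lambda>\<xi>. k * Dlist ds f \<xi>)"
  by (rule ext) (rule Dlist_linear(1)[OF open_UNIV test_fun_smooth bounded_linear_mult_right _ UNIV_I])

lemma test_fun_Dlist_continuous:
  "f \<in> test_fun \<Longrightarrow> set ds \<subseteq> Basis \<Longrightarrow> continuous_on S (Dlist ds f)"
  using test_fun_smooth unfolding smooth_on_def by (meson continuous_on_subset subset_UNIV)

lemma test_fun_continuous: "f \<in> test_fun \<Longrightarrow> continuous_on S f"
  using test_fun_Dlist_continuous[of f "[]"] by simp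

lemma test_fun_Dlist_bounded:
  assumes "f \<in> test_fun" "set ds \<subseteq> Basis"
  obtains C where "C \<ge> 0" "\<And>\<xi>. norm (Dlist ds f \<xi>) \<le> C"
proof -
  have "bounded (Dlist ds f ` tsupp f)"
    by (intro compact_imp_bounded compact_continuous_image test_fun_Dlist_continuous test_fun_compact assms)
  then obtain C where C: "\<And>\<xi>. \<xi> \<in> tsupp f \<Longrightarrow> norm (Dlist ds f \<xi>) \<le> C"
    unfolding bounded_iff by blast
  have "norm (Dlist ds f \<xi>) \<le> max C 0" for \<xi>
    using C[of \<xi>] Dlist_outside_tsupp[of \<xi> f ds] by (cases "\<xi> \<in> tsupp f") auto
  then show ?thesis using that[of "max C 0"] by simp
qed

subsection \<open>Moments\<close>

lemma monom_add_mset: "monom (add_mset b \<beta>) \<xi> = complex_of_real (\<xi> \<bullet> b) * monom \<beta> \<xi>"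
  by (simp add: monom_def)

lemma monom_empty [simp]: "monom {#} \<xi> = 1"
  by (simp add: monom_def)

lemma continuous_on_monom: "continuous_on S (monom \<beta>)"
proof (induction \<beta>)
  case empty
  have "monom ({#} :: 'a multiset) = (\<lambda>\<xi>. 1)" by auto
  then show ?case by simp
next
  case (add b \<beta>)
  have "monom (add_mset b \<beta>) = (\<lambda>\<xi>. complex_of_real (\<xi> \<bullet> b) * monom \<beta> \<xi>)" by (auto simp: monom_add_mset)
  then show ?case using add by (auto intro!: continuous_intros)
qed

definition moment :: "'a::euclidean_space multiset \<Rightarrow> ('a \<Rightarrow> complex) \<Rightarrow> complex" where
  "moment \<beta> f = integral UNIV (\<lambda>\<xi>. monom \<beta> \<xi> * f \<xi>)"

lemma has_integral_compact_support:
  fixes g :: "'a::euclidean_space \<Rightarrow> complex"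
  assumes "continuous_on UNIV g" "\<And>\<xi>. \<xi> \<notin> cbox a b \<Longrightarrow> g \<xi> = 0"
  shows "(g has_integral integral (cbox a b) g) UNIV"
proof -
  have "(g has_integral integral (cbox a b) g) (cbox a b)"
    using assms(1) by (intro integrable_integral integrable_continuous) (auto intro: continuous_on_subset)
  then show ?thesis by (rule has_integral_on_superset) (use assms in auto)
qed

lemma compact_support_box:
  fixes K :: "'a::euclidean_space set"
  assumes "compact K" obtains a b :: 'a where "K \<subseteq> cbox a b"
  using assms bounded_subset_cbox_symmetric compact_imp_bounded by metis

lemma moment_integrable:
  assumes "f \<in> test_fun" shows "(\<lambda>\<xi>. monom \<beta> \<xi> * f \<xi>) integrable_on UNIV"
proof -
  obtain a b where ab: "tsupp f \<subseteq> cbox a b" using compact_support_box test_fun_compact[OF assms] by metis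
  have "((\<lambda>\<xi>. monom \<beta> \<xi> * f \<xi>) has_integral integral (cbox a b) (\<lambda>\<xi>. monom \<beta> \<xi> * f \<xi>)) UNIV"
    by (rule has_integral_compact_support)
      (use ab tsupp_0[of _ f] in \<open>auto intro!: continuous_intros continuous_on_monom test_fun_continuous[OF assms]\<close>)
  then show ?thesis by (rule has_integral_integrable)
qed

lemma moment_add: "f \<in> test_fun \<Longrightarrow> g \<in> test_fun \<Longrightarrow> moment \<beta> (\<lambda>\<xi>. f \<xi> + g \<xi>) = moment \<beta> f + moment \<beta> g"
  unfolding moment_def distrib_left by (intro integral_add moment_integrable)

lemma moment_cmult: "moment \<beta> (\<lambda>\<xi>. k * f \<xi>) = k * moment \<beta> f"
proof -
  have "moment \<beta> (\<lambda>\<xi>. k * f \<xi>) = integral UNIV (\<lambda>\<xi>. k * (monom \<beta> \<xi> * f \<xi>))"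
    unfolding moment_def by (simp add: mult_ac)
  then show ?thesis by (simp add: moment_def)
qed

lemma moment_sum:
  "(\<And>i. i \<in> I \<Longrightarrow> f i \<in> test_fun) \<Longrightarrow> moment \<beta> (\<lambda>\<xi>. \<Sum>i\<in>I. f i \<xi>) = (\<Sum>i\<in>I. moment \<beta> (f i))"
proof (induction I rule: infinite_finite_induct)
  case (insert i I)
  then have "moment \<beta> (\<lambda>\<xi>. f i \<xi> + (\<Sum>i\<in>I. f i \<xi>)) = moment \<beta> (f i) + moment \<beta> (\<lambda>\<xi>. \<Sum>i\<in>I. f i \<xi>)"
    by (intro moment_add test_fun_sum) auto
  then show ?case using insert by simp
qed (auto simp: moment_def)

text \<open>The constant is a bound of the monomial on a box around \<open>K\<close> times the
  volume of the box. That it serves all test functions supported in \<open>K\<close> is what limits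
  of moments and moments of families require.\<close>

lemma moment_bound:
  fixes K :: "'a::euclidean_space set"
  assumes "compact K"
  obtains M where "M \<ge> 0" "\<And>f C. f \<in> test_fun \<Longrightarrow> tsupp f \<subseteq> K \<Longrightarrow> (\<And>\<xi>. norm (f \<xi>) \<le> C) \<Longrightarrow> norm (moment \<beta> f) \<le> M * C"
proof -
  obtain a b where ab: "K \<subseteq> cbox a b" using compact_support_box[OF assms] by metis
  have "bounded (monom \<beta> ` cbox a b)"
    by (intro compact_imp_bounded compact_continuous_image continuous_on_monom compact_cbox)
  then obtain B0 where "\<And>\<xi>. \<xi> \<in> cbox a b \<Longrightarrow> norm (monom \<beta> \<xi>) \<le> B0" unfolding bounded_iff by blast
  then have B: "\<And>\<xi>. \<xi> \<in> cbox a b \<Longrightarrow> norm (monom \<beta> \<xi>) \<le> max B0 0" by (meson le_max_iff_disj)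
  show ?thesis
  proof (rule that[of "max B0 0 * measure lborel (cbox a b)"])
    fix f :: "'a \<Rightarrow> complex" and C assume f: "f \<in> test_fun" "tsupp f \<subseteq> K" "\<And>\<xi>. norm (f \<xi>) \<le> C"
    have C: "C \<ge> 0" using order_trans[OF norm_ge_zero f(3)] by blast
    have c: "continuous_on S (\<lambda>\<xi>. monom \<beta> \<xi> * f \<xi>)" for S
      by (intro continuous_intros continuous_on_monom test_fun_continuous f)
    have "((\<lambda>\<xi>. monom \<beta> \<xi> * f \<xi>) has_integral integral (cbox a b) (\<lambda>\<xi>. monom \<beta> \<xi> * f \<xi>)) UNIV"
      by (rule has_integral_compact_support[OF c]) (use ab f(2) tsupp_0[of _ f] in auto)
    then have "moment \<beta> f = integral (cbox a b) (\<lambda>\<xi>. monom \<beta> \<xi> * f \<xi>)" unfolding moment_def by (rule integral_unique)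
    also have "norm \<dots> \<le> (max B0 0 * C) * measure lborel (cbox a b)"
    proof (rule has_integral_bound)
      show "((\<lambda>\<xi>. monom \<beta> \<xi> * f \<xi>) has_integral integral (cbox a b) (\<lambda>\<xi>. monom \<beta> \<xi> * f \<xi>)) (cbox a b)"
        by (intro integrable_integral integrable_continuous c)
      show "norm (monom \<beta> \<xi> * f \<xi>) \<le> max B0 0 * C" if "\<xi> \<in> cbox a b" for \<xi>
        unfolding norm_mult using B[OF that] f(3)[of \<xi>] C by (intro mult_mono) auto
    qed (use C in auto)
    finally show "norm (moment \<beta> f) \<le> max B0 0 * measure lborel (cbox a b) * C" by (simp add: mult_ac)
  qed simp
qed

lemma A_iff_moments:
  "\<phi> \<in> A q \<longleftrightarrow> \<phi> \<in> test_fun \<and> moment {#} \<phi> = 1 \<and>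
    (\<forall>\<beta>. multi_index \<beta> \<and> 1 \<le> size \<beta> \<and> size \<beta> \<le> q \<longrightarrow> moment \<beta> \<phi> = 0)"
  by (simp add: A_def moment_def)

lemma A_mono: "A q \<subseteq> A 0"
  by (auto simp: A_def)

subsection \<open>Curves of test functions\<close>

lemma test_fun_quotient:
  "f \<in> test_fun \<Longrightarrow> g \<in> test_fun \<Longrightarrow> (\<lambda>\<xi>. (f \<xi> - g \<xi>) / k) \<in> test_fun"
proof -
  assume "f \<in> test_fun" "g \<in> test_fun"
  then have "(\<lambda>\<xi>. inverse k * (f \<xi> + (-1) * g \<xi>)) \<in> test_fun" by (intro test_fun_cmult test_fun_add)
  then show ?thesis by (simp add: divide_inverse mult.commute)
qed

lemma D_tendsto_uniform_limit: "D_tendsto g L F \<Longrightarrow> uniform_limit UNIV g L F"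
  unfolding D_tendsto_def by (elim conjE) (drule spec[of _ "[]"], simp)

text \<open>The differences \<open>g h - L\<close> eventually have their supports in one compact set
  and are uniformly small, so \<open>moment_bound\<close> makes their moments small.\<close>

lemma D_tendsto_moment:
  assumes "D_tendsto g L F" "\<And>h. g h \<in> test_fun"
  shows "((\<lambda>h. moment \<beta> (g h)) \<longlongrightarrow> moment \<beta> L) F"
proof -
  obtain K where K: "compact K" "\<forall>\<^sub>F h in F. tsupp (g h) \<subseteq> K" and L: "L \<in> test_fun"
    using assms(1) unfolding D_tendsto_def by blast
  obtain M where M: "M \<ge> 0" "\<And>f C. f \<in> test_fun \<Longrightarrow> tsupp f \<subseteq> K \<union> tsupp L \<Longrightarrow> (\<And>\<xi>. norm (f \<xi>) \<le> C) \<Longrightarrow> norm (moment \<beta> f) \<le> M * C"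
    using moment_bound[of "K \<union> tsupp L" \<beta>] K(1) test_fun_compact[OF L] by (metis compact_Un)
  have ul: "uniform_limit UNIV g L F" by (rule D_tendsto_uniform_limit[OF assms(1)])
  show ?thesis
  proof (rule tendstoI)
    fix e :: real assume e: "e > 0"
    then have "e / (M + 1) > 0" using M(1) by simp
    from uniform_limitD[OF ul this] K(2)
    show "\<forall>\<^sub>F h in F. dist (moment \<beta> (g h)) (moment \<beta> L) < e"
    proof eventually_elim
      case (elim h)
      have "norm (moment \<beta> (\<lambda>\<xi>. g h \<xi> + (-1) * L \<xi>)) \<le> M * (e / (M + 1))"
      proof (rule M(2))
        show "(\<lambda>\<xi>. g h \<xi> + (-1) * L \<xi>) \<in> test_fun" by (intro test_fun_add test_fun_cmult assms L)
        show "tsupp (\<lambda>\<xi>. g h \<xi> + (-1) * L \<xi>) \<subseteq> K \<union> tsupp L"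
          by (rule tsupp_subsetI)
            (use K(1) L elim tsupp_0[of _ "g h"] tsupp_0[of _ L] test_fun_compact in \<open>auto intro!: compact_imp_closed compact_Un\<close>)
        show "norm (g h \<xi> + (-1) * L \<xi>) \<le> e / (M + 1)" for \<xi>
          using elim by (simp add: dist_norm less_imp_le)
      qed
      also have "\<dots> < e" using M(1) e by (simp add: field_simps)
      finally show ?case
        using moment_add[OF assms(2)[of h] test_fun_cmult[OF L], of \<beta> "-1"] moment_cmult[of \<beta> "-1" L]
        by (simp add: dist_norm)
    qed
  qed
qed

text \<open>Moments are continuous linear functionals on the test functions, so they commute with
  the limits of difference quotients at every order.\<close>

lemma smooth_D_curve_moment:
  assumes "smooth_D_curve c" shows "smooth_curve (\<lambda>t. moment \<beta> (c t))"
proof -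
  obtain cs where cs: "cs 0 = c" "\<And>n t. cs n t \<in> test_fun"
     "\<And>n t. D_tendsto (\<lambda>h. (\<lambda>\<xi>. (cs n (t + h) \<xi> - cs n t \<xi>) / complex_of_real h)) (cs (Suc n) t) (at 0)"
    using assms unfolding smooth_D_curve_def by blast
  have "((\<lambda>t. moment \<beta> (cs n t)) has_vector_derivative moment \<beta> (cs (Suc n) t)) (at t)" for n t
  proof -
    have "((\<lambda>h. moment \<beta> (\<lambda>\<xi>. (cs n (t + h) \<xi> - cs n t \<xi>) / complex_of_real h)) \<longlongrightarrow> moment \<beta> (cs (Suc n) t)) (at 0)"
      by (rule D_tendsto_moment[OF cs(3)]) (intro test_fun_quotient cs)
    moreover have "moment \<beta> (\<lambda>\<xi>. (cs n (t + h) \<xi> - cs n t \<xi>) / complex_of_real h)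
        = (moment \<beta> (cs n (t + h)) - moment \<beta> (cs n t)) /\<^sub>R h" for h
    proof -
      have "moment \<beta> (\<lambda>\<xi>. (cs n (t + h) \<xi> - cs n t \<xi>) / complex_of_real h)
          = moment \<beta> (\<lambda>\<xi>. complex_of_real (inverse h) * (cs n (t + h) \<xi> + (-1) * cs n t \<xi>))"
        by (simp add: divide_inverse mult.commute)
      also have "\<dots> = complex_of_real (inverse h) * (moment \<beta> (cs n (t + h)) + (-1) * moment \<beta> (cs n t))"
        unfolding moment_cmult by (subst moment_add) (auto intro: cs test_fun_cmult simp only: moment_cmult)
      finally show ?thesis by (simp add: scaleR_conv_of_real)
    qed
    ultimately have "((\<lambda>h. (moment \<beta> (cs n (t + h *\<^sub>R 1)) - moment \<beta> (cs n t)) /\<^sub>R h) \<longlongrightarrow> moment \<beta> (cs (Suc n) t)) (at 0)"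
      by simp
    then have "((\<lambda>h. moment \<beta> (cs n (t + h *\<^sub>R 1))) has_vector_derivative moment \<beta> (cs (Suc n) t)) (at (t + - t))"
      using has_vector_derivative_at_0_iff[of "\<lambda>t. moment \<beta> (cs n t)" t 1] by simp
    from has_vector_derivative_shift[OF this] show ?thesis by simp
  qed
  then show ?thesis unfolding smooth_curve_def by (intro exI[of _ "\<lambda>n t. moment \<beta> (cs n t)"]) (simp add: cs(1))
qed

lemma smooth_D_curve_eval:
  assumes "smooth_D_curve c" shows "smooth_curve (\<lambda>t. c t \<xi>)"
proof -
  obtain cs where cs: "cs 0 = c" "\<And>n t. cs n t \<in> test_fun"
     "\<And>n t. D_tendsto (\<lambda>h. (\<lambda>\<xi>. (cs n (t + h) \<xi> - cs n t \<xi>) / complex_of_real h)) (cs (Suc n) t) (at 0)"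
    using assms unfolding smooth_D_curve_def by blast
  have "((\<lambda>t. cs n t \<xi>) has_vector_derivative cs (Suc n) t \<xi>) (at t)" for n t
  proof -
    have "((\<lambda>h. (cs n (t + h) \<xi> - cs n t \<xi>) / complex_of_real h) \<longlongrightarrow> cs (Suc n) t \<xi>) (at 0)"
      by (rule tendsto_uniform_limitI[OF D_tendsto_uniform_limit[OF cs(3)] UNIV_I])
    then have "((\<lambda>h. (cs n (t + h *\<^sub>R 1) \<xi> - cs n t \<xi>) /\<^sub>R h) \<longlongrightarrow> cs (Suc n) t \<xi>) (at 0)"
      by (simp add: scaleR_conv_of_real divide_inverse mult.commute)
    then have "((\<lambda>h. cs n (t + h *\<^sub>R 1) \<xi>) has_vector_derivative cs (Suc n) t \<xi>) (at (t + - t))"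
      using has_vector_derivative_at_0_iff[of "\<lambda>t. cs n t \<xi>" t 1] by simp
    from has_vector_derivative_shift[OF this] show ?thesis by simp
  qed
  then show ?thesis unfolding smooth_curve_def by (intro exI[of _ "\<lambda>n t. cs n t \<xi>"]) (simp add: cs(1))
qed

text \<open>The difference quotient splits into that of \<open>c\<close> and a convergent scalar
  quotient times the fixed \<open>\<psi>\<close>, whose derivatives are bounded. Corrections of
  families by moments have this form.\<close>

lemma smooth_D_curve_add_scaled:
  assumes "smooth_D_curve c" "smooth_curve \<mu>" and \<psi>: "\<psi> \<in> test_fun"
  shows "smooth_D_curve (\<lambda>t \<xi>. c t \<xi> + \<mu> t * \<psi> \<xi>)"
proof -
  obtain cs where cs: "cs 0 = c" "\<And>n t. cs n t \<in> test_fun"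
     "\<And>n t. D_tendsto (\<lambda>h. (\<lambda>\<xi>. (cs n (t + h) \<xi> - cs n t \<xi>) / complex_of_real h)) (cs (Suc n) t) (at 0)"
    using assms(1) unfolding smooth_D_curve_def by blast
  obtain ms where ms: "ms 0 = \<mu>" "\<And>n t. (ms n has_vector_derivative ms (Suc n) t) (at t)"
    using assms(2) unfolding smooth_curve_def by blast
  have "D_tendsto (\<lambda>h \<xi>. ((cs n (t + h) \<xi> + ms n (t + h) * \<psi> \<xi>) - (cs n t \<xi> + ms n t * \<psi> \<xi>)) / complex_of_real h)
      (\<lambda>\<xi>. cs (Suc n) t \<xi> + ms (Suc n) t * \<psi> \<xi>) (at 0)" for n t
  proof -
    define q where "q h \<xi> = (cs n (t + h) \<xi> - cs n t \<xi>) / complex_of_real h" for h \<xi>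
    define k where "k h = (ms n (t + h) - ms n t) / complex_of_real h" for h
    have split: "((cs n (t + h) \<xi> + ms n (t + h) * \<psi> \<xi>) - (cs n t \<xi> + ms n t * \<psi> \<xi>)) / complex_of_real h
        = q h \<xi> + k h * \<psi> \<xi>" for h \<xi>
      by (simp add: q_def k_def divide_inverse algebra_simps)
    have q: "q h \<in> test_fun" for h unfolding q_def by (intro test_fun_quotient cs)
    have qD: "D_tendsto q (cs (Suc n) t) (at 0)" using cs(3)[of n t] by (simp add: q_def[abs_def])
    have k: "(k \<longlongrightarrow> ms (Suc n) t) (at 0)"
    proof -
      have "((\<lambda>h. ms n (h + t)) has_vector_derivative ms (Suc n) t) (at 0)"
        by (rule has_vector_derivative_shift) (simp add: ms)
      then have "((\<lambda>h. ms n (t + h *\<^sub>R 1)) has_vector_derivative ms (Suc n) t) (at 0)" by (simp add: add.commute)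
      then show ?thesis
        unfolding has_vector_derivative_at_0_iff by (simp add: k_def[abs_def] scaleR_conv_of_real divide_inverse mult.commute)
    qed
    show ?thesis unfolding split D_tendsto_def
    proof (intro conjI allI impI)
      show "(\<lambda>\<xi>. cs (Suc n) t \<xi> + ms (Suc n) t * \<psi> \<xi>) \<in> test_fun"
        by (intro test_fun_add test_fun_cmult cs \<psi>)
      obtain K where K: "compact K" "\<forall>\<^sub>F h in at 0. tsupp (q h) \<subseteq> K" using qD unfolding D_tendsto_def by blast
      show "\<exists>K. compact K \<and> (\<forall>\<^sub>F h in at 0. tsupp (\<lambda>\<xi>. q h \<xi> + k h * \<psi> \<xi>) \<subseteq> K)"
      proof (intro exI conjI)
        show "compact (K \<union> tsupp \<psi>)" by (rule compact_Un[OF K(1) test_fun_compact[OF \<psi>]])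
        show "\<forall>\<^sub>F h in at 0. tsupp (\<lambda>\<xi>. q h \<xi> + k h * \<psi> \<xi>) \<subseteq> K \<union> tsupp \<psi>"
          using K(2)
        proof eventually_elim
          case (elim h)
          show ?case
            by (rule tsupp_subsetI)
              (use K(1) test_fun_compact[OF \<psi>] elim tsupp_0[of _ "q h"] tsupp_0[of _ \<psi>] in \<open>auto intro!: compact_imp_closed compact_Un\<close>)
        qed
      qed
      fix ds :: "'a list" assume ds: "set ds \<subseteq> Basis"
      obtain C where C: "C \<ge> 0" "\<And>\<xi>. norm (Dlist ds \<psi> \<xi>) \<le> C" using test_fun_Dlist_bounded[OF \<psi> ds] by blast
      have D: "Dlist ds (\<lambda>\<xi>. f \<xi> + k * \<psi> \<xi>) = (\<lambda>\<xi>. Dlist ds f \<xi> + k * Dlist ds \<psi> \<xi>)" if "f \<in> test_fun" for f k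
        using Dlist_test_add[OF that test_fun_cmult[OF \<psi>] ds] Dlist_test_cmult[OF \<psi> ds] by simp
      have "uniform_limit UNIV (\<lambda>h \<xi>. k h * Dlist ds \<psi> \<xi>) (\<lambda>\<xi>. ms (Suc n) t * Dlist ds \<psi> \<xi>) (at 0)"
      proof (rule uniform_limitI)
        fix e :: real assume e: "e > 0"
        then have "e / (C + 1) > 0" using C(1) by simp
        from tendstoD[OF k this]
        show "\<forall>\<^sub>F h in at 0. \<forall>\<xi>\<in>UNIV. dist (k h * Dlist ds \<psi> \<xi>) (ms (Suc n) t * Dlist ds \<psi> \<xi>) < e"
        proof eventually_elim
          case (elim h)
          have "dist (k h * Dlist ds \<psi> \<xi>) (ms (Suc n) t * Dlist ds \<psi> \<xi>) < e" for \<xi>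
          proof -
            have "dist (k h * Dlist ds \<psi> \<xi>) (ms (Suc n) t * Dlist ds \<psi> \<xi>) = dist (k h) (ms (Suc n) t) * norm (Dlist ds \<psi> \<xi>)"
              by (simp add: dist_norm norm_mult flip: left_diff_distrib)
            also have "\<dots> \<le> (e / (C + 1)) * C" using elim C e by (intro mult_mono) auto
            also have "\<dots> < e" using C(1) e by (simp add: field_simps)
            finally show ?thesis .
          qed
          then show ?case by blast
        qed
      qed
      moreover have "uniform_limit UNIV (\<lambda>h. Dlist ds (q h)) (Dlist ds (cs (Suc n) t)) (at 0)"
        using qD ds unfolding D_tendsto_def by blast
      ultimately show "uniform_limit UNIV (\<lambda>h. Dlist ds (\<lambda>\<xi>. q h \<xi> + k h * \<psi> \<xi>)) (Dlist ds (\<lambda>\<xi>. cs (Suc n) t \<xi> + ms (Suc n) t * \<psi> \<xi>)) (at 0)"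
        unfolding D[OF q] D[OF cs(2)] by (intro uniform_limit_add)
    qed
  qed
  then show ?thesis
    unfolding smooth_D_curve_def
    by (intro exI[of _ "\<lambda>n t \<xi>. cs n t \<xi> + ms n t * \<psi> \<xi>"]) (auto simp: cs(1) ms(1) intro!: test_fun_add test_fun_cmult cs \<psi>)
qed

subsection \<open>Scaling\<close>

lemma Seps_support: "\<epsilon> > 0 \<Longrightarrow> \<xi> \<notin> (*\<^sub>R) \<epsilon> ` tsupp \<phi> \<Longrightarrow> Seps \<epsilon> \<phi> \<xi> = 0"
proof -
  assume "\<epsilon> > 0" "\<xi> \<notin> (*\<^sub>R) \<epsilon> ` tsupp \<phi>"
  moreover have "\<xi> = \<epsilon> *\<^sub>R (inverse \<epsilon> *\<^sub>R \<xi>)" using \<open>\<epsilon> > 0\<close> by simp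
  ultimately have "inverse \<epsilon> *\<^sub>R \<xi> \<notin> tsupp \<phi>" by blast
  then show ?thesis by (simp add: Seps_def tsupp_0)
qed

lemma tsupp_Seps: "\<epsilon> > 0 \<Longrightarrow> compact K \<Longrightarrow> tsupp \<phi> \<subseteq> K \<Longrightarrow> tsupp (Seps \<epsilon> \<phi>) \<subseteq> (*\<^sub>R) \<epsilon> ` K"
  by (rule tsupp_subsetI) (use Seps_support in \<open>blast intro: compact_imp_closed compact_scaling\<close>)+

lemma Seps_test_fun:
  assumes "\<epsilon> > 0" "\<phi> \<in> test_fun" shows "Seps \<epsilon> \<phi> \<in> test_fun"
proof (rule test_funI)
  show "compact ((*\<^sub>R) \<epsilon> ` tsupp \<phi>)" using test_fun_compact[OF assms(2)] by (rule compact_scaling)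
  show "Seps \<epsilon> \<phi> \<xi> = 0" if "\<xi> \<notin> (*\<^sub>R) \<epsilon> ` tsupp \<phi>" for \<xi> using Seps_support[OF assms(1) that] .
  show "smooth_on UNIV (Seps \<epsilon> \<phi>)" unfolding Seps_def
    by (rule Dlist_linear(2)[OF open_UNIV Dlist_scale(2) bounded_linear_mult_right]) (rule test_fun_smooth[OF assms(2)])
qed

lemma Dlist_Seps:
  assumes "\<phi> \<in> test_fun" "set ds \<subseteq> Basis"
  shows "Dlist ds (Seps \<epsilon> \<phi>) \<xi> = complex_of_real (inverse \<epsilon> ^ DIM('a) * inverse \<epsilon> ^ length ds) * Dlist ds \<phi> (inverse \<epsilon> *\<^sub>R (\<xi>::'a::euclidean_space))"
  unfolding Seps_def
  using Dlist_linear(1)[OF open_UNIV Dlist_scale(2)[OF test_fun_smooth[OF assms(1)]] bounded_linear_mult_right assms(2) UNIV_I]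
    Dlist_scale(1)[OF test_fun_smooth[OF assms(1)] assms(2)]
  by (simp add: scaleR_conv_of_real mult.assoc)

lemma Seps_A0:
  assumes \<epsilon>: "\<epsilon> > 0" and \<phi>: "\<phi> \<in> A 0" shows "Seps \<epsilon> \<phi> \<in> A 0"
proof -
  have t: "\<phi> \<in> test_fun" "integral UNIV \<phi> = 1" using \<phi> by (auto simp: A_def)
  obtain a b where ab: "tsupp \<phi> \<subseteq> cbox a b" using compact_support_box test_fun_compact[OF t(1)] by metis
  have "(\<phi> has_integral integral (cbox a b) \<phi>) UNIV"
    by (rule has_integral_compact_support) (use ab tsupp_0[of _ \<phi>] in \<open>auto intro: test_fun_continuous[OF t(1)]\<close>)
  then have "integral (cbox a b) \<phi> = 1" using t(2) integral_unique by metis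
  moreover have "\<phi> integrable_on cbox a b" by (intro integrable_continuous test_fun_continuous t)
  ultimately have "(\<phi> has_integral 1) (cbox a b)" using integrable_integral by metis
  from has_integral_affinity[OF this, of "inverse \<epsilon>" 0]
  have "((\<lambda>x. \<phi> (inverse \<epsilon> *\<^sub>R x)) has_integral (1 /\<^sub>R inverse \<epsilon> ^ DIM('a))) ((*\<^sub>R) \<epsilon> ` cbox a b)"
    using \<epsilon> by (simp add: inverse_eq_divide)
  then have "((\<lambda>x. \<phi> (inverse \<epsilon> *\<^sub>R x)) has_integral (1 /\<^sub>R inverse \<epsilon> ^ DIM('a))) UNIV"
  proof (rule has_integral_on_superset)
    fix \<xi> assume \<xi>: "\<xi> \<notin> (*\<^sub>R) \<epsilon> ` cbox a b"
    have "\<xi> = \<epsilon> *\<^sub>R (inverse \<epsilon> *\<^sub>R \<xi>)" using \<epsilon> by simp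
    then have "inverse \<epsilon> *\<^sub>R \<xi> \<notin> cbox a b" using \<xi> by blast
    then show "\<phi> (inverse \<epsilon> *\<^sub>R \<xi>) = 0" using ab tsupp_0 by blast
  qed simp
  from has_integral_mult_right[OF this, of "complex_of_real (inverse \<epsilon> ^ DIM('a))"]
  have "(Seps \<epsilon> \<phi> has_integral 1) UNIV" using \<epsilon> by (simp add: Seps_def scaleR_conv_of_real power_inverse)
  then have "integral UNIV (Seps \<epsilon> \<phi>) = 1" by (rule integral_unique)
  then show ?thesis using Seps_test_fun[OF \<epsilon> t(1)] by (auto simp: A_def)
qed

text \<open>Rescaling multiplies a derivative by a constant that depends only on
  \<open>\<epsilon>\<close> and its order, and scales supports; so it preserves convergence of test
  functions.\<close>

lemma smooth_D_curve_Seps: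
  assumes \<epsilon>: "\<epsilon> > 0" and "smooth_D_curve c"
  shows "smooth_D_curve (\<lambda>t. Seps \<epsilon> (c t))"
proof -
  obtain cs where cs: "cs 0 = c" "\<And>n t. cs n t \<in> test_fun"
     "\<And>n t. D_tendsto (\<lambda>h. (\<lambda>\<xi>. (cs n (t + h) \<xi> - cs n t \<xi>) / complex_of_real h)) (cs (Suc n) t) (at 0)"
    using assms(2) unfolding smooth_D_curve_def by blast
  have "D_tendsto (\<lambda>h \<xi>. (Seps \<epsilon> (cs n (t + h)) \<xi> - Seps \<epsilon> (cs n t) \<xi>) / complex_of_real h) (Seps \<epsilon> (cs (Suc n) t)) (at 0)" for n t
  proof -
    define q where "q h \<xi> = (cs n (t + h) \<xi> - cs n t \<xi>) / complex_of_real h" for h \<xi>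
    have eq: "(\<lambda>\<xi>. (Seps \<epsilon> (cs n (t + h)) \<xi> - Seps \<epsilon> (cs n t) \<xi>) / complex_of_real h) = Seps \<epsilon> (q h)" for h
      by (simp add: Seps_def q_def fun_eq_iff divide_inverse algebra_simps)
    have q: "q h \<in> test_fun" for h unfolding q_def by (intro test_fun_quotient cs)
    have qD: "D_tendsto q (cs (Suc n) t) (at 0)" using cs(3)[of n t] by (simp add: q_def[abs_def])
    show ?thesis unfolding eq D_tendsto_def
    proof (intro conjI allI impI)
      show "Seps \<epsilon> (cs (Suc n) t) \<in> test_fun" by (intro Seps_test_fun \<epsilon> cs)
      obtain K where K: "compact K" "\<forall>\<^sub>F h in at 0. tsupp (q h) \<subseteq> K" using qD unfolding D_tendsto_def by blast
      show "\<exists>K. compact K \<and> (\<forall>\<^sub>F h in at 0. tsupp (Seps \<epsilon> (q h)) \<subseteq> K)"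
        by (intro exI[of _ "(*\<^sub>R) \<epsilon> ` K"] conjI compact_scaling K(1) eventually_mono[OF K(2)] tsupp_Seps \<epsilon>)
      fix ds :: "'a list" assume ds: "set ds \<subseteq> Basis"
      define a where "a = complex_of_real (inverse \<epsilon> ^ DIM('a) * inverse \<epsilon> ^ length ds)"
      have ul: "uniform_limit UNIV (\<lambda>h. Dlist ds (q h)) (Dlist ds (cs (Suc n) t)) (at 0)"
        using qD ds unfolding D_tendsto_def by blast
      show "uniform_limit UNIV (\<lambda>h. Dlist ds (Seps \<epsilon> (q h))) (Dlist ds (Seps \<epsilon> (cs (Suc n) t))) (at 0)"
      proof (rule uniform_limitI)
        fix e :: real assume "e > 0"
        then have "e / (norm a + 1) > 0" by (simp add: add_nonneg_pos)
        from uniform_limitD[OF ul this]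
        show "\<forall>\<^sub>F h in at 0. \<forall>\<xi>\<in>UNIV. dist (Dlist ds (Seps \<epsilon> (q h)) \<xi>) (Dlist ds (Seps \<epsilon> (cs (Suc n) t)) \<xi>) < e"
        proof eventually_elim
          case (elim h)
          have "dist (Dlist ds (Seps \<epsilon> (q h)) \<xi>) (Dlist ds (Seps \<epsilon> (cs (Suc n) t)) \<xi>) < e" for \<xi>
          proof -
            have "dist (Dlist ds (Seps \<epsilon> (q h)) \<xi>) (Dlist ds (Seps \<epsilon> (cs (Suc n) t)) \<xi>)
                = norm a * dist (Dlist ds (q h) (inverse \<epsilon> *\<^sub>R \<xi>)) (Dlist ds (cs (Suc n) t) (inverse \<epsilon> *\<^sub>R \<xi>))"
              unfolding Dlist_Seps[OF q ds] Dlist_Seps[OF cs(2) ds] a_def[symmetric] dist_norm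
              by (simp add: norm_mult flip: right_diff_distrib)
            also have "\<dots> \<le> norm a * (e / (norm a + 1))" using elim by (intro mult_left_mono) (auto simp: less_imp_le)
            also have "\<dots> < (norm a + 1) * (e / (norm a + 1))"
              using \<open>e / (norm a + 1) > 0\<close> by (intro mult_strict_right_mono) auto
            also have "\<dots> = e" using add_nonneg_pos[OF norm_ge_zero[of a] zero_less_one] by (simp del: zero_less_one)
            finally show ?thesis .
          qed
          then show ?case by blast
        qed
      qed
    qed
  qed
  then show ?thesis
    unfolding smooth_D_curve_def
    by (intro exI[of _ "\<lambda>n t. Seps \<epsilon> (cs n t)"]) (auto simp: cs(1) intro!: Seps_test_fun \<epsilon> cs)
qed

subsection \<open>Test functions with prescribed moments\<close>

text \<open>A product of plateaus in the coordinates. Its smoothness is checked along curves, where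
  products and compositions are available, and Boman's theorem converts this into partial
  derivatives.\<close>

lemma smooth_bump:
  fixes x0 :: "'a::euclidean_space"
  assumes r: "r > 0"
  obtains \<rho> :: "'a \<Rightarrow> real" where "(\<lambda>\<xi>. complex_of_real (\<rho> \<xi>)) \<in> test_fun" "\<And>\<xi>. \<rho> \<xi> \<ge> 0" "\<rho> x0 = 1"
    "\<And>\<xi>. \<xi> \<notin> cbox (x0 - r *\<^sub>R One) (x0 + r *\<^sub>R One) \<Longrightarrow> \<rho> \<xi> = 0"
proof -
  obtain \<theta> :: "real \<Rightarrow> real" where \<theta>: "smooth_curve \<theta>" "\<And>t. 0 \<le> \<theta> t" "\<And>t. \<theta> t \<le> 1"
    "\<And>t. \<bar>t\<bar> \<le> 1/2 \<Longrightarrow> \<theta> t = 1" "\<And>t. \<bar>t\<bar> \<ge> 1 \<Longrightarrow> \<theta> t = 0" by (rule smooth_plateau) blast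
  define \<rho> where "\<rho> \<xi> = (\<Prod>b\<in>Basis. \<theta> (inverse r * ((\<xi> - x0) \<bullet> b)))" for \<xi>
  have z: "\<rho> \<xi> = 0" if "\<xi> \<notin> cbox (x0 - r *\<^sub>R One) (x0 + r *\<^sub>R One)" for \<xi>
  proof -
    have "\<exists>b\<in>Basis. \<not> (x0 \<bullet> b - r \<le> \<xi> \<bullet> b \<and> \<xi> \<bullet> b \<le> x0 \<bullet> b + r)"
      using that by (simp add: mem_box inner_diff_left inner_add_left)
    then obtain b where b: "b \<in> Basis" "\<not> (x0 \<bullet> b - r \<le> \<xi> \<bullet> b \<and> \<xi> \<bullet> b \<le> x0 \<bullet> b + r)"
      by blast
    then have "\<bar>(\<xi> - x0) \<bullet> b\<bar> \<ge> r" by (auto simp: inner_diff_left)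
    then have "\<bar>inverse r * ((\<xi> - x0) \<bullet> b)\<bar> \<ge> 1" using r by (simp add: abs_mult field_simps)
    then have "\<theta> (inverse r * ((\<xi> - x0) \<bullet> b)) = 0" by (rule \<theta>(5))
    then show ?thesis using b(1) unfolding \<rho>_def by (intro prod_zero) auto
  qed
  have "curve_smooth UNIV (\<lambda>\<xi>. complex_of_real (\<rho> \<xi>))"
    unfolding curve_smooth_def
  proof (intro allI impI)
    fix c :: "real \<Rightarrow> 'a" assume c: "smooth_curve c \<and> (\<forall>t. c t \<in> UNIV)"
    have "smooth_curve (\<lambda>t. \<theta> (inverse r * ((c t - x0) \<bullet> b)))" for b
    proof (rule smooth_curve_compose[of \<theta> "\<lambda>t. inverse r * ((c t - x0) \<bullet> b)", OF \<theta>(1)])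
      show "smooth_curve (\<lambda>t. inverse r * ((c t - x0) \<bullet> b))"
        using c by (intro smooth_curve_mult smooth_curve_const smooth_curve_bilinear[OF bounded_bilinear_inner] smooth_curve_diff) auto
    qed
    then have "smooth_curve (\<lambda>t. \<rho> (c t))" unfolding \<rho>_def by (intro smooth_curve_prod) auto
    then show "smooth_curve (\<lambda>t. complex_of_real (\<rho> (c t)))"
      by (rule smooth_curve_linear[OF bounded_linear_of_real])
  qed
  then have "smooth_on UNIV (\<lambda>\<xi>. complex_of_real (\<rho> \<xi>))"
    by (intro ray_smooth_imp_smooth_on curve_smooth_imp_ray_smooth open_UNIV)
  then have "(\<lambda>\<xi>. complex_of_real (\<rho> \<xi>)) \<in> test_fun"
    by (rule test_funI[OF _ compact_cbox]) (use z in auto)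
  moreover have "\<rho> x0 = 1" using \<theta>(4)[of 0] by (simp add: \<rho>_def)
  moreover have "\<rho> \<xi> \<ge> 0" for \<xi> unfolding \<rho>_def by (intro prod_nonneg) (simp add: \<theta>(2))
  ultimately show ?thesis using that z by blast
qed

text \<open>Where \<open>P\<close> does not vanish, a bump function concentrated near that point
  gives a nonzero integral.\<close>

lemma fundamental_lemma:
  fixes P :: "'a::euclidean_space \<Rightarrow> complex"
  assumes P: "continuous_on UNIV P" and zero: "\<And>\<psi>. \<psi> \<in> test_fun \<Longrightarrow> integral UNIV (\<lambda>\<xi>. P \<xi> * \<psi> \<xi>) = 0"
  shows "P x0 = 0"
proof (rule ccontr)
  assume nz: "P x0 \<noteq> 0"
  \<comment> \<open>Multiplication by the conjugate of \<open>P x0\<close> rotates the values of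
    \<open>P\<close> so that the real part is positive at \<open>x0\<close>, hence on a ball around
    it.\<close>
  define p where "p \<xi> = Re (cnj (P x0) * P \<xi>)" for \<xi>
  have "cnj (P x0) * P x0 = complex_of_real ((cmod (P x0))\<^sup>2)"
    unfolding complex_norm_square by (rule mult.commute)
  then have p0: "p x0 > 0" using nz by (simp add: p_def)
  have pc: "continuous_on UNIV p" unfolding p_def using P by (intro continuous_intros)
  then have o: "open (p -` {0<..})" by (rule open_vimage[OF open_greaterThan])
  obtain e where "e > 0" "ball x0 e \<subseteq> p -` {0<..}"
    by (rule openE[OF o, of x0]) (use p0 in auto)
  then have e: "e > 0" "\<And>\<xi>. \<xi> \<in> ball x0 e \<Longrightarrow> p \<xi> > 0" by auto
  define r where "r = e / (2 * (1 + norm (One::'a)))"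
  have den: "2 * (1 + norm (One::'a)) > 0" by (intro mult_pos_pos add_pos_nonneg) auto
  have r: "r > 0" using e(1) den by (simp add: r_def)
  have box: "\<xi> \<in> ball x0 e" if "\<xi> \<in> cbox (x0 - r *\<^sub>R One) (x0 + r *\<^sub>R One)" for \<xi>
  proof -
    have "norm (\<xi> - x0) \<le> norm (r *\<^sub>R One :: 'a)"
      by (rule norm_le_componentwise) (use that r in \<open>auto simp: mem_box inner_diff_left inner_add_left abs_le_iff\<close>)
    also have "\<dots> = r * norm (One::'a)" using r by simp
    also have "norm (One::'a) < 2 * (1 + norm (One::'a))"
    proof -
      have "t < 2 * (1 + t)" if "t \<ge> 0" for t :: real using that by simp
      from this[OF norm_ge_zero] show ?thesis .
    qed
    then have "r * norm (One::'a) < r * (2 * (1 + norm (One::'a)))" using r by (rule mult_strict_left_mono)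
    also have "\<dots> = e" using den by (simp add: r_def)
    finally show ?thesis by (simp add: dist_norm norm_minus_commute)
  qed
  obtain \<rho> :: "'a \<Rightarrow> real" where \<rho>: "(\<lambda>\<xi>. complex_of_real (\<rho> \<xi>)) \<in> test_fun" "\<And>\<xi>. \<rho> \<xi> \<ge> 0" "\<rho> x0 = 1"
    "\<And>\<xi>. \<xi> \<notin> cbox (x0 - r *\<^sub>R One) (x0 + r *\<^sub>R One) \<Longrightarrow> \<rho> \<xi> = 0" by (rule smooth_bump[OF r, of x0]) blast
  define B where "B = cbox (x0 - r *\<^sub>R One) (x0 + r *\<^sub>R One)"
  have \<rho>c: "continuous_on S \<rho>" for S
    using continuous_on_Re[OF test_fun_continuous[OF \<rho>(1), of S]] by simp
  define I where "I = integral B (\<lambda>\<xi>. P \<xi> * complex_of_real (\<rho> \<xi>))"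
  have hI: "((\<lambda>\<xi>. P \<xi> * complex_of_real (\<rho> \<xi>)) has_integral I) UNIV"
    unfolding I_def B_def
    by (rule has_integral_compact_support) (use \<rho>(4) P test_fun_continuous[OF \<rho>(1)] in \<open>auto intro!: continuous_intros\<close>)
  then have "I = 0" using zero[OF \<rho>(1)] integral_unique by metis
  have c: "continuous_on B (\<lambda>\<xi>. P \<xi> * complex_of_real (\<rho> \<xi>))"
    using continuous_on_subset[OF P] test_fun_continuous[OF \<rho>(1)] by (intro continuous_on_mult) auto
  have "((\<lambda>\<xi>. P \<xi> * complex_of_real (\<rho> \<xi>)) has_integral 0) B"
    using integrable_integral[OF integrable_continuous[OF c[unfolded B_def]]] \<open>I = 0\<close> unfolding I_def B_def by simp
  then have "((\<lambda>\<xi>. Re (cnj (P x0) * (P \<xi> * complex_of_real (\<rho> \<xi>)))) has_integral Re (cnj (P x0) * 0)) B"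
    by (rule has_integral_linear[OF _ bounded_linear_compose[OF bounded_linear_Re bounded_linear_mult_right], unfolded o_def])
  moreover have "Re (cnj (P x0) * (P \<xi> * complex_of_real (\<rho> \<xi>))) = p \<xi> * \<rho> \<xi>" for \<xi>
    by (simp add: p_def algebra_simps)
  ultimately have h: "((\<lambda>\<xi>. p \<xi> * \<rho> \<xi>) has_integral 0) B" by simp
  have "p x0 * \<rho> x0 = 0"
  proof (rule has_integral_0_cbox_imp_0[of "x0 - r *\<^sub>R One" "x0 + r *\<^sub>R One" "\<lambda>\<xi>. p \<xi> * \<rho> \<xi>"])
    show "continuous_on (cbox (x0 - r *\<^sub>R One) (x0 + r *\<^sub>R One)) (\<lambda>\<xi>. p \<xi> * \<rho> \<xi>)"
      using continuous_on_subset[OF pc] by (intro continuous_on_mult \<rho>c) auto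
    show "0 \<le> p \<xi> * \<rho> \<xi>" if "\<xi> \<in> box (x0 - r *\<^sub>R One) (x0 + r *\<^sub>R One)" for \<xi>
      using e(2)[OF box[OF subsetD[OF box_subset_cbox that]]] \<rho>(2)[of \<xi>] by simp
    show "((\<lambda>\<xi>. p \<xi> * \<rho> \<xi>) has_integral 0) (cbox (x0 - r *\<^sub>R One) (x0 + r *\<^sub>R One))" using h by (simp add: B_def)
    show "box (x0 - r *\<^sub>R One) (x0 + r *\<^sub>R One) \<noteq> {}"
      using r by (simp add: box_ne_empty inner_diff_left inner_add_left)
    show "x0 \<in> cbox (x0 - r *\<^sub>R One) (x0 + r *\<^sub>R One)"
      using r by (simp add: mem_box inner_diff_left inner_add_left)
  qed
  then show False using p0 \<rho>(3) by simp
qed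

lemma monom_prod_count:
  fixes \<beta> :: "'a::euclidean_space multiset"
  assumes "multi_index \<beta>"
  shows "monom \<beta> \<xi> = (\<Prod>b\<in>Basis. complex_of_real (\<xi> \<bullet> b) ^ count \<beta> b)"
proof -
  have "monom \<beta> \<xi> = (\<Prod>b\<in>set_mset \<beta>. complex_of_real (\<xi> \<bullet> b) ^ count \<beta> b)"
    unfolding monom_def by (rule image_prod_mset_multiplicity)
  also have "\<dots> = (\<Prod>b\<in>Basis. complex_of_real (\<xi> \<bullet> b) ^ count \<beta> b)"
    using assms by (intro prod.mono_neutral_left) (auto simp: multi_index_def not_in_iff)
  finally show ?thesis .
qed

text \<open>Dedekind's argument: doubling one coordinate multiplies the monomial of \<open>\<beta>\<close> by \<open>2 ^ count \<beta> b\<close>,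
  and two different multi-indices are separated by such a factor.\<close>

lemma monom_linear_independent:
  fixes I :: "'a::euclidean_space multiset set"
  assumes "finite I" "\<And>\<beta>. \<beta> \<in> I \<Longrightarrow> multi_index \<beta>"
    and "\<And>\<xi>. (\<Sum>\<beta>\<in>I. c \<beta> * monom \<beta> \<xi>) = 0" "\<beta> \<in> I"
  shows "c \<beta> = 0"
  using assms
proof (induction I arbitrary: c \<beta> rule: finite_induct)
  case (insert j I)
  have c0: "c \<beta> = 0" if \<beta>: "\<beta> \<in> I" for \<beta>
  proof -
    have "\<beta> \<noteq> j" using \<beta> insert.hyps by blast
    then obtain b where b: "count \<beta> b \<noteq> count j b" by (meson multiset_eqI)
    moreover have "count \<gamma> b = 0" if "multi_index \<gamma>" "b \<notin> Basis" for \<gamma>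
      using that by (auto simp: multi_index_def count_eq_zero_iff)
    ultimately have bB: "b \<in> Basis" using insert.prems(1)[of \<beta>] insert.prems(1)[of j] \<beta>
      by (cases "b \<in> Basis") simp_all
    define T where "T \<xi> = \<xi> + (\<xi> \<bullet> b) *\<^sub>R b" for \<xi> :: 'a
    have Ta: "T \<xi> \<bullet> a = (if a = b then 2 * (\<xi> \<bullet> b) else \<xi> \<bullet> a)" if "a \<in> Basis" for \<xi> a
      using that bB by (simp add: T_def inner_add_left inner_Basis)
    have T: "monom \<gamma> (T \<xi>) = 2 ^ count \<gamma> b * monom \<gamma> \<xi>" if "multi_index \<gamma>" for \<gamma> \<xi>
    proof -
      have "monom \<gamma> (T \<xi>) = (\<Prod>a\<in>Basis. (if a = b then 2 ^ count \<gamma> b else 1) * complex_of_real (\<xi> \<bullet> a) ^ count \<gamma> a)"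
        unfolding monom_prod_count[OF that]
        by (intro prod.cong refl) (auto simp: Ta power_mult_distrib)
      also have "\<dots> = 2 ^ count \<gamma> b * monom \<gamma> \<xi>"
        unfolding monom_prod_count[OF that] prod.distrib using bB by simp
      finally show ?thesis .
    qed
    have "(\<Sum>\<gamma>\<in>I. (c \<gamma> * (2 ^ count \<gamma> b - 2 ^ count j b)) * monom \<gamma> \<xi>) = 0" for \<xi>
    proof -
      have "0 = (\<Sum>\<gamma>\<in>insert j I. c \<gamma> * monom \<gamma> (T \<xi>)) - 2 ^ count j b * (\<Sum>\<gamma>\<in>insert j I. c \<gamma> * monom \<gamma> \<xi>)"
        using insert.prems(2) by simp
      also have "\<dots> = (\<Sum>\<gamma>\<in>insert j I. (c \<gamma> * (2 ^ count \<gamma> b - 2 ^ count j b)) * monom \<gamma> \<xi>)"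
        unfolding sum_distrib_left sum_subtractf[symmetric]
        by (intro sum.cong refl) (use insert.prems(1) T in \<open>simp add: algebra_simps\<close>)
      also have "\<dots> = (\<Sum>\<gamma>\<in>I. (c \<gamma> * (2 ^ count \<gamma> b - 2 ^ count j b)) * monom \<gamma> \<xi>)"
        using insert.hyps by simp
      finally show ?thesis by simp
    qed
    then have "c \<beta> * (2 ^ count \<beta> b - 2 ^ count j b) = 0"
      using insert.IH[of "\<lambda>\<gamma>. c \<gamma> * (2 ^ count \<gamma> b - 2 ^ count j b)" \<beta>] insert.prems(1) \<beta> by simp
    moreover have "(2::complex) ^ count \<beta> b \<noteq> 2 ^ count j b"
    proof
      assume "(2::complex) ^ count \<beta> b = 2 ^ count j b"
      then have "norm ((2::complex) ^ count \<beta> b) = norm ((2::complex) ^ count j b)" by simp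
      then have "(2::real) ^ count \<beta> b = 2 ^ count j b" by (simp add: norm_power)
      then show False using b by simp
    qed
    ultimately show ?thesis by simp
  qed
  \<comment> \<open>With all other coefficients gone, the last one is read off at
    \<open>One\<close>, where every monomial is 1.\<close>
  have "c j * monom j One = 0"
    using insert.prems(2)[of One] insert.hyps c0 by simp
  moreover have "monom j One = 1"
    using insert.prems(1)[of j] by (simp add: monom_prod_count)
  ultimately show ?case using c0 insert.prems(3) by auto
qed simp

text \<open>Linearly independent functionals have dual vectors, by induction on \<open>I\<close>.
  Projecting along the dual vectors found so far lands in the common kernel of the old functionals;
  if the new functional vanished there, it would be a combination of the old ones. Independence is
  tested on \<open>test_fun\<close>, which is a set and not a type.\<close>

lemma dual_family:
  fixes \<Lambda> :: "'i \<Rightarrow> ('a::euclidean_space \<Rightarrow> complex) \<Rightarrow> complex"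
  assumes "finite I" and add: "\<And>i f g. f \<in> test_fun \<Longrightarrow> g \<in> test_fun \<Longrightarrow> \<Lambda> i (\<lambda>\<xi>. f \<xi> + g \<xi>) = \<Lambda> i f + \<Lambda> i g"
    and mult: "\<And>i k f. \<Lambda> i (\<lambda>\<xi>. k * f \<xi>) = k * \<Lambda> i f"
    and "\<And>c i. (\<And>f. f \<in> test_fun \<Longrightarrow> (\<Sum>i\<in>I. c i * \<Lambda> i f) = 0) \<Longrightarrow> i \<in> I \<Longrightarrow> c i = 0"
  shows "\<exists>\<psi>. (\<forall>i\<in>I. \<psi> i \<in> test_fun) \<and> (\<forall>i\<in>I. \<forall>j\<in>I. \<Lambda> i (\<psi> j) = (if i = j then 1 else 0))"
proof -
  have lsum: "\<Lambda> i (\<lambda>\<xi>. f \<xi> + (\<Sum>j\<in>J. k j * g j \<xi>)) = \<Lambda> i f + (\<Sum>j\<in>J. k j * \<Lambda> i (g j))"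
    if "finite J" "f \<in> test_fun" "\<And>j. j \<in> J \<Longrightarrow> g j \<in> test_fun" for i J f and k :: "'i \<Rightarrow> complex" and g
    using that
  proof (induction J arbitrary: f rule: finite_induct)
    case (insert j J)
    have "\<Lambda> i (\<lambda>\<xi>. f \<xi> + (\<Sum>j\<in>insert j J. k j * g j \<xi>)) = \<Lambda> i (\<lambda>\<xi>. (f \<xi> + k j * g j \<xi>) + (\<Sum>j\<in>J. k j * g j \<xi>))"
      using insert.hyps by (simp add: add.assoc)
    also have "\<dots> = \<Lambda> i (\<lambda>\<xi>. f \<xi> + k j * g j \<xi>) + (\<Sum>j\<in>J. k j * \<Lambda> i (g j))"
      using test_fun_add[OF insert.prems(1) test_fun_cmult[OF insert.prems(2), of j "k j"]] insert.prems(2)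
      by (intro insert.IH) auto
    also have "\<Lambda> i (\<lambda>\<xi>. f \<xi> + k j * g j \<xi>) = \<Lambda> i f + k j * \<Lambda> i (g j)"
      using add[OF insert.prems(1) test_fun_cmult[OF insert.prems(2)], of j i "k j"] mult[of i "k j" "g j"] by simp
    finally show ?case using insert.hyps by simp
  qed simp
  show ?thesis
    using assms(1,4)
  proof (induction I rule: finite_induct)
    case (insert m I)
    have "c i = 0" if "\<And>f. f \<in> test_fun \<Longrightarrow> (\<Sum>i\<in>I. c i * \<Lambda> i f) = 0" "i \<in> I" for c i
    proof -
      have "(\<Sum>i\<in>insert m I. (if i = m then 0 else c i) * \<Lambda> i f) = 0" if f: "f \<in> test_fun" for f
      proof -
        have "(\<Sum>i\<in>I. (if i = m then 0 else c i) * \<Lambda> i f) = (\<Sum>i\<in>I. c i * \<Lambda> i f)"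
          using insert.hyps by (intro sum.cong) auto
        then show ?thesis using insert.hyps \<open>\<And>f. f \<in> test_fun \<Longrightarrow> (\<Sum>i\<in>I. c i * \<Lambda> i f) = 0\<close>[OF f] by simp
      qed
      from insert.prems[OF this, of i] have "(if i = m then 0 else c i) = 0" using that(2) by blast
      moreover have "i \<noteq> m" using that(2) insert.hyps(2) by blast
      ultimately show ?thesis by simp
    qed
    then have "\<exists>\<psi>. (\<forall>i\<in>I. \<psi> i \<in> test_fun) \<and> (\<forall>i\<in>I. \<forall>j\<in>I. \<Lambda> i (\<psi> j) = (if i = j then 1 else 0))"
      by (rule insert.IH)
    then obtain \<psi> where \<psi>: "\<And>i. i \<in> I \<Longrightarrow> \<psi> i \<in> test_fun"
      "\<And>i j. i \<in> I \<Longrightarrow> j \<in> I \<Longrightarrow> \<Lambda> i (\<psi> j) = (if i = j then 1 else 0)" by blast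
    \<comment> \<open>The projection onto the common kernel of the functionals of \<open>I\<close>,
      along the \<open>\<psi>\<close> found so far.\<close>
    define Pr where "Pr f = (\<lambda>\<xi>. f \<xi> + (\<Sum>j\<in>I. (- \<Lambda> j f) * \<psi> j \<xi>))" for f
    have Pr: "Pr f \<in> test_fun" if "f \<in> test_fun" for f
      unfolding Pr_def by (intro test_fun_add that test_fun_sum test_fun_cmult \<psi>(1))
    have lPr: "\<Lambda> i (Pr f) = \<Lambda> i f + (\<Sum>j\<in>I. (- \<Lambda> j f) * \<Lambda> i (\<psi> j))" if "f \<in> test_fun" for i f
      unfolding Pr_def by (rule lsum[OF insert.hyps(1) that \<psi>(1)])
    have lPrI: "\<Lambda> i (Pr f) = 0" if "f \<in> test_fun" "i \<in> I" for i f
    proof -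
      have "(\<Sum>j\<in>I. (- \<Lambda> j f) * \<Lambda> i (\<psi> j)) = (\<Sum>j\<in>I. if j = i then - \<Lambda> i f else 0)"
        using \<psi>(2) that(2) by (intro sum.cong) auto
      then show ?thesis using lPr[OF that(1)] that(2) insert.hyps by simp
    qed
    have "\<exists>f\<in>test_fun. \<Lambda> m (Pr f) \<noteq> 0"
    proof (rule ccontr)
      assume "\<not> ?thesis"
      then have z: "\<Lambda> m f + (\<Sum>j\<in>I. (- \<Lambda> j f) * \<Lambda> m (\<psi> j)) = 0" if "f \<in> test_fun" for f
        using lPr[OF that, of m] that by auto
      have "(\<Sum>i\<in>insert m I. (if i = m then 1 else - \<Lambda> m (\<psi> i)) * \<Lambda> i f) = 0" if "f \<in> test_fun" for f
      proof -
        have "(\<Sum>i\<in>I. (if i = m then 1 else - \<Lambda> m (\<psi> i)) * \<Lambda> i f) = (\<Sum>j\<in>I. (- \<Lambda> j f) * \<Lambda> m (\<psi> j))"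
          using insert.hyps by (intro sum.cong) auto
        then show ?thesis using insert.hyps z[OF that] by simp
      qed
      from insert.prems[OF this, of m] show False by simp
    qed
    then obtain f where f: "f \<in> test_fun" "\<Lambda> m (Pr f) \<noteq> 0" by blast
    define g where "g = (\<lambda>\<xi>. inverse (\<Lambda> m (Pr f)) * Pr f \<xi>)"
    have g: "g \<in> test_fun" "\<Lambda> m g = 1" "\<And>i. i \<in> I \<Longrightarrow> \<Lambda> i g = 0"
      unfolding g_def mult using f lPrI[OF f(1)] by (auto intro: test_fun_cmult Pr)
    \<comment> \<open>Subtracting a multiple of \<open>g\<close> makes the new functional vanish on
      the old dual vectors. The old duality survives, since the old functionals vanish on
      \<open>g\<close>.\<close>
    define \<psi>' where "\<psi>' i = (if i = m then g else (\<lambda>\<xi>. \<psi> i \<xi> + (- \<Lambda> m (\<psi> i)) * g \<xi>))" for i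
    have l': "\<Lambda> i (\<lambda>\<xi>. \<psi> j \<xi> + (- \<Lambda> m (\<psi> j)) * g \<xi>) = \<Lambda> i (\<psi> j) + (- \<Lambda> m (\<psi> j)) * \<Lambda> i g" if "j \<in> I" for i j
      by (subst add[OF \<psi>(1)[OF that] test_fun_cmult[OF g(1)]]) (simp only: mult)
    show ?case
    proof (intro exI[of _ \<psi>'] conjI ballI)
      fix i assume "i \<in> insert m I"
      show "\<psi>' i \<in> test_fun"
      proof (cases "i = m")
        case True then show ?thesis using g(1) by (simp add: \<psi>'_def)
      next
        case False
        then have "i \<in> I" using \<open>i \<in> insert m I\<close> by simp
        from test_fun_add[OF \<psi>(1)[OF this] test_fun_cmult[OF g(1), of "- \<Lambda> m (\<psi> i)"]]
        show ?thesis unfolding \<psi>'_def using False by (simp only: if_False)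
      qed
    next
      fix i j assume ij: "i \<in> insert m I" "j \<in> insert m I"
      show "\<Lambda> i (\<psi>' j) = (if i = j then 1 else 0)"
      proof (cases "j = m")
        case True then show ?thesis using ij g insert.hyps by (auto simp: \<psi>'_def)
      next
        case False
        then have "j \<in> I" using ij by simp
        then show ?thesis using False ij g(2,3) \<psi>(2) l'[of j i] by (auto simp: \<psi>'_def)
      qed
    qed
  qed simp
qed

lemma finite_multi_indices: "finite {\<beta>::'a::euclidean_space multiset. multi_index \<beta> \<and> size \<beta> \<le> q}"
proof -
  have "{\<beta>::'a multiset. multi_index \<beta> \<and> size \<beta> \<le> q} = (\<Union>n\<le>q. multisets_of_size Basis n)"
    by (auto simp: multi_index_def multisets_of_size_def)
  then show ?thesis by (simp add: finite_multisets_of_size)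
qed

text \<open>A linear relation between the moments of all test functions says that a polynomial
  integrates to 0 against each of them. The polynomial vanishes by \<open>fundamental_lemma\<close>,
  its coefficients by independence of the monomials, and \<open>dual_family\<close> applies.\<close>

lemma dual_test_functions:
  obtains \<psi> :: "'a::euclidean_space multiset \<Rightarrow> 'a \<Rightarrow> complex"
  where "\<And>\<beta>. multi_index \<beta> \<Longrightarrow> size \<beta> \<le> q \<Longrightarrow> \<psi> \<beta> \<in> test_fun"
    "\<And>\<beta> \<gamma>. multi_index \<beta> \<Longrightarrow> size \<beta> \<le> q \<Longrightarrow> multi_index \<gamma> \<Longrightarrow> size \<gamma> \<le> q \<Longrightarrow>
      moment \<beta> (\<psi> \<gamma>) = (if \<beta> = \<gamma> then 1 else 0)"
proof -
  define I where "I = {\<beta>::'a multiset. multi_index \<beta> \<and> size \<beta> \<le> q}"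
  have fI: "finite I" unfolding I_def by (rule finite_multi_indices)
  have ind: "c \<beta> = 0" if z: "\<And>f. f \<in> test_fun \<Longrightarrow> (\<Sum>\<beta>\<in>I. c \<beta> * moment \<beta> f) = 0" and "\<beta> \<in> I" for c \<beta>
  proof (rule monom_linear_independent[where c = c, OF fI _ _ \<open>\<beta> \<in> I\<close>])
    show "multi_index \<gamma>" if "\<gamma> \<in> I" for \<gamma> using that by (simp add: I_def)
    show "(\<Sum>\<beta>\<in>I. c \<beta> * monom \<beta> \<xi>) = 0" for \<xi>
    proof (rule fundamental_lemma[of "\<lambda>\<xi>. \<Sum>\<beta>\<in>I. c \<beta> * monom \<beta> \<xi>" \<xi>])
      show "continuous_on UNIV (\<lambda>\<xi>. \<Sum>\<beta>\<in>I. c \<beta> * monom \<beta> \<xi>)"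
        by (intro continuous_intros continuous_on_monom)
      fix f :: "'a \<Rightarrow> complex" assume f: "f \<in> test_fun"
      have "integral UNIV (\<lambda>\<xi>. (\<Sum>\<beta>\<in>I. c \<beta> * monom \<beta> \<xi>) * f \<xi>) = integral UNIV (\<lambda>\<xi>. \<Sum>\<beta>\<in>I. c \<beta> * (monom \<beta> \<xi> * f \<xi>))"
        by (simp add: sum_distrib_right mult.assoc)
      also have "\<dots> = (\<Sum>\<beta>\<in>I. integral UNIV (\<lambda>\<xi>. c \<beta> * (monom \<beta> \<xi> * f \<xi>)))"
        by (intro integral_sum fI integrable_on_mult_right moment_integrable f)
      also have "\<dots> = (\<Sum>\<beta>\<in>I. c \<beta> * moment \<beta> f)" by (simp add: moment_def)
      finally show "integral UNIV (\<lambda>\<xi>. (\<Sum>\<beta>\<in>I. c \<beta> * monom \<beta> \<xi>) * f \<xi>) = 0" using z[OF f] by simp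
    qed
  qed
  have "\<exists>\<psi>. (\<forall>i\<in>I. \<psi> i \<in> test_fun) \<and> (\<forall>i\<in>I. \<forall>j\<in>I. moment i (\<psi> j) = (if i = j then 1 else 0))"
    by (rule dual_family[OF fI]) (rule moment_add moment_cmult ind; assumption)+
  then show ?thesis using that unfolding I_def by blast
qed

section \<open>Families of test functions\<close>

text \<open>A quadratic error is what Taylor's formula delivers uniformly in a parameter; in this
  form the derivative can be taken through a moment.\<close>

lemma has_vector_derivative_quadratic:
  fixes f :: "'a::real_vector \<Rightarrow> 'b::real_normed_vector"
  assumes r: "r > 0" and bound: "\<And>t. \<bar>t\<bar> < r \<Longrightarrow> norm (f (x + t *\<^sub>R v) - f x - t *\<^sub>R D) \<le> C * t\<^sup>2"
  shows "((\<lambda>t. f (x + t *\<^sub>R v)) has_vector_derivative D) (at 0)"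
  unfolding has_vector_derivative_at_0_iff
proof (rule LIM_zero_cancel, rule tendsto_norm_zero_cancel, rule tendsto_sandwich[OF _ _ tendsto_const])
  show "\<forall>\<^sub>F t in at (0::real). 0 \<le> norm ((f (x + t *\<^sub>R v) - f x) /\<^sub>R t - D)" by simp
  have "\<forall>\<^sub>F t in at (0::real). \<bar>t\<bar> < r \<and> t \<noteq> 0" using r by (auto simp: eventually_at dist_norm)
  then show "\<forall>\<^sub>F t in at (0::real). norm ((f (x + t *\<^sub>R v) - f x) /\<^sub>R t - D) \<le> C * \<bar>t\<bar>"
  proof eventually_elim
    case (elim t)
    then have "(f (x + t *\<^sub>R v) - f x) /\<^sub>R t - D = (f (x + t *\<^sub>R v) - f x - t *\<^sub>R D) /\<^sub>R t"
      by (simp add: scaleR_diff_right)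
    then have "norm ((f (x + t *\<^sub>R v) - f x) /\<^sub>R t - D) = norm (f (x + t *\<^sub>R v) - f x - t *\<^sub>R D) / \<bar>t\<bar>"
      by (simp add: divide_inverse mult.commute)
    also have "\<dots> \<le> C * t\<^sup>2 / \<bar>t\<bar>" using bound[of t] elim by (intro divide_right_mono) auto
    also have "t\<^sup>2 = \<bar>t\<bar> * \<bar>t\<bar>" by (simp add: power2_eq_square)
    also have "C * (\<bar>t\<bar> * \<bar>t\<bar>) / \<bar>t\<bar> = C * \<bar>t\<bar>" using elim nonzero_mult_div_cancel_right[of "\<bar>t\<bar>" "C * \<bar>t\<bar>"]
      by (simp only: mult.assoc[symmetric]) simp
    finally show ?case .
  qed
  have "((\<lambda>t. C * \<bar>t\<bar>) \<longlongrightarrow> C * \<bar>0\<bar>) (at (0::real))" by (intro tendsto_intros)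
  then show "((\<lambda>t. C * \<bar>t\<bar>) \<longlongrightarrow> 0) (at (0::real))" by simp
qed

lemma A_0_iff_moment: "\<phi> \<in> A 0 \<longleftrightarrow> \<phi> \<in> test_fun \<and> moment {#} \<phi> = 1"
  by (auto simp: A_iff_moments)

lemma Cb_A: "\<phi> \<in> Cb \<Omega> q \<Longrightarrow> \<epsilon> \<in> {0<..1} \<Longrightarrow> x \<in> \<Omega> \<Longrightarrow> \<phi> \<epsilon> x \<in> A q"
  unfolding Cb_def by blast

lemma Cb_smooth_D_curve:
  "\<phi> \<in> Cb \<Omega> q \<Longrightarrow> smooth_curve e \<Longrightarrow> smooth_curve y \<Longrightarrow> (\<And>t. e t \<in> {0<..1}) \<Longrightarrow> (\<And>t. y t \<in> \<Omega>) \<Longrightarrow>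
    smooth_D_curve (\<lambda>t. \<phi> (e t) (y t))"
  unfolding Cb_def by blast

lemma Cb_D_bounded:
  "\<phi> \<in> Cb \<Omega> q \<Longrightarrow> compact K \<Longrightarrow> K \<subseteq> \<Omega> \<Longrightarrow> multi_index \<alpha> \<Longrightarrow>
    D_bounded {xdiff \<alpha> \<phi> \<epsilon> x |\<epsilon> x. \<epsilon> \<in> {0<..1} \<and> x \<in> K}"
  unfolding Cb_def by blast

lemma Cb_mono: "Cb \<Omega> q \<subseteq> Cb \<Omega> 0"
  using A_mono[of q] unfolding Cb_def by blast

lemma Cb_improve:
  "\<phi> \<in> Cb \<Omega> 0 \<Longrightarrow> (\<And>\<epsilon> x. \<epsilon> \<in> {0<..1} \<Longrightarrow> x \<in> \<Omega> \<Longrightarrow> \<phi> \<epsilon> x \<in> A q) \<Longrightarrow> \<phi> \<in> Cb \<Omega> q"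
  unfolding Cb_def by blast

text \<open>For fixed \<open>\<epsilon>\<close>, evaluation at \<open>\<xi>\<close> turns smooth
  curves of test functions into smooth scalar curves, so Boman's theorem applies in the variable
  \<open>y\<close>. This gives meaning to the pointwise derivatives in \<open>xdiff\<close>.\<close>

lemma Cb_ray_smooth:
  assumes "open \<Omega>" and \<phi>: "\<phi> \<in> Cb \<Omega> q" and \<epsilon>: "\<epsilon> \<in> {0<..1}"
  shows "ray_smooth \<Omega> (\<lambda>y. \<phi> \<epsilon> y \<xi>)"
proof (rule curve_smooth_imp_ray_smooth[OF assms(1)])
  show "curve_smooth \<Omega> (\<lambda>y. \<phi> \<epsilon> y \<xi>)"
    unfolding curve_smooth_def
  proof (intro allI impI)
    fix c assume c: "smooth_curve c \<and> (\<forall>t. c t \<in> \<Omega>)"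
    have "smooth_D_curve (\<lambda>t. \<phi> \<epsilon> (c t))"
      using Cb_smooth_D_curve[OF \<phi> smooth_curve_const[of \<epsilon>], of c] c \<epsilon> by blast
    then show "smooth_curve (\<lambda>t. \<phi> \<epsilon> (c t) \<xi>)" by (rule smooth_D_curve_eval)
  qed
qed

lemma Cb_xdiff:
  assumes "open \<Omega>" "\<phi> \<in> Cb \<Omega> q" "\<epsilon> \<in> {0<..1}" "x \<in> \<Omega>"
  shows "xdiff (mset ds) \<phi> \<epsilon> x = (\<lambda>\<xi>. Dlist ds (\<lambda>y. \<phi> \<epsilon> y \<xi>) x)"
  unfolding xdiff_def using mdiff_eq_Dlist[OF assms(1) Cb_ray_smooth[OF assms(1-3)] assms(4)] by simp

lemma multi_index_mset: "multi_index (mset ds) \<longleftrightarrow> set ds \<subseteq> Basis"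
  by (simp add: multi_index_def)

text \<open>Extracts from boundedness in the space of test functions what estimates of moments use:
  a common compact support and a uniform bound.\<close>

lemma Cb_Dlist_bounds:
  assumes \<Omega>: "open \<Omega>" and \<phi>: "\<phi> \<in> Cb \<Omega> q" and K: "compact K" "K \<subseteq> \<Omega>" and ds: "set ds \<subseteq> Basis"
  shows "\<exists>K0 C. compact K0 \<and> (\<forall>\<epsilon>\<in>{0<..1}. \<forall>x\<in>K. (\<lambda>\<xi>. Dlist ds (\<lambda>y. \<phi> \<epsilon> y \<xi>) x) \<in> test_fun \<and>
    tsupp (\<lambda>\<xi>. Dlist ds (\<lambda>y. \<phi> \<epsilon> y \<xi>) x) \<subseteq> K0 \<and> (\<forall>\<xi>. norm (Dlist ds (\<lambda>y. \<phi> \<epsilon> y \<xi>) x) \<le> C))"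
proof -
  have "D_bounded {xdiff (mset ds) \<phi> \<epsilon> x |\<epsilon> x. \<epsilon> \<in> {0<..1} \<and> x \<in> K}"
    using Cb_D_bounded[OF \<phi> K, of "mset ds"] ds by (simp add: multi_index_mset)
  moreover have "{xdiff (mset ds) \<phi> \<epsilon> x |\<epsilon> x. \<epsilon> \<in> {0<..1} \<and> x \<in> K} =
      {(\<lambda>\<xi>. Dlist ds (\<lambda>y. \<phi> \<epsilon> y \<xi>) x) |\<epsilon> x. \<epsilon> \<in> {0<..1} \<and> x \<in> K}"
    using Cb_xdiff[OF \<Omega> \<phi>] K(2) by (metis (no_types, lifting) subsetD)
  ultimately have D: "D_bounded {(\<lambda>\<xi>. Dlist ds (\<lambda>y. \<phi> \<epsilon> y \<xi>) x) |\<epsilon> x. \<epsilon> \<in> {0<..1} \<and> x \<in> K}" by simp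
  let ?B = "{(\<lambda>\<xi>. Dlist ds (\<lambda>y. \<phi> \<epsilon> y \<xi>) x) |\<epsilon> x. \<epsilon> \<in> {0<..1} \<and> x \<in> K}"
  obtain K0 where K0: "compact K0" "\<forall>f\<in>?B. tsupp f \<subseteq> K0" and t: "?B \<subseteq> test_fun"
    using D unfolding D_bounded_def by blast
  have "\<exists>C. \<forall>f\<in>?B. \<forall>\<xi>. norm (Dlist [] f \<xi>) \<le> C"
    using D unfolding D_bounded_def by (elim conjE) (drule spec[of _ "[]"], simp)
  then obtain C where C: "\<forall>f\<in>?B. \<forall>\<xi>. norm (f \<xi>) \<le> C" by auto
  show ?thesis
  proof (intro exI conjI ballI)
    fix \<epsilon> :: real and x assume "\<epsilon> \<in> {0<..1}" "x \<in> K"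
    then have B: "(\<lambda>\<xi>. Dlist ds (\<lambda>y. \<phi> \<epsilon> y \<xi>) x) \<in> ?B" by blast
    show "(\<lambda>\<xi>. Dlist ds (\<lambda>y. \<phi> \<epsilon> y \<xi>) x) \<in> test_fun" using t B by (rule subsetD)
    show "tsupp (\<lambda>\<xi>. Dlist ds (\<lambda>y. \<phi> \<epsilon> y \<xi>) x) \<subseteq> K0" using K0(2) B by (rule bspec)
    show "\<forall>\<xi>. norm (Dlist ds (\<lambda>y. \<phi> \<epsilon> y \<xi>) x) \<le> C" using bspec[OF C B] .
  qed (rule K0(1))
qed

lemma moment_curve_smooth:
  assumes \<phi>: "\<phi> \<in> Cb \<Omega> q" and "smooth_curve e" "smooth_curve y" "\<And>t. e t \<in> {0<..1}" "\<And>t. y t \<in> \<Omega>"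
  shows "smooth_curve (\<lambda>t. moment \<beta> (\<phi> (e t) (y t)))"
  by (rule smooth_D_curve_moment[OF Cb_smooth_D_curve[OF assms]])

text \<open>Differentiation under the integral sign. Derivatives in \<open>x\<close> are taken
  pointwise in \<open>\<xi>\<close>, so a remainder uniform in \<open>\<xi>\<close> is needed:
  Taylor's formula bounds it by the second derivative along \<open>b\<close>, which is bounded for
  families in \<open>Cb\<close>, and all supports lie in one compact set.\<close>

lemma Dlist_moment:
  assumes \<Omega>: "open \<Omega>" and \<phi>: "\<phi> \<in> Cb \<Omega> q" and \<epsilon>: "\<epsilon> \<in> {0<..1}" and "x \<in> \<Omega>" "set ds \<subseteq> Basis"
  shows "Dlist ds (\<lambda>y. moment \<beta> (\<phi> \<epsilon> y)) x = moment \<beta> (\<lambda>\<xi>. Dlist ds (\<lambda>y. \<phi> \<epsilon> y \<xi>) x)"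
  using assms(4,5)
proof (induction ds arbitrary: x)
  case (Cons b ds)
  define u where "u ds x = (\<lambda>\<xi>. Dlist ds (\<lambda>y. \<phi> \<epsilon> y \<xi>) x)" for ds x
  have ds: "set ds \<subseteq> Basis" "set (b # ds) \<subseteq> Basis" "set (b # b # ds) \<subseteq> Basis" and b: "norm b = 1"
    using Cons.prems by auto
  obtain r where r: "r > 0" "cball x r \<subseteq> \<Omega>" using \<Omega> Cons.prems(1) open_contains_cball by blast
  have xr: "x + t *\<^sub>R b \<in> cball x r" if "\<bar>t\<bar> \<le> r" for t using that b by (simp add: dist_norm)
  obtain K1 C1 where 1: "compact K1" "\<And>y. y \<in> cball x r \<Longrightarrow> u ds y \<in> test_fun" "\<And>y. y \<in> cball x r \<Longrightarrow> tsupp (u ds y) \<subseteq> K1"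
    using Cb_Dlist_bounds[OF \<Omega> \<phi> compact_cball r(2) ds(1)] \<epsilon> unfolding u_def by blast
  obtain K2 C2 where 2: "compact K2" "\<And>y. y \<in> cball x r \<Longrightarrow> u (b # ds) y \<in> test_fun" "\<And>y. y \<in> cball x r \<Longrightarrow> tsupp (u (b # ds) y) \<subseteq> K2"
    using Cb_Dlist_bounds[OF \<Omega> \<phi> compact_cball r(2) ds(2)] \<epsilon> unfolding u_def by blast
  obtain K3 C where 3: "\<And>y \<xi>. y \<in> cball x r \<Longrightarrow> norm (u (b # b # ds) y \<xi>) \<le> C"
    using Cb_Dlist_bounds[OF \<Omega> \<phi> compact_cball r(2) ds(3)] \<epsilon> unfolding u_def by blast
  obtain M where M: "M \<ge> 0" "\<And>f C. f \<in> test_fun \<Longrightarrow> tsupp f \<subseteq> K1 \<union> K2 \<Longrightarrow> (\<And>\<xi>. norm (f \<xi>) \<le> C) \<Longrightarrow> norm (moment \<beta> f) \<le> M * C"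
    using moment_bound[OF compact_Un[OF 1(1) 2(1)], of \<beta>] by blast
  have x0: "x \<in> cball x r" using r(1) by simp
  have der: "((\<lambda>t. moment \<beta> (u ds (x + t *\<^sub>R b))) has_vector_derivative moment \<beta> (u (b # ds) x)) (at 0)"
  proof (rule has_vector_derivative_quadratic[OF r(1), where f = "\<lambda>y. moment \<beta> (u ds y)" and C = "M * C"])
    fix t assume t: "\<bar>t\<bar> < r"
    \<comment> \<open>The first-order Taylor remainder as a function of \<open>\<xi>\<close>,
      written with scalar multiples so that linearity of \<open>moment\<close> on
      \<open>test_fun\<close> applies.\<close>
    define f where "f = (\<lambda>\<xi>. u ds (x + t *\<^sub>R b) \<xi> + ((-1) * u ds x \<xi> + (- complex_of_real t) * u (b # ds) x \<xi>))"
    have xt: "x + t *\<^sub>R b \<in> cball x r" using t xr by simp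
    have tf: "(\<lambda>\<xi>. (-1) * u ds x \<xi>) \<in> test_fun" "(\<lambda>\<xi>. (- complex_of_real t) * u (b # ds) x \<xi>) \<in> test_fun"
      by (intro test_fun_cmult 1(2) 2(2) x0)+
    have f: "f \<in> test_fun" unfolding f_def by (intro test_fun_add tf 1(2) xt)
    have "norm (moment \<beta> f) \<le> M * (C * t\<^sup>2)"
    proof (rule M(2)[OF f])
      show "tsupp f \<subseteq> K1 \<union> K2"
      proof (rule tsupp_subsetI)
        show "closed (K1 \<union> K2)" using 1(1) 2(1) by (intro compact_imp_closed compact_Un)
        fix \<xi> assume "\<xi> \<notin> K1 \<union> K2"
        then have "u ds (x + t *\<^sub>R b) \<xi> = 0" "u ds x \<xi> = 0" "u (b # ds) x \<xi> = 0"
          using 1(3)[OF xt] 1(3)[OF x0] 2(3)[OF x0] by (blast intro: tsupp_0)+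
        then show "f \<xi> = 0" by (simp add: f_def)
      qed
      fix \<xi>
      define g where "g = Dlist ds (\<lambda>y. \<phi> \<epsilon> y \<xi>)"
      have g: "ray_smooth \<Omega> g" "ray_smooth \<Omega> (pdiff b g)"
        unfolding g_def using ray_smooth_Dlist[OF \<Omega> Cb_ray_smooth[OF \<Omega> \<phi> \<epsilon>], of ds]
          ray_smooth_Dlist[OF \<Omega> Cb_ray_smooth[OF \<Omega> \<phi> \<epsilon>], of "b # ds"] by simp_all
      have "norm (g (x + t *\<^sub>R b) - g x - t *\<^sub>R pdiff b g x) \<le> C * t\<^sup>2"
      proof (rule along_taylor[where S = \<Omega>])
        show "diff_along \<Omega> b g" "diff_along \<Omega> b (pdiff b g)"
          using g by (simp_all add: ray_smooth_diff_along_0)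
        fix s assume "\<bar>s\<bar> \<le> \<bar>t\<bar>"
        then have s: "x + s *\<^sub>R b \<in> cball x r" using t by (intro xr) simp
        then show "x + s *\<^sub>R b \<in> \<Omega>" using r(2) by blast
        show "norm (pdiff b (pdiff b g) (x + s *\<^sub>R b)) \<le> C" using 3[OF s, of \<xi>] by (simp add: u_def g_def)
      qed
      then show "norm (f \<xi>) \<le> C * t\<^sup>2"
        by (simp add: f_def u_def g_def scaleR_conv_of_real algebra_simps)
    qed
    moreover have "moment \<beta> f = moment \<beta> (u ds (x + t *\<^sub>R b)) - moment \<beta> (u ds x) - t *\<^sub>R moment \<beta> (u (b # ds) x)"
    proof -
      have "moment \<beta> f = moment \<beta> (u ds (x + t *\<^sub>R b)) + (moment \<beta> (\<lambda>\<xi>. (-1) * u ds x \<xi>) + moment \<beta> (\<lambda>\<xi>. (- complex_of_real t) * u (b # ds) x \<xi>))"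
        unfolding f_def moment_add[OF 1(2)[OF xt] test_fun_add[OF tf]] moment_add[OF tf] ..
      then show ?thesis unfolding moment_cmult by (simp add: scaleR_conv_of_real)
    qed
    ultimately show "norm (moment \<beta> (u ds (x + t *\<^sub>R b)) - moment \<beta> (u ds x) - t *\<^sub>R moment \<beta> (u (b # ds) x)) \<le> M * C * t\<^sup>2"
      by (simp add: mult.assoc)
  qed
  have "Dlist (b # ds) (\<lambda>y. moment \<beta> (\<phi> \<epsilon> y)) x = pdiff b (\<lambda>y. moment \<beta> (u ds y)) x"
    using pdiff_cong_open(2)[OF \<Omega> Cons.prems(1), of "Dlist ds (\<lambda>y. moment \<beta> (\<phi> \<epsilon> y))" "\<lambda>y. moment \<beta> (u ds y)"] Cons.IH ds(1)
    by (simp add: u_def)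
  also have "\<dots> = moment \<beta> (u (b # ds) x)" by (rule pdiff_eqI) (rule der)
  finally show ?case by (simp add: u_def)
qed simp

subsection \<open>Perturbations by scalar families\<close>

text \<open>The scalar counterpart of \<open>Cb\<close>: admissible coefficients of a fixed test
  function that is added to a family. As in \<open>Cb\<close>, the bounds concern derivatives in
  \<open>x\<close> only.\<close>

definition scalar_family :: "'a::euclidean_space set \<Rightarrow> (real \<Rightarrow> 'a \<Rightarrow> complex) \<Rightarrow> bool" where
  "scalar_family \<Omega> \<mu> \<longleftrightarrow>
     (\<forall>e y. smooth_curve e \<and> smooth_curve y \<and> (\<forall>t. e t \<in> {0<..1} \<and> y t \<in> \<Omega>) \<longrightarrow> smooth_curve (\<lambda>t. \<mu> (e t) (y t))) \<and>
     (\<forall>K ds. compact K \<and> K \<subseteq> \<Omega> \<and> set ds \<subseteq> Basis \<longrightarrow>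
        (\<exists>C. \<forall>\<epsilon>\<in>{0<..1}. \<forall>x\<in>K. norm (Dlist ds (\<mu> \<epsilon>) x) \<le> C))"

lemma scalar_family_curve:
  "scalar_family \<Omega> \<mu> \<Longrightarrow> smooth_curve e \<Longrightarrow> smooth_curve y \<Longrightarrow> (\<And>t. e t \<in> {0<..1}) \<Longrightarrow> (\<And>t. y t \<in> \<Omega>) \<Longrightarrow>
    smooth_curve (\<lambda>t. \<mu> (e t) (y t))"
  unfolding scalar_family_def by blast

lemma scalar_family_bound:
  "scalar_family \<Omega> \<mu> \<Longrightarrow> compact K \<Longrightarrow> K \<subseteq> \<Omega> \<Longrightarrow> set ds \<subseteq> Basis \<Longrightarrow>
    \<exists>C. \<forall>\<epsilon>\<in>{0<..1}. \<forall>x\<in>K. norm (Dlist ds (\<mu> \<epsilon>) x) \<le> C"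
  unfolding scalar_family_def by blast

lemma scalar_family_ray_smooth:
  assumes "open \<Omega>" and \<mu>: "scalar_family \<Omega> \<mu>" and \<epsilon>: "\<epsilon> \<in> {0<..1}"
  shows "ray_smooth \<Omega> (\<mu> \<epsilon>)"
proof (rule curve_smooth_imp_ray_smooth[OF assms(1)])
  show "curve_smooth \<Omega> (\<mu> \<epsilon>)"
    unfolding curve_smooth_def
  proof (intro allI impI)
    fix c assume c: "smooth_curve c \<and> (\<forall>t. c t \<in> \<Omega>)"
    show "smooth_curve (\<lambda>t. \<mu> \<epsilon> (c t))"
      by (rule scalar_family_curve[OF \<mu> smooth_curve_const[of \<epsilon>]]) (use c \<epsilon> in auto)
  qed
qed

lemma scalar_family_smooth_on:
  "open \<Omega> \<Longrightarrow> scalar_family \<Omega> \<mu> \<Longrightarrow> \<epsilon> \<in> {0<..1} \<Longrightarrow> smooth_on \<Omega> (\<mu> \<epsilon>)"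
  by (rule ray_smooth_imp_smooth_on[OF _ scalar_family_ray_smooth])

lemma scalar_family_moment:
  assumes \<Omega>: "open \<Omega>" and \<phi>: "\<phi> \<in> Cb \<Omega> q"
  shows "scalar_family \<Omega> (\<lambda>\<epsilon> x. moment \<beta> (\<phi> \<epsilon> x))"
  unfolding scalar_family_def
proof (intro conjI allI impI)
  fix e :: "real \<Rightarrow> real" and y :: "real \<Rightarrow> 'a" assume "smooth_curve e \<and> smooth_curve y \<and> (\<forall>t. e t \<in> {0<..1} \<and> y t \<in> \<Omega>)"
  then show "smooth_curve (\<lambda>t. moment \<beta> (\<phi> (e t) (y t)))" by (intro moment_curve_smooth[OF \<phi>]) auto
next
  fix K :: "'a set" and ds :: "'a list" assume K: "compact K \<and> K \<subseteq> \<Omega> \<and> set ds \<subseteq> Basis"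
  then obtain K0 C where K0: "compact K0" "\<And>\<epsilon> x. \<epsilon> \<in> {0<..1} \<Longrightarrow> x \<in> K \<Longrightarrow> (\<lambda>\<xi>. Dlist ds (\<lambda>y. \<phi> \<epsilon> y \<xi>) x) \<in> test_fun \<and>
    tsupp (\<lambda>\<xi>. Dlist ds (\<lambda>y. \<phi> \<epsilon> y \<xi>) x) \<subseteq> K0 \<and> (\<forall>\<xi>. norm (Dlist ds (\<lambda>y. \<phi> \<epsilon> y \<xi>) x) \<le> C)"
    using Cb_Dlist_bounds[OF \<Omega> \<phi>, of K ds] by blast
  obtain M where M: "M \<ge> 0" "\<And>f C. f \<in> test_fun \<Longrightarrow> tsupp f \<subseteq> K0 \<Longrightarrow> (\<And>\<xi>. norm (f \<xi>) \<le> C) \<Longrightarrow> norm (moment \<beta> f) \<le> M * C"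
    using moment_bound[OF K0(1), of \<beta>] by blast
  have "norm (Dlist ds (\<lambda>x. moment \<beta> (\<phi> \<epsilon> x)) x) \<le> M * C" if \<epsilon>: "\<epsilon> \<in> {0<..1}" and x: "x \<in> K" for \<epsilon> x
  proof -
    have "Dlist ds (\<lambda>x. moment \<beta> (\<phi> \<epsilon> x)) x = moment \<beta> (\<lambda>\<xi>. Dlist ds (\<lambda>y. \<phi> \<epsilon> y \<xi>) x)"
      by (rule Dlist_moment[OF \<Omega> \<phi> \<epsilon>]) (use K x in auto)
    moreover have "norm (moment \<beta> (\<lambda>\<xi>. Dlist ds (\<lambda>y. \<phi> \<epsilon> y \<xi>) x)) \<le> M * C"
      using K0(2)[OF \<epsilon> x] by (intro M(2)) auto
    ultimately show ?thesis by simp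
  qed
  then show "\<exists>C. \<forall>\<epsilon>\<in>{0<..1}. \<forall>x\<in>K. norm (Dlist ds (\<lambda>x. moment \<beta> (\<phi> \<epsilon> x)) x) \<le> C" by blast
qed

lemma scalar_family_add:
  assumes \<Omega>: "open \<Omega>" and \<mu>: "scalar_family \<Omega> \<mu>" and \<nu>: "scalar_family \<Omega> \<nu>"
  shows "scalar_family \<Omega> (\<lambda>\<epsilon> x. \<mu> \<epsilon> x + \<nu> \<epsilon> x)"
  unfolding scalar_family_def
proof (intro conjI allI impI)
  fix e :: "real \<Rightarrow> real" and y :: "real \<Rightarrow> 'a" assume "smooth_curve e \<and> smooth_curve y \<and> (\<forall>t. e t \<in> {0<..1} \<and> y t \<in> \<Omega>)"
  then show "smooth_curve (\<lambda>t. \<mu> (e t) (y t) + \<nu> (e t) (y t))"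
    by (intro smooth_curve_add scalar_family_curve[OF \<mu>] scalar_family_curve[OF \<nu>]) auto
next
  fix K :: "'a set" and ds :: "'a list" assume K: "compact K \<and> K \<subseteq> \<Omega> \<and> set ds \<subseteq> Basis"
  obtain C where C: "\<And>\<epsilon> x. \<epsilon> \<in> {0<..1} \<Longrightarrow> x \<in> K \<Longrightarrow> norm (Dlist ds (\<mu> \<epsilon>) x) \<le> C"
    using scalar_family_bound[OF \<mu>, of K ds] K by blast
  obtain C' where C': "\<And>\<epsilon> x. \<epsilon> \<in> {0<..1} \<Longrightarrow> x \<in> K \<Longrightarrow> norm (Dlist ds (\<nu> \<epsilon>) x) \<le> C'"
    using scalar_family_bound[OF \<nu>, of K ds] K by blast
  have "norm (Dlist ds (\<lambda>x. \<mu> \<epsilon> x + \<nu> \<epsilon> x) x) \<le> C + C'" if \<epsilon>: "\<epsilon> \<in> {0<..1}" and x: "x \<in> K" for \<epsilon> x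
  proof -
    have "Dlist ds (\<lambda>x. \<mu> \<epsilon> x + \<nu> \<epsilon> x) x = Dlist ds (\<mu> \<epsilon>) x + Dlist ds (\<nu> \<epsilon>) x"
      by (rule Dlist_add(1)[OF \<Omega> scalar_family_smooth_on[OF \<Omega> \<mu> \<epsilon>] scalar_family_smooth_on[OF \<Omega> \<nu> \<epsilon>]]) (use K x in auto)
    then show ?thesis using norm_triangle_le[OF add_mono[OF C[OF that] C'[OF that]]] by simp
  qed
  then show "\<exists>C. \<forall>\<epsilon>\<in>{0<..1}. \<forall>x\<in>K. norm (Dlist ds (\<lambda>x. \<mu> \<epsilon> x + \<nu> \<epsilon> x) x) \<le> C" by blast
qed

lemma scalar_family_cmult:
  assumes \<Omega>: "open \<Omega>" and \<mu>: "scalar_family \<Omega> \<mu>"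
  shows "scalar_family \<Omega> (\<lambda>\<epsilon> x. k * \<mu> \<epsilon> x)"
  unfolding scalar_family_def
proof (intro conjI allI impI)
  fix e :: "real \<Rightarrow> real" and y :: "real \<Rightarrow> 'a" assume "smooth_curve e \<and> smooth_curve y \<and> (\<forall>t. e t \<in> {0<..1} \<and> y t \<in> \<Omega>)"
  then show "smooth_curve (\<lambda>t. k * \<mu> (e t) (y t))"
    by (intro smooth_curve_mult smooth_curve_const scalar_family_curve[OF \<mu>]) auto
next
  fix K :: "'a set" and ds :: "'a list" assume K: "compact K \<and> K \<subseteq> \<Omega> \<and> set ds \<subseteq> Basis"
  obtain C where C: "\<And>\<epsilon> x. \<epsilon> \<in> {0<..1} \<Longrightarrow> x \<in> K \<Longrightarrow> norm (Dlist ds (\<mu> \<epsilon>) x) \<le> C"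
    using scalar_family_bound[OF \<mu>, of K ds] K by blast
  have "norm (Dlist ds (\<lambda>x. k * \<mu> \<epsilon> x) x) \<le> norm k * C" if \<epsilon>: "\<epsilon> \<in> {0<..1}" and x: "x \<in> K" for \<epsilon> x
  proof -
    have "Dlist ds (\<lambda>x. k * \<mu> \<epsilon> x) x = k * Dlist ds (\<mu> \<epsilon>) x"
      by (rule Dlist_linear(1)[OF \<Omega> scalar_family_smooth_on[OF \<Omega> \<mu> \<epsilon>] bounded_linear_mult_right]) (use K x in auto)
    then show ?thesis using C[OF that] by (simp add: norm_mult mult_left_mono)
  qed
  then show "\<exists>C. \<forall>\<epsilon>\<in>{0<..1}. \<forall>x\<in>K. norm (Dlist ds (\<lambda>x. k * \<mu> \<epsilon> x) x) \<le> C" by blast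
qed

text \<open>Derivatives in \<open>\<epsilon>\<close> need no bounds, so any bounded smooth function
  of \<open>inverse \<epsilon>\<close> may be a coefficient, however fast it oscillates as
  \<open>\<epsilon>\<close> tends to 0. This is the freedom that allows values to be prescribed at a
  sequence of scales.\<close>

lemma scalar_family_separated:
  fixes g :: "'a::euclidean_space \<Rightarrow> complex"
  assumes \<Omega>: "open \<Omega>" and g: "curve_smooth \<Omega> g" and a: "smooth_curve a" "\<And>s. norm (a s) \<le> B"
  shows "scalar_family \<Omega> (\<lambda>\<epsilon> x. a (inverse \<epsilon>) * g x)"
  unfolding scalar_family_def
proof (intro conjI allI impI)
  fix e :: "real \<Rightarrow> real" and y :: "real \<Rightarrow> 'a" assume ey: "smooth_curve e \<and> smooth_curve y \<and> (\<forall>t. e t \<in> {0<..1} \<and> y t \<in> \<Omega>)"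
  have "smooth_curve (\<lambda>t. inverse (e t))"
  proof (rule smooth_curve_inverse)
    show "e t \<noteq> 0" for t using ey[THEN conjunct2, THEN conjunct2, rule_format, of t] by auto
  qed (use ey in blast)
  then have "smooth_curve (\<lambda>t. a (inverse (e t)))" by (rule smooth_curve_compose[OF a(1)])
  moreover have "smooth_curve (\<lambda>t. g (y t))" using g ey unfolding curve_smooth_def by blast
  ultimately show "smooth_curve (\<lambda>t. a (inverse (e t)) * g (y t))" by (rule smooth_curve_mult)
next
  fix K :: "'a set" and ds :: "'a list" assume K: "compact K \<and> K \<subseteq> \<Omega> \<and> set ds \<subseteq> Basis"
  have gs: "smooth_on \<Omega> g" by (intro ray_smooth_imp_smooth_on curve_smooth_imp_ray_smooth \<Omega> g)
  then have "continuous_on \<Omega> (Dlist ds g)" using K by (simp add: smooth_on_def)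
  then have "continuous_on K (Dlist ds g)" using K continuous_on_subset by blast
  then have "bounded (Dlist ds g ` K)" using K by (intro compact_imp_bounded compact_continuous_image) auto
  then obtain C where C: "\<And>x. x \<in> K \<Longrightarrow> norm (Dlist ds g x) \<le> C" unfolding bounded_iff by blast
  have "norm (Dlist ds (\<lambda>x. a (inverse \<epsilon>) * g x) x) \<le> B * C" if x: "x \<in> K" for \<epsilon> x
  proof -
    have "Dlist ds (\<lambda>x. a (inverse \<epsilon>) * g x) x = a (inverse \<epsilon>) * Dlist ds g x"
      by (rule Dlist_linear(1)[OF \<Omega> gs bounded_linear_mult_right]) (use K x in auto)
    moreover have "norm (a (inverse \<epsilon>)) * norm (Dlist ds g x) \<le> B * C"
      using a(2)[of "inverse \<epsilon>"] C[OF x] order_trans[OF norm_ge_zero a(2)] by (intro mult_mono) auto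
    ultimately show ?thesis by (simp add: norm_mult)
  qed
  then show "\<exists>C. \<forall>\<epsilon>\<in>{0<..1}. \<forall>x\<in>K. norm (Dlist ds (\<lambda>x. a (inverse \<epsilon>) * g x) x) \<le> C" by blast
qed

lemma D_bounded_family_iff:
  fixes F :: "real \<Rightarrow> 'a::euclidean_space \<Rightarrow> 'a \<Rightarrow> complex"
  shows "D_bounded {F \<epsilon> x |\<epsilon> x. \<epsilon> \<in> I \<and> x \<in> K} \<longleftrightarrow>
    (\<forall>\<epsilon>\<in>I. \<forall>x\<in>K. F \<epsilon> x \<in> test_fun) \<and>
    (\<exists>K0. compact K0 \<and> (\<forall>\<epsilon>\<in>I. \<forall>x\<in>K. tsupp (F \<epsilon> x) \<subseteq> K0)) \<and>
    (\<forall>ds. set ds \<subseteq> Basis \<longrightarrow> (\<exists>C. \<forall>\<epsilon>\<in>I. \<forall>x\<in>K. \<forall>\<xi>. norm (Dlist ds (F \<epsilon> x) \<xi>) \<le> C))"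
proof -
  have B: "(\<forall>f\<in>{F \<epsilon> x |\<epsilon> x. \<epsilon> \<in> I \<and> x \<in> K}. P f) \<longleftrightarrow> (\<forall>\<epsilon>\<in>I. \<forall>x\<in>K. P (F \<epsilon> x))" for P by blast
  show ?thesis unfolding D_bounded_def subset_eq[of _ test_fun] B by (rule refl)
qed

text \<open>The integral stays 1 because \<open>\<psi>\<close> has integral 0. Each derivative in
  \<open>x\<close> is that of \<open>\<phi>\<close> plus a bounded scalar times
  \<open>\<psi>\<close>, so boundedness in the space of test functions is inherited.\<close>

lemma Cb_perturb:
  assumes \<Omega>: "open \<Omega>" and \<phi>: "\<phi> \<in> Cb \<Omega> 0" and \<mu>: "scalar_family \<Omega> \<mu>"
    and \<psi>: "\<psi> \<in> test_fun" "moment {#} \<psi> = 0"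
  shows "(\<lambda>\<epsilon> x \<xi>. \<phi> \<epsilon> x \<xi> + \<mu> \<epsilon> x * \<psi> \<xi>) \<in> Cb \<Omega> 0"
  unfolding Cb_def
proof (intro CollectI conjI ballI allI impI)
  fix \<epsilon> :: real and x assume "\<epsilon> \<in> {0<..1}" "x \<in> \<Omega>"
  then have "\<phi> \<epsilon> x \<in> A 0" by (rule Cb_A[OF \<phi>])
  then have \<phi>x: "\<phi> \<epsilon> x \<in> test_fun" "moment {#} (\<phi> \<epsilon> x) = 1" by (simp_all only: A_0_iff_moment)
  show "(\<lambda>\<xi>. \<phi> \<epsilon> x \<xi> + \<mu> \<epsilon> x * \<psi> \<xi>) \<in> A 0"
    unfolding A_0_iff_moment moment_add[OF \<phi>x(1) test_fun_cmult[OF \<psi>(1)]] moment_cmult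
    using test_fun_add[OF \<phi>x(1) test_fun_cmult[OF \<psi>(1)]] \<phi>x(2) \<psi>(2) by simp
next
  fix e :: "real \<Rightarrow> real" and y :: "real \<Rightarrow> 'a" assume ey: "smooth_curve e \<and> smooth_curve y \<and> (\<forall>t. e t \<in> {0<..1} \<and> y t \<in> \<Omega>)"
  show "smooth_D_curve (\<lambda>t \<xi>. \<phi> (e t) (y t) \<xi> + \<mu> (e t) (y t) * \<psi> \<xi>)"
  proof (rule smooth_D_curve_add_scaled[OF _ _ \<psi>(1)])
    show "smooth_D_curve (\<lambda>t. \<phi> (e t) (y t))" using ey by (intro Cb_smooth_D_curve[OF \<phi>]) auto
    show "smooth_curve (\<lambda>t. \<mu> (e t) (y t))" using ey by (intro scalar_family_curve[OF \<mu>]) auto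
  qed
next
  fix K and \<alpha> :: "'a multiset" assume K: "compact K \<and> K \<subseteq> \<Omega> \<and> multi_index \<alpha>"
  obtain ds where ds: "mset ds = \<alpha>" using ex_mset by blast
  then have dsB: "set ds \<subseteq> Basis" using K by (auto simp: multi_index_mset)
  define \<phi>' where "\<phi>' = (\<lambda>\<epsilon> x \<xi>. \<phi> \<epsilon> x \<xi> + \<mu> \<epsilon> x * \<psi> \<xi>)"
  have x': "xdiff \<alpha> \<phi>' \<epsilon> x = (\<lambda>\<xi>. xdiff \<alpha> \<phi> \<epsilon> x \<xi> + Dlist ds (\<mu> \<epsilon>) x * \<psi> \<xi>)"
    if \<epsilon>: "\<epsilon> \<in> {0<..1}" and x: "x \<in> K" for \<epsilon> x
  proof
    fix \<xi>
    have xO: "x \<in> \<Omega>" using x K by blast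
    \<comment> \<open>The order of differentiation that \<open>mdiff\<close> picks; by symmetry it
      is exchanged in the derivative of \<open>\<mu>\<close> for the fixed \<open>ds\<close>, for
      which a bound is available.\<close>
    define ds' where "ds' = (SOME ds. mset ds = \<alpha>)"
    have ds': "mset ds' = \<alpha>" unfolding ds'_def using ds by (rule someI)
    then have ds'B: "set ds' \<subseteq> Basis" using K by (auto simp: multi_index_mset)
    have s1: "smooth_on \<Omega> (\<lambda>y. \<phi> \<epsilon> y \<xi>)" by (intro ray_smooth_imp_smooth_on \<Omega> Cb_ray_smooth[OF \<Omega> \<phi> \<epsilon>])
    have s2: "smooth_on \<Omega> (\<mu> \<epsilon>)" by (rule scalar_family_smooth_on[OF \<Omega> \<mu> \<epsilon>])
    have s3: "smooth_on \<Omega> (\<lambda>y. \<mu> \<epsilon> y * \<psi> \<xi>)" by (rule Dlist_linear(2)[OF \<Omega> s2 bounded_linear_mult_left])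
    have "xdiff \<alpha> \<phi>' \<epsilon> x \<xi> = Dlist ds' (\<lambda>y. \<phi> \<epsilon> y \<xi> + \<mu> \<epsilon> y * \<psi> \<xi>) x"
      by (simp add: xdiff_def mdiff_def \<phi>'_def ds'_def)
    also have "\<dots> = Dlist ds' (\<lambda>y. \<phi> \<epsilon> y \<xi>) x + Dlist ds' (\<lambda>y. \<mu> \<epsilon> y * \<psi> \<xi>) x"
      by (rule Dlist_add(1)[OF \<Omega> s1 s3 ds'B xO])
    also have "Dlist ds' (\<lambda>y. \<mu> \<epsilon> y * \<psi> \<xi>) x = Dlist ds' (\<mu> \<epsilon>) x * \<psi> \<xi>"
      by (rule Dlist_linear(1)[OF \<Omega> s2 bounded_linear_mult_left ds'B xO])
    also have "Dlist ds' (\<mu> \<epsilon>) x = Dlist ds (\<mu> \<epsilon>) x"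
      by (rule Dlist_perm[OF \<Omega> scalar_family_ray_smooth[OF \<Omega> \<mu> \<epsilon>] _ xO]) (simp add: ds ds')
    finally show "xdiff \<alpha> \<phi>' \<epsilon> x \<xi> = xdiff \<alpha> \<phi> \<epsilon> x \<xi> + Dlist ds (\<mu> \<epsilon>) x * \<psi> \<xi>"
      by (simp add: xdiff_def mdiff_def ds'_def)
  qed
  obtain C\<mu> where C\<mu>: "\<And>\<epsilon> x. \<epsilon> \<in> {0<..1} \<Longrightarrow> x \<in> K \<Longrightarrow> norm (Dlist ds (\<mu> \<epsilon>) x) \<le> C\<mu>"
    using scalar_family_bound[OF \<mu>, of K ds] K dsB by blast
  have D: "D_bounded {xdiff \<alpha> \<phi> \<epsilon> x |\<epsilon> x. \<epsilon> \<in> {0<..1} \<and> x \<in> K}" using K by (intro Cb_D_bounded[OF \<phi>]) auto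
  note D' = D[unfolded D_bounded_family_iff]
  have tf: "xdiff \<alpha> \<phi> \<epsilon> x \<in> test_fun" if "\<epsilon> \<in> {0<..1}" "x \<in> K" for \<epsilon> x
    by (rule bspec[OF bspec[OF conjunct1[OF D'] that(1)] that(2)])
  have tf': "(\<lambda>\<xi>. Dlist ds (\<mu> \<epsilon>) x * \<psi> \<xi>) \<in> test_fun" for \<epsilon> x by (rule test_fun_cmult[OF \<psi>(1)])
  obtain K0 where K0: "compact K0" and K0': "\<forall>\<epsilon>\<in>{0<..1}. \<forall>x\<in>K. tsupp (xdiff \<alpha> \<phi> \<epsilon> x) \<subseteq> K0"
    using conjunct1[OF conjunct2[OF D']] by (elim exE conjE)
  have "D_bounded {xdiff \<alpha> \<phi>' \<epsilon> x |\<epsilon> x. \<epsilon> \<in> {0<..1} \<and> x \<in> K}"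
    unfolding D_bounded_family_iff
  proof (intro conjI allI impI)
    show "\<forall>\<epsilon>\<in>{0<..1}. \<forall>x\<in>K. xdiff \<alpha> \<phi>' \<epsilon> x \<in> test_fun"
    proof (intro ballI)
      fix \<epsilon> :: real and x assume "\<epsilon> \<in> {0<..1}" "x \<in> K"
      from test_fun_add[OF tf[OF this] tf'[of \<epsilon> x]] show "xdiff \<alpha> \<phi>' \<epsilon> x \<in> test_fun"
        unfolding x'[OF \<open>\<epsilon> \<in> {0<..1}\<close> \<open>x \<in> K\<close>] .
    qed
    have "tsupp (xdiff \<alpha> \<phi>' \<epsilon> x) \<subseteq> K0 \<union> tsupp \<psi>" if \<epsilon>x: "\<epsilon> \<in> {0<..1}" "x \<in> K" for \<epsilon> x
    proof (rule tsupp_subsetI)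
      show "closed (K0 \<union> tsupp \<psi>)" by (intro compact_imp_closed compact_Un K0 test_fun_compact \<psi>(1))
      fix \<xi> assume "\<xi> \<notin> K0 \<union> tsupp \<psi>"
      then have "\<xi> \<notin> tsupp (xdiff \<alpha> \<phi> \<epsilon> x)" "\<xi> \<notin> tsupp \<psi>"
        using bspec[OF bspec[OF K0' \<epsilon>x(1)] \<epsilon>x(2)] by auto
      note this[THEN tsupp_0]
      then show "xdiff \<alpha> \<phi>' \<epsilon> x \<xi> = 0" unfolding x'[OF \<epsilon>x] by simp
    qed
    then show "\<exists>K'. compact K' \<and> (\<forall>\<epsilon>\<in>{0<..1}. \<forall>x\<in>K. tsupp (xdiff \<alpha> \<phi>' \<epsilon> x) \<subseteq> K')"
      by (intro exI[of _ "K0 \<union> tsupp \<psi>"] conjI ballI compact_Un K0 test_fun_compact \<psi>(1))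
    fix es :: "'a list" assume es: "set es \<subseteq> Basis"
    obtain C1 where C1: "\<forall>\<epsilon>\<in>{0<..1}. \<forall>x\<in>K. \<forall>\<xi>. norm (Dlist es (xdiff \<alpha> \<phi> \<epsilon> x) \<xi>) \<le> C1"
      using conjunct2[OF conjunct2[OF D'], rule_format, OF es] by (elim exE)
    obtain C2 where C2: "C2 \<ge> 0" "\<And>\<xi>. norm (Dlist es \<psi> \<xi>) \<le> C2"
      using test_fun_Dlist_bounded[OF \<psi>(1) es] by blast
    have "norm (Dlist es (xdiff \<alpha> \<phi>' \<epsilon> x) \<xi>) \<le> C1 + C\<mu> * C2" if \<epsilon>x: "\<epsilon> \<in> {0<..1}" "x \<in> K" for \<epsilon> x \<xi>
    proof -
      have "Dlist es (xdiff \<alpha> \<phi>' \<epsilon> x) \<xi> = Dlist es (xdiff \<alpha> \<phi> \<epsilon> x) \<xi> + Dlist ds (\<mu> \<epsilon>) x * Dlist es \<psi> \<xi>"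
        unfolding x'[OF \<epsilon>x] Dlist_test_add[OF tf[OF \<epsilon>x] tf' es] Dlist_test_cmult[OF \<psi>(1) es] ..
      moreover have "norm (Dlist ds (\<mu> \<epsilon>) x * Dlist es \<psi> \<xi>) \<le> C\<mu> * C2"
        unfolding norm_mult
        by (intro mult_mono C\<mu>[OF \<epsilon>x] C2 order_trans[OF norm_ge_zero C\<mu>[OF \<epsilon>x]] norm_ge_zero)
      moreover have "norm (Dlist es (xdiff \<alpha> \<phi> \<epsilon> x) \<xi>) \<le> C1"
        by (rule C1[rule_format, OF \<epsilon>x])
      ultimately show ?thesis by (simp add: norm_triangle_le)
    qed
    then show "\<exists>C. \<forall>\<epsilon>\<in>{0<..1}. \<forall>x\<in>K. \<forall>\<xi>. norm (Dlist es (xdiff \<alpha> \<phi>' \<epsilon> x) \<xi>) \<le> C"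
      by (intro exI[of _ "C1 + C\<mu> * C2"] ballI allI)
  qed
  then show "D_bounded {xdiff \<alpha> (\<lambda>\<epsilon> x \<xi>. \<phi> \<epsilon> x \<xi> + \<mu> \<epsilon> x * \<psi> \<xi>) \<epsilon> x |\<epsilon> x. \<epsilon> \<in> {0<..1} \<and> x \<in> K}"
    by (simp add: \<phi>'_def)
qed

lemma Cb_perturb_sum:
  assumes \<Omega>: "open \<Omega>" and \<phi>: "\<phi> \<in> Cb \<Omega> 0" and "finite I" and \<mu>: "\<And>i. i \<in> I \<Longrightarrow> scalar_family \<Omega> (\<mu> i)"
    and \<psi>: "\<And>i. i \<in> I \<Longrightarrow> \<psi> i \<in> test_fun" "\<And>i. i \<in> I \<Longrightarrow> moment {#} (\<psi> i) = 0"
  shows "(\<lambda>\<epsilon> x \<xi>. \<phi> \<epsilon> x \<xi> + (\<Sum>i\<in>I. \<mu> i \<epsilon> x * \<psi> i \<xi>)) \<in> Cb \<Omega> 0"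
  using assms(3-6)
proof (induction I rule: finite_induct)
  case empty then show ?case using \<phi> by simp
next
  case (insert i I)
  have "(\<lambda>\<epsilon> x \<xi>. \<phi> \<epsilon> x \<xi> + (\<Sum>i\<in>I. \<mu> i \<epsilon> x * \<psi> i \<xi>)) \<in> Cb \<Omega> 0"
    by (rule insert.IH) (use insert.prems in auto)
  then have "(\<lambda>\<epsilon> x \<xi>. \<phi> \<epsilon> x \<xi> + (\<Sum>i\<in>I. \<mu> i \<epsilon> x * \<psi> i \<xi>) + \<mu> i \<epsilon> x * \<psi> i \<xi>) \<in> Cb \<Omega> 0"
    by (rule Cb_perturb[OF \<Omega>]) (use insert.prems in auto)
  moreover have "\<phi> \<epsilon> x \<xi> + (\<Sum>i\<in>I. \<mu> i \<epsilon> x * \<psi> i \<xi>) + \<mu> i \<epsilon> x * \<psi> i \<xi>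
      = \<phi> \<epsilon> x \<xi> + (\<Sum>i\<in>insert i I. \<mu> i \<epsilon> x * \<psi> i \<xi>)" for \<epsilon> x \<xi>
    using insert.hyps by simp
  ultimately show ?case by simp
qed

text \<open>A sum of plateaus translated to the points \<open>u i\<close>, with heights
  \<open>a i\<close>. The points are at least 2 apart, so at most one summand is nonzero anywhere,
  which preserves the bound \<open>B\<close>.\<close>

lemma smooth_interpolation:
  fixes a :: "nat \<Rightarrow> complex" and u :: "nat \<Rightarrow> real"
  assumes u: "u 0 \<ge> 0" "\<And>i. u (Suc i) \<ge> u i + 2" and a: "\<And>i. norm (a i) \<le> B"
  obtains f where "smooth_curve f" "\<And>i. f (u i) = a i" "\<And>s. norm (f s) \<le> B"
proof -
  obtain \<theta> :: "real \<Rightarrow> real" where \<theta>: "smooth_curve \<theta>" "\<And>t. 0 \<le> \<theta> t" "\<And>t. \<theta> t \<le> 1"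
    "\<And>t. \<bar>t\<bar> \<le> 1/2 \<Longrightarrow> \<theta> t = 1" "\<And>t. \<bar>t\<bar> \<ge> 1 \<Longrightarrow> \<theta> t = 0" by (rule smooth_plateau) blast
  have B: "B \<ge> 0" by (rule order_trans[OF norm_ge_zero a[of 0]])
  have ui: "u i \<ge> 2 * real i" for i
  proof (induction i)
    case (Suc i) then show ?case using u(2)[of i] by simp
  qed (use u in simp)
  have gap: "u j \<ge> u i + 2" if "i < j" for i j
    using that
  proof (induction j)
    case (Suc j) then show ?case using u(2)[of j] by (cases "i = j") auto
  qed simp
  define F where "F M s = (\<Sum>i<M. \<theta> (s - u i) *\<^sub>R a i)" for M s
  \<comment> \<open>A cut-off index: \<open>u i \<ge> 2 * real i\<close>, so all plateaus from
    \<open>N s\<close> on vanish at \<open>s\<close>. The sum is locally finite, and near each point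
    it is one smooth finite sum.\<close>
  define N where "N s = Suc (nat \<lceil>s + 1\<rceil>)" for s :: real
  have far: "\<theta> (s - u i) = 0" if "N s \<le> i" for s i
  proof -
    have "s + 1 \<le> real (N s)" unfolding N_def by linarith
    also have "\<dots> \<le> real i" using that by simp
    also have "\<dots> \<le> u i" using ui[of i] by simp
    finally show ?thesis by (intro \<theta>(5)) simp
  qed
  have FM: "F M s = F (N s) s" if "N s \<le> M" for M s
    unfolding F_def
  proof (rule sum.mono_neutral_right)
    show "\<forall>i\<in>{..<M} - {..<N s}. \<theta> (s - u i) *\<^sub>R a i = 0" by (auto simp: far)
  qed (use that in auto)
  define f where "f s = F (N s) s" for s
  have single: "F M s = \<theta> (s - u i) *\<^sub>R a i" if i: "i < M" "\<bar>s - u i\<bar> < 1" for M s i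
  proof -
    have "\<theta> (s - u j) = 0" if "j \<noteq> i" for j
    proof (rule \<theta>(5))
      have "i < j \<or> j < i" using that by linarith
      then show "1 \<le> \<bar>s - u j\<bar>"
        using gap[of i j] gap[of j i] i(2) by (elim disjE) linarith+
    qed
    then have "F M s = (\<Sum>j\<in>{i}. \<theta> (s - u j) *\<^sub>R a j)"
      unfolding F_def by (intro sum.mono_neutral_right) (use i in auto)
    then show ?thesis by simp
  qed
  show ?thesis
  proof (rule that[of f])
    show "smooth_curve f"
    proof (rule smooth_curve_local)
      fix t0
      have "smooth_curve (F (N (t0 + 1)))"
        unfolding F_def[abs_def]
      proof (intro smooth_curve_sum smooth_curve_scaleR_const)
        fix i show "smooth_curve (\<lambda>s. \<theta> (s - u i))"
          using smooth_curve_affine[OF \<theta>(1), of 1 "- u i"] by simp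
      qed
      moreover have "\<forall>\<^sub>F t in nhds t0. f t = F (N (t0 + 1)) t"
      proof -
        have "\<forall>\<^sub>F t in nhds t0. t < t0 + 1" by (rule order_tendstoD(2)[OF filterlim_ident]) simp
        then show ?thesis
        proof eventually_elim
          case (elim t)
          then have "\<lceil>t + 1\<rceil> \<le> \<lceil>t0 + 1 + 1\<rceil>" by (intro ceiling_mono) simp
          then have "N t \<le> N (t0 + 1)" unfolding N_def by (intro Suc_le_mono[THEN iffD2] nat_mono)
          from FM[OF this] show ?case by (simp only: f_def)
        qed
      qed
      ultimately show "\<exists>g. smooth_curve g \<and> (\<forall>\<^sub>F t in nhds t0. f t = g t)" by blast
    qed
    fix i
    have "f (u i) = F (max (N (u i)) (Suc i)) (u i)" unfolding f_def by (rule FM[symmetric]) simp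
    also have "\<dots> = \<theta> (u i - u i) *\<^sub>R a i" by (rule single) auto
    finally show "f (u i) = a i" using \<theta>(4)[of 0] by simp
  next
    fix s
    show "norm (f s) \<le> B"
    proof (cases "\<exists>i<N s. \<bar>s - u i\<bar> < 1")
      case True
      then obtain i where "i < N s" "\<bar>s - u i\<bar> < 1" by blast
      from single[OF this] have "norm (f s) = \<theta> (s - u i) * norm (a i)" by (simp add: f_def \<theta>(2))
      also have "\<dots> \<le> 1 * B" by (intro mult_mono \<theta>(3) a norm_ge_zero) simp
      finally show ?thesis by simp
    next
      case False
      then have "\<theta> (s - u i) *\<^sub>R a i = 0" if "i < N s" for i
      proof -
        have "1 \<le> \<bar>s - u i\<bar>" using False that by (meson not_less)
        from \<theta>(5)[OF this] show ?thesis by simp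
      qed
      then have "f s = 0" unfolding f_def F_def by (intro sum.neutral) simp
      then show ?thesis using B by simp
    qed
  qed
qed

section \<open>The representatives\<close>

lemma eventually_small: "c > 0 \<Longrightarrow> \<forall>\<^sub>F \<epsilon> in at_right (0::real). 0 < \<epsilon> \<and> \<epsilon> < c"
  using eventually_at_right_real[of 0 c] by (simp add: greaterThanLessThan_iff)

lemma compact_cball_neighbourhood:
  fixes K :: "'a::euclidean_space set"
  assumes "compact K"
  shows "compact (\<Union>k\<in>K. cball k e)"
proof -
  have "(\<Union>k\<in>K. cball k e) = {k + z |k z. k \<in> K \<and> z \<in> cball 0 e}"
  proof (intro subset_antisym subsetI)
    fix x assume "x \<in> (\<Union>k\<in>K. cball k e)"
    then obtain k where "k \<in> K" "dist k x \<le> e" by auto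
    then show "x \<in> {k + z |k z. k \<in> K \<and> z \<in> cball 0 e}"
      by (intro CollectI exI[of _ k] exI[of _ "x - k"]) (auto simp: dist_norm norm_minus_commute)
  next
    fix x assume "x \<in> {k + z |k z. k \<in> K \<and> z \<in> cball 0 e}"
    then obtain k z where "x = k + z" "k \<in> K" "z \<in> cball 0 e" by blast
    then show "x \<in> (\<Union>k\<in>K. cball k e)" by (intro UN_I[of k]) (auto simp: dist_norm)
  qed
  then show ?thesis using compact_sums[OF assms compact_cball[of 0 e]] by simp
qed

lemma Rphi_empty: "Rphi R {#} \<phi> \<epsilon> x = R (Seps \<epsilon> (\<phi> \<epsilon> x)) x"
  by (simp add: Rphi_def mdiff_def)

text \<open>\<open>R\<close> is controlled only where the scaled support fits into \<Omega>. The
  supports of a family are bounded near \<open>L\<close>, so small \<open>\<epsilon>\<close> make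
  them fit for all points of one neighbourhood \<open>W\<close> simultaneously, and there the
  composition is smooth along curves.\<close>

lemma Rphi_ray_smooth:
  fixes \<Omega> :: "'a::euclidean_space set"
  assumes \<Omega>: "open \<Omega>" and R: "R \<in> Ed \<Omega>" and \<phi>: "\<phi> \<in> Cb \<Omega> q" and L: "compact L" "L \<subseteq> \<Omega>"
  shows "\<exists>W. open W \<and> L \<subseteq> W \<and> W \<subseteq> \<Omega> \<and> (\<forall>\<^sub>F \<epsilon> in at_right 0. ray_smooth W (\<lambda>y. R (Seps \<epsilon> (\<phi> \<epsilon> y)) y))"
proof -
  obtain e where e: "e > 0" "(\<Union>k\<in>L. cball k e) \<subseteq> \<Omega>"
    using compact_subset_open_imp_cball_epsilon_subset[OF L(1) \<Omega> L(2)] by blast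
  define W where "W = (\<Union>k\<in>L. ball k (e / 2))"
  define L2 where "L2 = (\<Union>k\<in>L. cball k (e / 2))"
  have W: "open W" "L \<subseteq> W" "W \<subseteq> L2"
    unfolding W_def L2_def using e(1) by (auto intro: less_imp_le)
  have "L2 \<subseteq> (\<Union>k\<in>L. cball k e)" unfolding L2_def using e(1) by (intro UN_mono subset_cball) auto
  then have L2: "compact L2" "L2 \<subseteq> \<Omega>"
    unfolding L2_def using compact_cball_neighbourhood[OF L(1)] e(2) by auto
  obtain K0 where K0: "compact K0" "\<And>\<epsilon> x. \<epsilon> \<in> {0<..1} \<Longrightarrow> x \<in> L2 \<Longrightarrow> tsupp (\<phi> \<epsilon> x) \<subseteq> K0"
    using Cb_Dlist_bounds[OF \<Omega> \<phi> L2, of "[]"] by auto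
  obtain B where B: "B > 0" "\<And>z. z \<in> K0 \<Longrightarrow> norm z \<le> B"
    using compact_imp_bounded[OF K0(1)] unfolding bounded_pos by blast
  \<comment> \<open>Points of \<open>W\<close> are within \<open>e / 2\<close> of \<open>L\<close>,
    and scaled supports have norm at most \<open>\<epsilon> * B \<le> e / 2\<close>; their sums stay
    in the \<open>e\<close>-neighbourhood of \<open>L\<close>.\<close>
  have "min 1 (e / (2 * B)) > 0" using e(1) B(1) by simp
  from eventually_small[OF this]
  have "\<forall>\<^sub>F \<epsilon> in at_right 0. ray_smooth W (\<lambda>y. R (Seps \<epsilon> (\<phi> \<epsilon> y)) y)"
  proof eventually_elim
    case (elim \<epsilon>)
    then have \<epsilon>: "\<epsilon> \<in> {0<..1}" "\<epsilon> > 0" and \<epsilon>B: "\<epsilon> * B \<le> e / 2" using B(1) by (auto simp: field_simps)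
    have in_U: "(Seps \<epsilon> (\<phi> \<epsilon> y), y) \<in> U \<Omega>" if y: "y \<in> W" for y
    proof -
      have yL2: "y \<in> L2" using y W(3) by blast
      then have yO: "y \<in> \<Omega>" using L2 by blast
      have "\<phi> \<epsilon> y \<in> A 0" using Cb_A[OF \<phi> \<epsilon>(1) yO] A_mono by blast
      then have "Seps \<epsilon> (\<phi> \<epsilon> y) \<in> A 0" by (rule Seps_A0[OF \<epsilon>(2)])
      moreover have "tsupp (Seps \<epsilon> (\<phi> \<epsilon> y)) \<subseteq> (*\<^sub>R) \<epsilon> ` K0"
        by (rule tsupp_Seps[OF \<epsilon>(2) K0(1) K0(2)[OF \<epsilon>(1) yL2]])
      moreover have "(*\<^sub>R) \<epsilon> ` K0 \<subseteq> {z - y |z. z \<in> \<Omega>}"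
      proof
        fix w assume "w \<in> (*\<^sub>R) \<epsilon> ` K0"
        then obtain z where z: "z \<in> K0" "w = \<epsilon> *\<^sub>R z" by blast
        have "norm w \<le> \<epsilon> * B" using z B(2)[OF z(1)] \<epsilon>(2) by (simp add: mult_left_mono)
        then have w: "norm w \<le> e / 2" using \<epsilon>B by simp
        obtain k where k: "k \<in> L" "dist k y \<le> e / 2" using yL2 unfolding L2_def by auto
        have "dist k (y + w) \<le> dist k y + norm w" using dist_triangle[of k "y + w" y] by (simp add: dist_norm)
        then have "y + w \<in> cball k e" using k(2) w by simp
        then have "y + w \<in> \<Omega>" using e(2) k(1) by blast
        then show "w \<in> {z - y |z. z \<in> \<Omega>}" by (intro CollectI exI[of _ "y + w"]) simp
      qed
      ultimately show ?thesis unfolding U_def using yO by blast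
    qed
    show ?case
    proof (rule curve_smooth_imp_ray_smooth[OF W(1)])
      show "curve_smooth W (\<lambda>y. R (Seps \<epsilon> (\<phi> \<epsilon> y)) y)"
        unfolding curve_smooth_def
      proof (intro allI impI)
        fix c assume c: "smooth_curve c \<and> (\<forall>t. c t \<in> W)"
        have "smooth_D_curve (\<lambda>t. \<phi> \<epsilon> (c t))"
        proof (rule Cb_smooth_D_curve[OF \<phi> smooth_curve_const[of \<epsilon>]])
          show "smooth_curve c" using c by blast
          show "c t \<in> \<Omega>" for t using c W(3) L2(2) by blast
        qed (rule \<epsilon>(1))
        then have "smooth_D_curve (\<lambda>t. Seps \<epsilon> (\<phi> \<epsilon> (c t)))" by (rule smooth_D_curve_Seps[OF \<epsilon>(2)])
        moreover have "\<forall>t. (Seps \<epsilon> (\<phi> \<epsilon> (c t)), c t) \<in> U \<Omega>" using in_U c by blast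
        ultimately show "smooth_curve (\<lambda>t. R (Seps \<epsilon> (\<phi> \<epsilon> (c t))) (c t))"
          using R c unfolding Ed_def by blast
      qed
    qed
  qed
  then show ?thesis using W L2(2) by blast
qed

lemma Rphi_eq_Dlist:
  assumes "open W" "ray_smooth W (\<lambda>y. R (Seps \<epsilon> (\<phi> \<epsilon> y)) y)" "x \<in> W"
  shows "Rphi R (mset ds) \<phi> \<epsilon> x = Dlist ds (\<lambda>y. R (Seps \<epsilon> (\<phi> \<epsilon> y)) y) x"
  unfolding Rphi_def by (rule mdiff_eq_Dlist[OF assms])

subsection \<open>Small neighbourhoods of a compact set\<close>

text \<open>A substitute for metric neighbourhoods, adapted to moves along basis directions: a mean
  value or difference quotient estimate at level \<open>j\<close> uses points of level
  \<open>Suc j\<close>. With \<open>\<eta> = \<epsilon> ^ \<rho>\<close> every fixed level shrinks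
  to \<open>K\<close>.\<close>

fun reach :: "'a::euclidean_space set \<Rightarrow> real \<Rightarrow> nat \<Rightarrow> 'a set" where
  "reach K \<eta> 0 = K"
| "reach K \<eta> (Suc j) = {x + t *\<^sub>R b |x t b. x \<in> reach K \<eta> j \<and> b \<in> Basis \<and> \<bar>t\<bar> \<le> \<eta>}"

lemma reach_SucI: "x \<in> reach K \<eta> j \<Longrightarrow> b \<in> Basis \<Longrightarrow> \<bar>t\<bar> \<le> \<eta> \<Longrightarrow> x + t *\<^sub>R b \<in> reach K \<eta> (Suc j)"
  unfolding reach.simps by blast

lemma reach_near:
  assumes "x \<in> reach K \<eta> j" "0 \<le> \<eta>" shows "\<exists>k\<in>K. norm (x - k) \<le> real j * \<eta>"
  using assms(1)
proof (induction j arbitrary: x)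
  case 0 then show ?case by auto
next
  case (Suc j)
  then obtain y t b where x: "x = y + t *\<^sub>R b" "y \<in> reach K \<eta> j" "b \<in> Basis" "\<bar>t\<bar> \<le> \<eta>" by auto
  obtain k where k: "k \<in> K" "norm (y - k) \<le> real j * \<eta>" using Suc.IH[OF x(2)] by blast
  have "norm (x - k) \<le> norm (y - k) + norm (t *\<^sub>R b)"
    using norm_triangle_ineq[of "y - k" "t *\<^sub>R b"] by (simp add: x(1) algebra_simps)
  also have "\<dots> \<le> real j * \<eta> + \<eta>" using k(2) x(3,4) by (intro add_mono) simp_all
  finally show ?case using k(1) by (intro bexI[of _ k]) (simp_all add: algebra_simps)
qed

lemma reach_small:
  fixes K :: "'a::euclidean_space set"
  assumes "e > 0" "\<rho> \<ge> 1"
  shows "\<forall>\<^sub>F \<epsilon> in at_right 0. 0 < \<epsilon> \<and> \<epsilon> < 1 \<and> \<epsilon> ^ \<rho> \<le> \<epsilon> \<and> reach K (\<epsilon> ^ \<rho>) j \<subseteq> (\<Union>k\<in>K. cball k e)"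
proof -
  have "min 1 (e / (real j + 1)) > 0" using assms(1) by simp
  from eventually_small[OF this] show ?thesis
  proof eventually_elim
    case (elim \<epsilon>)
    have \<epsilon>: "\<epsilon> ^ \<rho> \<le> \<epsilon>" using elim assms(2) power_decreasing[of 1 \<rho> \<epsilon>] by simp
    have "real j * \<epsilon> ^ \<rho> \<le> (real j + 1) * \<epsilon>" using \<epsilon> elim by (intro mult_mono) auto
    also have "\<dots> \<le> e" using elim by (simp add: pos_less_divide_eq mult.commute less_imp_le)
    finally have j: "real j * \<epsilon> ^ \<rho> \<le> e" .
    have "reach K (\<epsilon> ^ \<rho>) j \<subseteq> (\<Union>k\<in>K. cball k e)"
    proof
      fix x assume "x \<in> reach K (\<epsilon> ^ \<rho>) j"
      then obtain k where "k \<in> K" "norm (x - k) \<le> real j * \<epsilon> ^ \<rho>" using reach_near elim by force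
      then show "x \<in> (\<Union>k\<in>K. cball k e)" using j by (intro UN_I[of k]) (auto simp: dist_norm norm_minus_commute)
    qed
    then show ?case using \<epsilon> elim by simp
  qed
qed

text \<open>Two nested inductions. The outer one is over the exponent \<open>p\<close> and starts
  from the uniform bounds on compact sets; the inner one is over the number of steps and starts on
  \<open>K\<close>. A coordinate step of length at most \<open>\<epsilon>\<close> changes the
  function by at most \<open>\<epsilon>\<close> times a derivative of the next order, which the
  outer hypothesis bounds by \<open>\<epsilon> ^ p\<close> up to a constant: one power is gained.
  Derivatives of all orders therefore have to be small on \<open>K\<close>.\<close>

lemma small_on_reach:
  fixes \<Omega> :: "'a::euclidean_space set"
  assumes \<Omega>: "open \<Omega>" and K: "compact K" "K \<subseteq> \<Omega>" and \<rho>: "\<rho> \<ge> 1" and m: "scalar_family \<Omega> m"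
    and small: "\<And>ds. set ds \<subseteq> Basis \<Longrightarrow> \<exists>C. \<forall>\<^sub>F \<epsilon> in at_right 0. \<forall>x\<in>K. norm (Dlist ds (m \<epsilon>) x) \<le> C * \<epsilon> ^ q"
  shows "p \<le> q \<Longrightarrow> set ds \<subseteq> Basis \<Longrightarrow>
    \<exists>C. \<forall>\<^sub>F \<epsilon> in at_right 0. \<forall>x\<in>reach K (\<epsilon> ^ \<rho>) j. norm (Dlist ds (m \<epsilon>) x) \<le> C * \<epsilon> ^ p"
proof -
  obtain e where e: "e > 0" "(\<Union>k\<in>K. cball k e) \<subseteq> \<Omega>"
    using compact_subset_open_imp_cball_epsilon_subset[OF K(1) \<Omega> K(2)] by blast
  show "p \<le> q \<Longrightarrow> set ds \<subseteq> Basis \<Longrightarrow>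
    \<exists>C. \<forall>\<^sub>F \<epsilon> in at_right 0. \<forall>x\<in>reach K (\<epsilon> ^ \<rho>) j. norm (Dlist ds (m \<epsilon>) x) \<le> C * \<epsilon> ^ p"
  proof (induction p arbitrary: ds j)
    case 0
    obtain C where C: "\<And>\<epsilon> x. \<epsilon> \<in> {0<..1} \<Longrightarrow> x \<in> (\<Union>k\<in>K. cball k e) \<Longrightarrow> norm (Dlist ds (m \<epsilon>) x) \<le> C"
      using scalar_family_bound[OF m compact_cball_neighbourhood[OF K(1)] e(2) 0(2)] by blast
    have "\<forall>\<^sub>F \<epsilon> in at_right 0. \<forall>x\<in>reach K (\<epsilon> ^ \<rho>) j. norm (Dlist ds (m \<epsilon>) x) \<le> C * \<epsilon> ^ 0"
      using reach_small[OF e(1) \<rho>, of K j]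
    proof eventually_elim
      case (elim \<epsilon>)
      then have "\<epsilon> \<in> {0<..1}" by simp
      from C[OF this] elim show ?case by (simp add: subset_eq)
    qed
    then show ?case by blast
  next
    case (Suc p)
    have pq: "p \<le> q" "Suc p \<le> q" using Suc.prems(1) by simp_all
    note IHp = Suc.IH[OF pq(1)]
    show ?case
      using Suc.prems(2)
    proof (induction j arbitrary: ds)
      case 0
      obtain C where "\<forall>\<^sub>F \<epsilon> in at_right 0. \<forall>x\<in>K. norm (Dlist ds (m \<epsilon>) x) \<le> C * \<epsilon> ^ q" using small[OF 0] by blast
      then have "\<forall>\<^sub>F \<epsilon> in at_right 0. \<forall>x\<in>reach K (\<epsilon> ^ \<rho>) 0. norm (Dlist ds (m \<epsilon>) x) \<le> \<bar>C\<bar> * \<epsilon> ^ Suc p"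
        using eventually_small[OF zero_less_one]
      proof eventually_elim
        case (elim \<epsilon>)
        have "C * \<epsilon> ^ q \<le> \<bar>C\<bar> * \<epsilon> ^ Suc p"
          using elim(2) pq(2) by (intro mult_mono power_decreasing) auto
        show ?case
        proof
          fix x assume "x \<in> reach K (\<epsilon> ^ \<rho>) 0"
          then have "norm (Dlist ds (m \<epsilon>) x) \<le> C * \<epsilon> ^ q" using elim(1) by simp
          also have "\<dots> \<le> \<bar>C\<bar> * \<epsilon> ^ Suc p" by fact
          finally show "norm (Dlist ds (m \<epsilon>) x) \<le> \<bar>C\<bar> * \<epsilon> ^ Suc p" .
        qed
      qed
      then show ?case by blast
    next
      case (Suc j)
      obtain C where C: "\<forall>\<^sub>F \<epsilon> in at_right 0. \<forall>x\<in>reach K (\<epsilon> ^ \<rho>) j. norm (Dlist ds (m \<epsilon>) x) \<le> C * \<epsilon> ^ Suc p"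
        using Suc.IH[OF Suc.prems] by blast
      have "\<exists>D. \<forall>\<^sub>F \<epsilon> in at_right 0. \<forall>x\<in>reach K (\<epsilon> ^ \<rho>) (Suc j). norm (Dlist (b # ds) (m \<epsilon>) x) \<le> D * \<epsilon> ^ p"
        if "b \<in> Basis" for b
        by (rule IHp) (use that Suc.prems in simp)
      then obtain D where D: "\<And>b. b \<in> Basis \<Longrightarrow>
          \<forall>\<^sub>F \<epsilon> in at_right 0. \<forall>x\<in>reach K (\<epsilon> ^ \<rho>) (Suc j). norm (Dlist (b # ds) (m \<epsilon>) x) \<le> D b * \<epsilon> ^ p"
        by (metis (no_types))
      \<comment> \<open>One nonnegative constant for all basis directions.\<close>
      define D' where "D' = (\<Sum>b\<in>(Basis::'a set). \<bar>D b\<bar>)"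
      have D': "D b \<le> D'" if "b \<in> Basis" for b
        unfolding D'_def using member_le_sum[of b Basis "\<lambda>b. \<bar>D b\<bar>"] that by fastforce
      have D'0: "D' \<ge> 0" unfolding D'_def by (intro sum_nonneg) simp
      have "\<forall>\<^sub>F \<epsilon> in at_right 0. \<forall>b\<in>Basis. \<forall>x\<in>reach K (\<epsilon> ^ \<rho>) (Suc j). norm (Dlist (b # ds) (m \<epsilon>) x) \<le> D b * \<epsilon> ^ p"
        by (rule eventually_ball_finite) (use D in auto)
      then have "\<forall>\<^sub>F \<epsilon> in at_right 0. \<forall>x\<in>reach K (\<epsilon> ^ \<rho>) (Suc j). norm (Dlist ds (m \<epsilon>) x) \<le> (C + D') * \<epsilon> ^ Suc p"
        using C reach_small[OF e(1) \<rho>, of K "Suc j"]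
      proof eventually_elim
        case (elim \<epsilon>)
        show ?case
        proof
          fix y assume "y \<in> reach K (\<epsilon> ^ \<rho>) (Suc j)"
          then obtain x t b where y: "y = x + t *\<^sub>R b" and x: "x \<in> reach K (\<epsilon> ^ \<rho>) j" and b: "b \<in> Basis"
            and t: "\<bar>t\<bar> \<le> \<epsilon> ^ \<rho>" by auto
          have \<epsilon>: "\<epsilon> \<in> {0<..1}" "0 < \<epsilon>" using elim by auto
          have rs: "ray_smooth \<Omega> (Dlist ds (m \<epsilon>))"
            by (rule ray_smooth_Dlist[OF \<Omega> scalar_family_ray_smooth[OF \<Omega> m \<epsilon>(1)]])
          have "norm (Dlist ds (m \<epsilon>) (x + t *\<^sub>R b) - Dlist ds (m \<epsilon>) x) \<le> (D' * \<epsilon> ^ p) * \<bar>t\<bar>"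
          proof (rule along_bound_abs[OF ray_smooth_diff_along_0[OF rs]])
            fix s assume "\<bar>s\<bar> \<le> \<bar>t\<bar>"
            then have s: "x + s *\<^sub>R b \<in> reach K (\<epsilon> ^ \<rho>) (Suc j)" using t by (intro reach_SucI x b) simp
            then show "x + s *\<^sub>R b \<in> \<Omega>" using elim e(2) by blast
            have "norm (Dlist (b # ds) (m \<epsilon>) (x + s *\<^sub>R b)) \<le> D b * \<epsilon> ^ p" using elim(1) b s by blast
            also have "\<dots> \<le> D' * \<epsilon> ^ p" using D'[OF b] \<epsilon>(2) by (intro mult_right_mono) auto
            finally show "norm (pdiff b (Dlist ds (m \<epsilon>)) (x + s *\<^sub>R b)) \<le> D' * \<epsilon> ^ p" by simp
          qed
          also have "\<dots> \<le> (D' * \<epsilon> ^ p) * \<epsilon>" using t elim D'0 by (intro mult_left_mono) auto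
          finally have 1: "norm (Dlist ds (m \<epsilon>) y - Dlist ds (m \<epsilon>) x) \<le> D' * \<epsilon> ^ Suc p" by (simp add: y mult_ac)
          have 2: "norm (Dlist ds (m \<epsilon>) x) \<le> C * \<epsilon> ^ Suc p" using elim(2) x by blast
          have "Dlist ds (m \<epsilon>) y = Dlist ds (m \<epsilon>) x + (Dlist ds (m \<epsilon>) y - Dlist ds (m \<epsilon>) x)" by simp
          then have "norm (Dlist ds (m \<epsilon>) y) \<le> C * \<epsilon> ^ Suc p + D' * \<epsilon> ^ Suc p"
            using norm_triangle_le[OF add_mono[OF 2 1]] by metis
          then show "norm (Dlist ds (m \<epsilon>) y) \<le> (C + D') * \<epsilon> ^ Suc p" by (simp add: distrib_right)
        qed
      qed
      then show ?case by blast
    qed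
  qed
qed

section \<open>Negligibility\<close>

lemma moment_eq: "integral UNIV (\<lambda>\<xi>. monom \<beta> \<xi> * f \<xi>) = moment \<beta> f"
  by (simp only: moment_def)

lemma typeA_moment_small:
  fixes \<Omega> :: "'a::euclidean_space set"
  assumes \<Omega>: "open \<Omega>" and K: "K \<subseteq> \<Omega>" and \<phi>: "typeA \<Omega> K q \<phi>"
    and \<beta>: "multi_index \<beta>" "1 \<le> size \<beta>" "size \<beta> \<le> q" and ds: "set ds \<subseteq> Basis"
  shows "\<exists>C. \<forall>\<^sub>F \<epsilon> in at_right 0. \<forall>x\<in>K. norm (Dlist ds (\<lambda>x. moment \<beta> (\<phi> \<epsilon> x)) x) \<le> C * \<epsilon> ^ q"
proof -
  have \<phi>0: "\<phi> \<in> Cb \<Omega> 0" using \<phi> by (simp add: typeA_def)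
  obtain C where C: "\<forall>\<^sub>F \<epsilon> in at_right 0. \<forall>x\<in>K. norm (integral UNIV (\<lambda>\<xi>. monom \<beta> \<xi> * xdiff (mset ds) \<phi> \<epsilon> x \<xi>)) \<le> C * \<epsilon> ^ q"
    using \<phi> \<beta> ds unfolding typeA_def multi_index_mset[symmetric] by blast
  have "\<forall>\<^sub>F \<epsilon> in at_right 0. \<forall>x\<in>K. norm (Dlist ds (\<lambda>x. moment \<beta> (\<phi> \<epsilon> x)) x) \<le> C * \<epsilon> ^ q"
    using C eventually_small[OF zero_less_one]
  proof eventually_elim
    case (elim \<epsilon>)
    show ?case
    proof
      fix x assume x: "x \<in> K"
      then have xO: "x \<in> \<Omega>" and \<epsilon>: "\<epsilon> \<in> {0<..1}" using K elim(2) by auto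
      have "Dlist ds (\<lambda>x. moment \<beta> (\<phi> \<epsilon> x)) x = integral UNIV (\<lambda>\<xi>. monom \<beta> \<xi> * xdiff (mset ds) \<phi> \<epsilon> x \<xi>)"
        using Dlist_moment[OF \<Omega> \<phi>0 \<epsilon> xO ds, of \<beta>]
        by (simp add: Cb_xdiff[OF \<Omega> \<phi>0 \<epsilon> xO] moment_eq)
      then show "norm (Dlist ds (\<lambda>x. moment \<beta> (\<phi> \<epsilon> x)) x) \<le> C * \<epsilon> ^ q" using elim(1) x by simp
    qed
  qed
  then show ?thesis by blast
qed

text \<open>Moments that vanish at all points of an open set have vanishing derivatives there, so
  the constant 0 serves for every \<open>\<gamma>\<close>.\<close>

lemma Cb_imp_typeA:
  fixes \<Omega> :: "'a::euclidean_space set"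
  assumes \<Omega>: "open \<Omega>" and K: "K \<subseteq> \<Omega>" and \<phi>: "\<phi> \<in> Cb \<Omega> q"
  shows "typeA \<Omega> K q \<phi>"
  unfolding typeA_def
proof (intro conjI allI impI)
  show "\<phi> \<in> Cb \<Omega> 0" using Cb_mono \<phi> by blast
  fix \<beta> \<gamma> :: "'a multiset"
  assume \<beta>\<gamma>: "multi_index \<beta> \<and> 1 \<le> size \<beta> \<and> size \<beta> \<le> q \<and> multi_index \<gamma>"
  obtain ds where ds: "mset ds = \<gamma>" using ex_mset by blast
  then have dsB: "set ds \<subseteq> Basis" using \<beta>\<gamma> by (auto simp: multi_index_mset)
  have "\<forall>\<^sub>F \<epsilon> in at_right 0. \<forall>x\<in>K. norm (integral UNIV (\<lambda>\<xi>. monom \<beta> \<xi> * xdiff \<gamma> \<phi> \<epsilon> x \<xi>)) \<le> 0 * \<epsilon> ^ q"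
    using eventually_small[OF zero_less_one]
  proof eventually_elim
    case (elim \<epsilon>)
    show ?case
    proof
      fix x assume x: "x \<in> K"
      then have xO: "x \<in> \<Omega>" and \<epsilon>: "\<epsilon> \<in> {0<..1}" using K elim by auto
      have z: "moment \<beta> (\<phi> \<epsilon> y) = 0" if "y \<in> \<Omega>" for y
        using Cb_A[OF \<phi> \<epsilon> that] \<beta>\<gamma> unfolding A_iff_moments by blast
      have "integral UNIV (\<lambda>\<xi>. monom \<beta> \<xi> * xdiff \<gamma> \<phi> \<epsilon> x \<xi>) = Dlist ds (\<lambda>x. moment \<beta> (\<phi> \<epsilon> x)) x"
        using Dlist_moment[OF \<Omega> \<phi> \<epsilon> xO dsB, of \<beta>]
        by (simp add: ds[symmetric] Cb_xdiff[OF \<Omega> \<phi> \<epsilon> xO] moment_eq)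
      also have "\<dots> = Dlist ds (\<lambda>x. 0) x" by (rule Dlist_cong_open[OF \<Omega> z xO])
      finally show "norm (integral UNIV (\<lambda>\<xi>. monom \<beta> \<xi> * xdiff \<gamma> \<phi> \<epsilon> x \<xi>)) \<le> 0 * \<epsilon> ^ q"
        by (simp add: Dlist_zero)
    qed
  qed
  then show "\<exists>C. \<forall>\<^sub>F \<epsilon> in at_right 0. \<forall>x\<in>K. norm (integral UNIV (\<lambda>\<xi>. monom \<beta> \<xi> * xdiff \<gamma> \<phi> \<epsilon> x \<xi>)) \<le> C * \<epsilon> ^ q"
    by blast
qed

lemma moderateD:
  assumes "R \<in> moderate \<Omega>" "compact K" "K \<subseteq> \<Omega>" "multi_index \<alpha>"
  shows "\<exists>N. \<forall>\<phi>\<in>Cb \<Omega> 0. \<exists>C. \<forall>\<^sub>F \<epsilon> in at_right 0. \<forall>x\<in>K. norm (Rphi R \<alpha> \<phi> \<epsilon> x) \<le> C * inverse \<epsilon> ^ N"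
  using assms(1)[unfolded moderate_def, THEN CollectD, THEN conjunct2, rule_format, of K \<alpha>] assms(2-4) by (simp only: simp_thms)

lemma negligibleD:
  assumes "R \<in> negligible \<Omega>" "compact K" "K \<subseteq> \<Omega>" "multi_index \<alpha>" "n \<ge> 1"
  shows "\<exists>q\<ge>1. \<forall>\<phi>\<in>Cb \<Omega> q. \<exists>C. \<forall>\<^sub>F \<epsilon> in at_right 0. \<forall>x\<in>K. norm (Rphi R \<alpha> \<phi> \<epsilon> x) \<le> C * \<epsilon> ^ n"
  using assms(1)[unfolded negligible_def, THEN CollectD, THEN conjunct2, rule_format, of K \<alpha> n] assms(2-5) by (simp only: simp_thms)

text \<open>Failures occur at arbitrarily small scales, so scales can be chosen recursively with
  reciprocals at least 2 apart, the spacing that \<open>smooth_interpolation\<close> needs. The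
  index in \<open>P\<close> lets the violated constant grow along the sequence.\<close>

lemma frequently_bad_sequence:
  fixes P :: "nat \<Rightarrow> real \<Rightarrow> 'a \<Rightarrow> bool"
  assumes bad: "\<And>i \<eta>. \<eta> > 0 \<Longrightarrow> \<exists>\<epsilon> x. 0 < \<epsilon> \<and> \<epsilon> < \<eta> \<and> P i \<epsilon> x"
  shows "\<exists>e X. \<forall>i. 0 < e i \<and> inverse (e (Suc i)) \<ge> inverse (e i) + 2 \<and> P i (e i) (X i)"
proof -
  have "\<exists>f :: nat \<Rightarrow> real \<times> 'a. \<forall>i. (0 < fst (f i) \<and> P i (fst (f i)) (snd (f i))) \<and>
      inverse (fst (f (Suc i))) \<ge> inverse (fst (f i)) + 2"
  proof (rule dependent_nat_choice)
    obtain \<epsilon> x where "0 < \<epsilon>" "P 0 \<epsilon> x" using bad[OF zero_less_one, of 0] by blast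
    then show "\<exists>p :: real \<times> 'a. 0 < fst p \<and> P 0 (fst p) (snd p)" by (intro exI[of _ "(\<epsilon>, x)"]) simp
  next
    fix p :: "real \<times> 'a" and i assume p: "0 < fst p \<and> P i (fst p) (snd p)"
    then have pos: "inverse (fst p) + 2 > 0" by (simp add: add_pos_pos)
    then obtain \<epsilon> x where \<epsilon>: "0 < \<epsilon>" "\<epsilon> < inverse (inverse (fst p) + 2)" "P (Suc i) \<epsilon> x"
      using bad[of "inverse (inverse (fst p) + 2)" "Suc i"] by auto
    have "inverse (inverse (inverse (fst p) + 2)) \<le> inverse \<epsilon>"
      using \<epsilon>(1,2) by (intro le_imp_inverse_le) auto
    then show "\<exists>q. (0 < fst q \<and> P (Suc i) (fst q) (snd q)) \<and> inverse (fst p) + 2 \<le> inverse (fst q)"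
      using \<epsilon> pos by (intro exI[of _ "(\<epsilon>, x)"]) simp
  qed
  then obtain f where "\<And>i. (0 < fst (f i) \<and> P i (fst (f i)) (snd (f i))) \<and>
      inverse (fst (f (Suc i))) \<ge> inverse (fst (f i)) + 2" by blast
  then show ?thesis by (intro exI[of _ "\<lambda>i. fst (f i)"] exI[of _ "\<lambda>i. snd (f i)"]) blast
qed

text \<open>By duality the added sum cancels each moment of order 1 to \<open>q\<close>; the
  integral is untouched because \<open>{#}\<close> is not in \<open>B\<close>.\<close>

lemma moment_correction:
  fixes \<psi> :: "'a::euclidean_space multiset \<Rightarrow> 'a \<Rightarrow> complex"
  assumes \<psi>: "\<And>\<beta>. multi_index \<beta> \<Longrightarrow> size \<beta> \<le> q \<Longrightarrow> \<psi> \<beta> \<in> test_fun"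
    "\<And>\<beta> \<gamma>. multi_index \<beta> \<Longrightarrow> size \<beta> \<le> q \<Longrightarrow> multi_index \<gamma> \<Longrightarrow> size \<gamma> \<le> q \<Longrightarrow>
      moment \<beta> (\<psi> \<gamma>) = (if \<beta> = \<gamma> then 1 else 0)"
    and f: "f \<in> A 0" and B: "B = {\<beta>. multi_index \<beta> \<and> 1 \<le> size \<beta> \<and> size \<beta> \<le> q}"
  shows "(\<lambda>\<xi>. f \<xi> + (\<Sum>\<beta>\<in>B. (-1 * moment \<beta> f) * \<psi> \<beta> \<xi>)) \<in> A q"
proof -
  have fB: "finite B" unfolding B by (rule finite_subset[OF _ finite_multi_indices[of q]]) auto
  have f0: "f \<in> test_fun" "moment {#} f = 1" using f by (simp_all only: A_0_iff_moment)
  have t: "(\<lambda>\<xi>. (-1 * moment \<beta> f) * \<psi> \<beta> \<xi>) \<in> test_fun" if "\<beta> \<in> B" for \<beta>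
    using that by (intro test_fun_cmult \<psi>(1)) (auto simp: B)
  have m: "moment \<gamma> (\<lambda>\<xi>. f \<xi> + (\<Sum>\<beta>\<in>B. (-1 * moment \<beta> f) * \<psi> \<beta> \<xi>)) = moment \<gamma> f + (\<Sum>\<beta>\<in>B. (-1 * moment \<beta> f) * moment \<gamma> (\<psi> \<beta>))" for \<gamma>
  proof -
    have "moment \<gamma> (\<lambda>\<xi>. f \<xi> + (\<Sum>\<beta>\<in>B. (-1 * moment \<beta> f) * \<psi> \<beta> \<xi>)) = moment \<gamma> f + moment \<gamma> (\<lambda>\<xi>. \<Sum>\<beta>\<in>B. (-1 * moment \<beta> f) * \<psi> \<beta> \<xi>)"
      by (rule moment_add[OF f0(1) test_fun_sum]) (rule t)
    also have "moment \<gamma> (\<lambda>\<xi>. \<Sum>\<beta>\<in>B. (-1 * moment \<beta> f) * \<psi> \<beta> \<xi>) = (\<Sum>\<beta>\<in>B. moment \<gamma> (\<lambda>\<xi>. (-1 * moment \<beta> f) * \<psi> \<beta> \<xi>))"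
      by (rule moment_sum) (rule t)
    finally show ?thesis by (simp only: moment_cmult)
  qed
  have d: "(\<Sum>\<beta>\<in>B. (-1 * moment \<beta> f) * moment \<gamma> (\<psi> \<beta>)) = (if \<gamma> \<in> B then - moment \<gamma> f else 0)"
    if "multi_index \<gamma>" "size \<gamma> \<le> q" for \<gamma>
  proof -
    have "(\<Sum>\<beta>\<in>B. (-1 * moment \<beta> f) * moment \<gamma> (\<psi> \<beta>)) = (\<Sum>\<beta>\<in>B. if \<gamma> = \<beta> then - moment \<gamma> f else 0)"
      using \<psi>(2)[OF that] by (intro sum.cong) (auto simp: B)
    then show ?thesis using fB by simp
  qed
  show ?thesis
    unfolding A_iff_moments
  proof (intro conjI allI impI)
    show "(\<lambda>\<xi>. f \<xi> + (\<Sum>\<beta>\<in>B. (-1 * moment \<beta> f) * \<psi> \<beta> \<xi>)) \<in> test_fun"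
      by (intro test_fun_add f0 test_fun_sum t)
    show "moment {#} (\<lambda>\<xi>. f \<xi> + (\<Sum>\<beta>\<in>B. (-1 * moment \<beta> f) * \<psi> \<beta> \<xi>)) = 1"
      unfolding m using d[of "{#}"] f0(2) by (simp add: B multi_index_def)
    fix \<gamma> :: "'a multiset" assume "multi_index \<gamma> \<and> 1 \<le> size \<gamma> \<and> size \<gamma> \<le> q"
    then show "moment \<gamma> (\<lambda>\<xi>. f \<xi> + (\<Sum>\<beta>\<in>B. (-1 * moment \<beta> f) * \<psi> \<beta> \<xi>)) = 0"
      unfolding m using d[of \<gamma>] by (simp add: B)
  qed
qed

text \<open>If the estimate fails along \<open>\<epsilon>\<^sub>i \<rightarrow> 0\<close> at points \<open>x\<^sub>i\<close>, perturb \<open>\<phi>\<close> so that the moments at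
  \<open>\<epsilon>\<^sub>i\<close> become affine functions on the line through \<open>x\<^sub>i\<close> in direction \<open>b\<close>, agreeing with those of \<open>\<phi>\<close>
  at \<open>x\<^sub>i\<close> and vanishing at \<open>x\<^sub>i + \<delta> b\<close>, \<open>\<delta> = \<epsilon>\<^sub>i ^ (n + N)\<close>. The slopes are bounded since the moments are
  \<open>O(\<delta>)\<close>. Negligibility controls the value at \<open>x\<^sub>i + \<delta> b\<close> and moderateness the increment.\<close>

lemma negligible_on_reach:
  fixes \<Omega> :: "'a::euclidean_space set"
  assumes \<Omega>: "open \<Omega>" and R: "R \<in> negligible \<Omega>" and K: "compact K" "K \<subseteq> \<Omega>"
    and n: "n \<ge> 1" and \<rho>: "\<rho> \<ge> 1"
  shows "\<exists>q\<ge>1. \<forall>\<phi>. typeA \<Omega> K q \<phi> \<longrightarrow>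
    (\<exists>C. \<forall>\<^sub>F \<epsilon> in at_right 0. \<forall>x\<in>reach K (\<epsilon> ^ \<rho>) j. norm (R (Seps \<epsilon> (\<phi> \<epsilon> x)) x) \<le> C * \<epsilon> ^ n)"
proof -
  have Rm: "R \<in> moderate \<Omega>" and RE: "R \<in> Ed \<Omega>" using R by (auto simp: negligible_def moderate_def)
  obtain e where e: "e > 0" "(\<Union>k\<in>K. cball k e) \<subseteq> \<Omega>"
    using compact_subset_open_imp_cball_epsilon_subset[OF K(1) \<Omega> K(2)] by blast
  define L where "L = (\<Union>k\<in>K. cball k e)"
  have L: "compact L" "L \<subseteq> \<Omega>" unfolding L_def using compact_cball_neighbourhood[OF K(1)] e(2) by auto
  \<comment> \<open>The segments may point in any direction; one basis direction serves for all of
    them.\<close>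
  define b where "b = (SOME b::'a. b \<in> Basis)"
  have b: "b \<in> Basis" unfolding b_def by (rule SOME_Basis)
  have nb: "norm b = 1" using b by simp
  have mb: "multi_index (mset [b])" using b by (simp add: multi_index_def)
  obtain N where N: "\<And>\<phi>. \<phi> \<in> Cb \<Omega> 0 \<Longrightarrow> \<exists>C. \<forall>\<^sub>F \<epsilon> in at_right 0. \<forall>x\<in>L. norm (Rphi R (mset [b]) \<phi> \<epsilon> x) \<le> C * inverse \<epsilon> ^ N"
    using moderateD[OF Rm L mb] by (elim exE) (blast dest: bspec)
  have m0: "multi_index ({#} :: 'a multiset)" by (simp add: multi_index_def)
  obtain q1 where q1: "q1 \<ge> 1" "\<And>\<phi>. \<phi> \<in> Cb \<Omega> q1 \<Longrightarrow> \<exists>C. \<forall>\<^sub>F \<epsilon> in at_right 0. \<forall>x\<in>L. norm (Rphi R {#} \<phi> \<epsilon> x) \<le> C * \<epsilon> ^ n"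
    using negligibleD[OF R L m0 n] by (elim exE conjE) (blast dest: bspec)
  \<comment> \<open>Over a segment of length \<open>\<epsilon> ^ s\<close> moderateness permits an
    increment of at most \<open>C * inverse \<epsilon> ^ N * \<epsilon> ^ s = C * \<epsilon> ^
    n\<close>. Below, \<open>q \<ge> s\<close> makes the moments \<open>O(\<epsilon> ^ s)\<close>,
    and \<open>q \<ge> q1\<close> covers all the moments to be corrected.\<close>
  define s where "s = n + N"
  define q where "q = max q1 s"
  obtain \<psi> :: "'a multiset \<Rightarrow> 'a \<Rightarrow> complex"
    where \<psi>: "\<And>\<beta>. multi_index \<beta> \<Longrightarrow> size \<beta> \<le> q1 \<Longrightarrow> \<psi> \<beta> \<in> test_fun"
    "\<And>\<beta> \<gamma>. multi_index \<beta> \<Longrightarrow> size \<beta> \<le> q1 \<Longrightarrow> multi_index \<gamma> \<Longrightarrow> size \<gamma> \<le> q1 \<Longrightarrow>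
      moment \<beta> (\<psi> \<gamma>) = (if \<beta> = \<gamma> then 1 else 0)"
    by (rule dual_test_functions[of q1]) blast
  define B where "B = {\<beta>::'a multiset. multi_index \<beta> \<and> 1 \<le> size \<beta> \<and> size \<beta> \<le> q1}"
  have fB: "finite B" unfolding B_def by (rule finite_subset[OF _ finite_multi_indices[of q1]]) auto
  have \<psi>t: "\<psi> \<beta> \<in> test_fun" if "\<beta> \<in> B" for \<beta> using \<psi>(1) that by (simp add: B_def)
  have \<psi>0: "moment {#} (\<psi> \<beta>) = 0" if "\<beta> \<in> B" for \<beta>
    using \<psi>(2)[of "{#}" \<beta>] that by (auto simp: B_def multi_index_def)
  show ?thesis
  proof (intro exI[of _ q] conjI allI impI)
    show "q \<ge> 1" using q1(1) by (simp add: q_def)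
    fix \<phi> assume ty: "typeA \<Omega> K q \<phi>"
    then have \<phi>: "\<phi> \<in> Cb \<Omega> 0" by (simp add: typeA_def)
    define m where "m \<beta> \<epsilon> x = moment \<beta> (\<phi> \<epsilon> x)" for \<beta> \<epsilon> x
    have msf: "scalar_family \<Omega> (m \<beta>)" for \<beta> unfolding m_def[abs_def] by (rule scalar_family_moment[OF \<Omega> \<phi>])
    \<comment> \<open>The fully corrected family. It lies in \<open>Cb \<Omega> q1\<close>, where
      negligibility applies.\<close>
    define \<phi>' where "\<phi>' = (\<lambda>\<epsilon> x \<xi>. \<phi> \<epsilon> x \<xi> + (\<Sum>\<beta>\<in>B. (-1 * m \<beta> \<epsilon> x) * \<psi> \<beta> \<xi>))"
    have "\<phi>' \<in> Cb \<Omega> 0" unfolding \<phi>'_def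
      by (rule Cb_perturb_sum[OF \<Omega> \<phi> fB scalar_family_cmult[OF \<Omega> msf] \<psi>t \<psi>0])
    then have "\<phi>' \<in> Cb \<Omega> q1"
    proof (rule Cb_improve)
      fix \<epsilon> :: real and x assume "\<epsilon> \<in> {0<..1}" "x \<in> \<Omega>"
      then show "\<phi>' \<epsilon> x \<in> A q1" unfolding \<phi>'_def m_def by (intro moment_correction \<psi> B_def Cb_A[OF \<phi>])
    qed
    from q1(2)[OF this] obtain C1 where C1:
      "\<forall>\<^sub>F \<epsilon> in at_right 0. \<forall>x\<in>L. norm (R (Seps \<epsilon> (\<phi>' \<epsilon> x)) x) \<le> C1 * \<epsilon> ^ n"
      unfolding Rphi_empty by blast
    have "\<exists>D. \<forall>\<^sub>F \<epsilon> in at_right 0. \<forall>x\<in>reach K (\<epsilon> ^ \<rho>) j. norm (Dlist [] (m \<beta> \<epsilon>) x) \<le> D * \<epsilon> ^ s"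
      if \<beta>: "\<beta> \<in> B" for \<beta>
    proof (rule small_on_reach[OF \<Omega> K \<rho> msf])
      show "\<exists>C. \<forall>\<^sub>F \<epsilon> in at_right 0. \<forall>x\<in>K. norm (Dlist ds (m \<beta> \<epsilon>) x) \<le> C * \<epsilon> ^ q" if "set ds \<subseteq> Basis" for ds
        unfolding m_def[abs_def]
        by (rule typeA_moment_small[OF \<Omega> K(2) ty _ _ _ that]) (use \<beta> in \<open>auto simp: B_def q_def\<close>)
      show "s \<le> q" by (simp add: q_def)
    qed simp
    then have "\<forall>\<beta>\<in>B. \<exists>D. \<forall>\<^sub>F \<epsilon> in at_right 0. \<forall>x\<in>reach K (\<epsilon> ^ \<rho>) j. norm (m \<beta> \<epsilon> x) \<le> D * \<epsilon> ^ s"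
      unfolding Dlist.simps by (rule ballI)
    from bchoice[OF this] obtain D0
      where D0: "\<forall>\<beta>\<in>B. \<forall>\<^sub>F \<epsilon> in at_right 0. \<forall>x\<in>reach K (\<epsilon> ^ \<rho>) j. norm (m \<beta> \<epsilon> x) \<le> D0 \<beta> * \<epsilon> ^ s" ..
    have D0B: "\<forall>\<^sub>F \<epsilon> in at_right 0. \<forall>\<beta>\<in>B. \<forall>x\<in>reach K (\<epsilon> ^ \<rho>) j. norm (m \<beta> \<epsilon> x) \<le> D0 \<beta> * \<epsilon> ^ s"
      by (rule eventually_ball_finite[OF fB D0])
    show "\<exists>C. \<forall>\<^sub>F \<epsilon> in at_right 0. \<forall>x\<in>reach K (\<epsilon> ^ \<rho>) j. norm (R (Seps \<epsilon> (\<phi> \<epsilon> x)) x) \<le> C * \<epsilon> ^ n"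
    proof (rule ccontr)
      assume no: "\<not> ?thesis"
      \<comment> \<open>What is needed at a single scale: segments of length
        \<open>\<epsilon> ^ s\<close> that start in \<open>reach\<close> stay in \<open>L\<close>,
        and the moments obey their bounds.\<close>
      define G where "G \<epsilon> \<longleftrightarrow> 0 < \<epsilon> \<and> \<epsilon> < 1 \<and> \<epsilon> ^ s \<le> e / 2 \<and> reach K (\<epsilon> ^ \<rho>) j \<subseteq> (\<Union>k\<in>K. cball k (e / 2)) \<and>
        (\<forall>\<beta>\<in>B. \<forall>x\<in>reach K (\<epsilon> ^ \<rho>) j. norm (m \<beta> \<epsilon> x) \<le> D0 \<beta> * \<epsilon> ^ s)" for \<epsilon>
      have "e / 2 > 0" using e(1) by simp
      have G: "\<forall>\<^sub>F \<epsilon> in at_right 0. G \<epsilon>"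
        using D0B reach_small[OF \<open>e / 2 > 0\<close> \<rho>, of K j] eventually_small[OF \<open>e / 2 > 0\<close>]
      proof eventually_elim
        case (elim \<epsilon>)
        have "s \<ge> 1" using n by (simp add: s_def)
        then have "\<epsilon> ^ s \<le> \<epsilon>" using elim power_decreasing[of 1 s \<epsilon>] by simp
        then show ?case unfolding G_def using elim by auto
      qed
      define P where "P i \<epsilon> x \<longleftrightarrow> G \<epsilon> \<and> x \<in> reach K (\<epsilon> ^ \<rho>) j \<and> norm (R (Seps \<epsilon> (\<phi> \<epsilon> x)) x) > real i * \<epsilon> ^ n" for i \<epsilon> x
      have "\<exists>\<epsilon> x. 0 < \<epsilon> \<and> \<epsilon> < \<eta> \<and> P i \<epsilon> x" if \<eta>: "\<eta> > 0" for i \<eta>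
      proof (rule ccontr)
        assume neg: "\<nexists>\<epsilon> x. 0 < \<epsilon> \<and> \<epsilon> < \<eta> \<and> P i \<epsilon> x"
        have "\<forall>\<^sub>F \<epsilon> in at_right 0. \<forall>x\<in>reach K (\<epsilon> ^ \<rho>) j. norm (R (Seps \<epsilon> (\<phi> \<epsilon> x)) x) \<le> real i * \<epsilon> ^ n"
          using G eventually_small[OF \<eta>]
        proof eventually_elim
          case (elim \<epsilon>)
          then show ?case using neg unfolding P_def by (meson not_less)
        qed
        then show False using no by blast
      qed
      then have "\<exists>E X. \<forall>i. 0 < E i \<and> inverse (E (Suc i)) \<ge> inverse (E i) + 2 \<and> P i (E i) (X i)"
        by (rule frequently_bad_sequence[where P = P])
      then obtain E X where "\<forall>i. 0 < E i \<and> inverse (E (Suc i)) \<ge> inverse (E i) + 2 \<and> P i (E i) (X i)"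
        by (elim exE)
      then have EX: "\<And>i. 0 < E i" "\<And>i. inverse (E (Suc i)) \<ge> inverse (E i) + 2" "\<And>i. P i (E i) (X i)"
        by simp_all
      define u where "u i = inverse (E i)" for i
      define \<delta> where "\<delta> i = E i ^ s" for i
      have u: "u 0 \<ge> 0" "\<And>i. u (Suc i) \<ge> u i + 2" using EX(1)[of 0] EX(2) by (simp_all add: u_def)
      have E1: "E i \<in> {0<..1}" "E i < 1" and \<delta>: "0 < \<delta> i" "\<delta> i \<le> 1" "\<delta> i \<le> e / 2" for i
        using EX(3)[of i] EX(1)[of i] unfolding P_def G_def \<delta>_def by (auto simp: power_le_one)
      have XK: "X i \<in> (\<Union>k\<in>K. cball k (e / 2))" for i
        using EX(3)[of i] unfolding P_def G_def by blast
      have mX: "norm (m \<beta> (E i) (X i)) \<le> \<bar>D0 \<beta>\<bar> * \<delta> i" if "\<beta> \<in> B" for \<beta> i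
      proof -
        have "norm (m \<beta> (E i) (X i)) \<le> D0 \<beta> * \<delta> i"
          using EX(3)[of i] that unfolding P_def G_def \<delta>_def by blast
        also have "\<dots> \<le> \<bar>D0 \<beta>\<bar> * \<delta> i" using \<delta>(1)[of i] by (intro mult_right_mono) auto
        finally show ?thesis .
      qed
      have XL: "X i + t *\<^sub>R b \<in> L" if "\<bar>t\<bar> \<le> e / 2" for i t
      proof -
        obtain k where k: "k \<in> K" "dist k (X i) \<le> e / 2" using XK[of i] by auto
        have "dist k (X i + t *\<^sub>R b) \<le> dist k (X i) + \<bar>t\<bar>"
          using dist_triangle[of k "X i + t *\<^sub>R b" "X i"] nb by (simp add: dist_norm)
        then have "X i + t *\<^sub>R b \<in> cball k e" using k(2) that by simp
        then show ?thesis unfolding L_def using k(1) by blast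
      qed
      obtain BL where BL: "\<And>x. x \<in> L \<Longrightarrow> norm x \<le> BL"
        using compact_imp_bounded[OF L(1)] unfolding bounded_iff by blast
      have Xb: "\<bar>X i \<bullet> b\<bar> \<le> BL" for i
        using BL[OF XL[of 0 i]] e(1) Basis_le_norm[OF b, of "X i"] by simp
      define d where "d \<beta> i = - m \<beta> (E i) (X i) / complex_of_real (\<delta> i)" for \<beta> i
      \<comment> \<open>The value of the affine function where the coordinate along \<open>b\<close>
        is 0, so its bound uses that the points \<open>X i\<close> lie in the bounded set
        \<open>L\<close>.\<close>
      define a where "a \<beta> i = m \<beta> (E i) (X i) - d \<beta> i * complex_of_real (X i \<bullet> b)" for \<beta> i
      have db: "norm (d \<beta> i) \<le> \<bar>D0 \<beta>\<bar>" if "\<beta> \<in> B" for \<beta> i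
        using mX[OF that, of i] \<delta>(1)[of i] by (simp add: d_def norm_divide pos_divide_le_eq)
      have ab: "norm (a \<beta> i) \<le> \<bar>D0 \<beta>\<bar> + \<bar>D0 \<beta>\<bar> * BL" if "\<beta> \<in> B" for \<beta> i
      proof -
        have "norm (m \<beta> (E i) (X i)) \<le> \<bar>D0 \<beta>\<bar> * 1"
          using mX[OF that, of i] mult_left_mono[OF \<delta>(2)[of i], of "\<bar>D0 \<beta>\<bar>"] by simp
        moreover have "norm (d \<beta> i * complex_of_real (X i \<bullet> b)) \<le> \<bar>D0 \<beta>\<bar> * BL"
          unfolding norm_mult norm_of_real by (intro mult_mono db[OF that] Xb) auto
        ultimately show ?thesis
          unfolding a_def using norm_triangle_ineq4[of "m \<beta> (E i) (X i)" "d \<beta> i * complex_of_real (X i \<bullet> b)"] by simp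
      qed
      have "\<exists>f. smooth_curve f \<and> (\<forall>i. f (u i) = a \<beta> i) \<and> (\<forall>s. norm (f s) \<le> \<bar>D0 \<beta>\<bar> + \<bar>D0 \<beta>\<bar> * BL)" if "\<beta> \<in> B" for \<beta>
        by (rule smooth_interpolation[where a = "a \<beta>", OF u ab[OF that]]) blast
      then have "\<forall>\<beta>\<in>B. \<exists>f. smooth_curve f \<and> (\<forall>i. f (u i) = a \<beta> i) \<and> (\<forall>s. norm (f s) \<le> \<bar>D0 \<beta>\<bar> + \<bar>D0 \<beta>\<bar> * BL)"
        by (rule ballI)
      from bchoice[OF this] obtain fa where "\<forall>\<beta>\<in>B. smooth_curve (fa \<beta>) \<and> (\<forall>i. fa \<beta> (u i) = a \<beta> i) \<and>
        (\<forall>s. norm (fa \<beta> s) \<le> \<bar>D0 \<beta>\<bar> + \<bar>D0 \<beta>\<bar> * BL)" ..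
      then have fa: "\<And>\<beta>. \<beta> \<in> B \<Longrightarrow> smooth_curve (fa \<beta>)" "\<And>\<beta> i. \<beta> \<in> B \<Longrightarrow> fa \<beta> (u i) = a \<beta> i"
        "\<And>\<beta> s. \<beta> \<in> B \<Longrightarrow> norm (fa \<beta> s) \<le> \<bar>D0 \<beta>\<bar> + \<bar>D0 \<beta>\<bar> * BL" by blast+
      have "\<exists>f. smooth_curve f \<and> (\<forall>i. f (u i) = d \<beta> i) \<and> (\<forall>s. norm (f s) \<le> \<bar>D0 \<beta>\<bar>)" if "\<beta> \<in> B" for \<beta>
        by (rule smooth_interpolation[where a = "d \<beta>", OF u db[OF that]]) blast
      then have "\<forall>\<beta>\<in>B. \<exists>f. smooth_curve f \<and> (\<forall>i. f (u i) = d \<beta> i) \<and> (\<forall>s. norm (f s) \<le> \<bar>D0 \<beta>\<bar>)"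
        by (rule ballI)
      from bchoice[OF this] obtain fd where "\<forall>\<beta>\<in>B. smooth_curve (fd \<beta>) \<and> (\<forall>i. fd \<beta> (u i) = d \<beta> i) \<and>
        (\<forall>s. norm (fd \<beta> s) \<le> \<bar>D0 \<beta>\<bar>)" ..
      then have fd: "\<And>\<beta>. \<beta> \<in> B \<Longrightarrow> smooth_curve (fd \<beta>)" "\<And>\<beta> i. \<beta> \<in> B \<Longrightarrow> fd \<beta> (u i) = d \<beta> i"
        "\<And>\<beta> s. \<beta> \<in> B \<Longrightarrow> norm (fd \<beta> s) \<le> \<bar>D0 \<beta>\<bar>" by blast+
      \<comment> \<open>Removes the moment of \<open>\<phi>\<close> and puts the interpolated affine
        function in its place; the factor 1 fits the shape of
        \<open>scalar_family_separated\<close>.\<close>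
      define \<mu> where "\<mu> \<beta> \<epsilon> x = -1 * m \<beta> \<epsilon> x + (fa \<beta> (inverse \<epsilon>) * 1 + fd \<beta> (inverse \<epsilon>) * complex_of_real (x \<bullet> b))" for \<beta> \<epsilon> x
      have cs1: "curve_smooth \<Omega> (\<lambda>x. 1::complex)" by (simp add: curve_smooth_def)
      have csb: "curve_smooth \<Omega> (\<lambda>x. complex_of_real (x \<bullet> b))"
        unfolding curve_smooth_def
      proof (intro allI impI)
        fix c :: "real \<Rightarrow> 'a" assume "smooth_curve c \<and> (\<forall>t. c t \<in> \<Omega>)"
        then show "smooth_curve (\<lambda>t. complex_of_real (c t \<bullet> b))"
          by (intro smooth_curve_linear[OF bounded_linear_of_real] smooth_curve_linear[OF bounded_linear_inner_left]) simp
      qed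
      have \<mu>sf: "scalar_family \<Omega> (\<mu> \<beta>)" if "\<beta> \<in> B" for \<beta>
        unfolding \<mu>_def[abs_def]
        by (rule scalar_family_add[OF \<Omega> scalar_family_cmult[OF \<Omega> msf] scalar_family_add[OF \<Omega>
              scalar_family_separated[OF \<Omega> cs1 fa(1)[OF that] fa(3)[OF that]]
              scalar_family_separated[OF \<Omega> csb fd(1)[OF that] fd(3)[OF that]]]])
      define \<phi>h where "\<phi>h = (\<lambda>\<epsilon> x \<xi>. \<phi> \<epsilon> x \<xi> + (\<Sum>\<beta>\<in>B. \<mu> \<beta> \<epsilon> x * \<psi> \<beta> \<xi>))"
      have \<phi>h: "\<phi>h \<in> Cb \<Omega> 0" unfolding \<phi>h_def by (rule Cb_perturb_sum[OF \<Omega> \<phi> fB \<mu>sf \<psi>t \<psi>0])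
      have h0: "\<phi>h (E i) (X i) = \<phi> (E i) (X i)" for i
      proof -
        have "\<mu> \<beta> (E i) (X i) = 0" if "\<beta> \<in> B" for \<beta>
          using fa(2)[OF that, of i] fd(2)[OF that, of i] by (simp add: \<mu>_def a_def u_def)
        then show ?thesis by (simp add: \<phi>h_def)
      qed
      have h1: "\<phi>h (E i) (X i + \<delta> i *\<^sub>R b) = \<phi>' (E i) (X i + \<delta> i *\<^sub>R b)" for i
      proof -
        have "\<mu> \<beta> (E i) (X i + \<delta> i *\<^sub>R b) = -1 * m \<beta> (E i) (X i + \<delta> i *\<^sub>R b)" if "\<beta> \<in> B" for \<beta>
        proof -
          have "d \<beta> i * complex_of_real (\<delta> i) = - m \<beta> (E i) (X i)" using \<delta>(1)[of i] by (simp add: d_def)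
          then have "a \<beta> i + d \<beta> i * complex_of_real ((X i + \<delta> i *\<^sub>R b) \<bullet> b) = 0"
            using b by (simp add: a_def inner_add_left distrib_left)
          then show ?thesis using fa(2)[OF that, of i] fd(2)[OF that, of i] by (simp add: \<mu>_def u_def)
        qed
        then show ?thesis unfolding \<phi>h_def \<phi>'_def by (intro ext arg_cong2[where f = "(+)"] refl sum.cong) simp_all
      qed
      obtain C2 where C2: "\<forall>\<^sub>F \<epsilon> in at_right 0. \<forall>x\<in>L. norm (Rphi R (mset [b]) \<phi>h \<epsilon> x) \<le> C2 * inverse \<epsilon> ^ N"
        using N[OF \<phi>h] by blast
      obtain W where W: "open W" "L \<subseteq> W" "\<forall>\<^sub>F \<epsilon> in at_right 0. ray_smooth W (\<lambda>y. R (Seps \<epsilon> (\<phi>h \<epsilon> y)) y)"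
        using Rphi_ray_smooth[OF \<Omega> RE \<phi>h L] by blast
      from eventually_conj[OF C1 eventually_conj[OF C2 W(3)]]
      obtain \<eta> where \<eta>: "\<eta> > 0" and ev: "\<And>\<epsilon>. 0 < \<epsilon> \<Longrightarrow> \<epsilon> < \<eta> \<Longrightarrow>
          (\<forall>x\<in>L. norm (R (Seps \<epsilon> (\<phi>' \<epsilon> x)) x) \<le> C1 * \<epsilon> ^ n) \<and>
          (\<forall>x\<in>L. norm (Rphi R (mset [b]) \<phi>h \<epsilon> x) \<le> C2 * inverse \<epsilon> ^ N) \<and> ray_smooth W (\<lambda>y. R (Seps \<epsilon> (\<phi>h \<epsilon> y)) y)"
        unfolding eventually_at_right_field by blast
      have ui: "u i \<ge> real i" for i
      proof (induction i)
        case (Suc i) then show ?case using u(2)[of i] by simp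
      qed (use u in simp)
      \<comment> \<open>As \<open>u i \<ge> real i\<close>, the first bound brings
        \<open>E i\<close> below \<open>\<eta>\<close>; the second contradicts the failure with
        constant \<open>i\<close> that \<open>P\<close> records.\<close>
      obtain i where i: "real i > max (inverse \<eta>) (C1 + C2)" using reals_Archimedean2 by blast
      define \<epsilon> where "\<epsilon> = E i"
      have \<epsilon>0: "0 < \<epsilon>" "\<epsilon> < 1" using EX(1)[of i] E1(2)[of i] by (simp_all add: \<epsilon>_def)
      have "inverse \<eta> < inverse \<epsilon>" using ui[of i] i by (simp add: u_def \<epsilon>_def)
      then have \<epsilon>\<eta>: "\<epsilon> < \<eta>" using \<epsilon>0(1) \<eta> by (simp add: inverse_less_iff_less)
      note ev' = ev[OF \<epsilon>0(1) \<epsilon>\<eta>]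
      define F where "F = (\<lambda>y. R (Seps \<epsilon> (\<phi>h \<epsilon> y)) y)"
      have F: "ray_smooth W F" using ev' by (simp add: F_def)
      have \<delta>e: "0 \<le> \<delta> i" "\<delta> i \<le> e / 2" using \<delta>[of i] by auto
      have "norm (F (X i + \<delta> i *\<^sub>R b) - F (X i)) \<le> (C2 * inverse \<epsilon> ^ N) * \<delta> i"
      proof (rule along_bound[OF \<delta>e(1) ray_smooth_diff_along_0[OF F]])
        fix t assume "0 \<le> t" "t \<le> \<delta> i"
        then have t: "X i + t *\<^sub>R b \<in> L" using \<delta>e by (intro XL) auto
        then show tW: "X i + t *\<^sub>R b \<in> W" using W(2) by blast
        have "pdiff b F (X i + t *\<^sub>R b) = Rphi R (mset [b]) \<phi>h \<epsilon> (X i + t *\<^sub>R b)"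
          using Rphi_eq_Dlist[where R = R and \<phi> = \<phi>h and \<epsilon> = \<epsilon>, OF W(1) F[unfolded F_def] tW, of "[b]"] by (simp add: F_def)
        then show "norm (pdiff b F (X i + t *\<^sub>R b)) \<le> C2 * inverse \<epsilon> ^ N" using ev' t by simp
      qed
      also have "(C2 * inverse \<epsilon> ^ N) * \<delta> i = C2 * \<epsilon> ^ n"
      proof -
        have "inverse \<epsilon> ^ N * \<epsilon> ^ N = 1" using \<epsilon>0(1) by (simp flip: power_mult_distrib)
        moreover have "\<delta> i = \<epsilon> ^ N * \<epsilon> ^ n" by (simp add: \<delta>_def \<epsilon>_def s_def power_add mult.commute)
        ultimately show ?thesis by (simp add: mult.assoc[symmetric])
      qed
      finally have 1: "norm (F (X i + \<delta> i *\<^sub>R b) - F (X i)) \<le> C2 * \<epsilon> ^ n" .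
      have "X i + \<delta> i *\<^sub>R b \<in> L" using \<delta>e by (intro XL) auto
      then have 2: "norm (F (X i + \<delta> i *\<^sub>R b)) \<le> C1 * \<epsilon> ^ n"
        using ev' h1[of i] by (simp add: F_def \<epsilon>_def)
      have "norm (F (X i)) \<le> norm (F (X i + \<delta> i *\<^sub>R b)) + norm (F (X i + \<delta> i *\<^sub>R b) - F (X i))"
        using norm_triangle_ineq4[of "F (X i + \<delta> i *\<^sub>R b)" "F (X i + \<delta> i *\<^sub>R b) - F (X i)"] by simp
      then have "norm (F (X i)) \<le> (C1 + C2) * \<epsilon> ^ n" using 1 2 by (simp add: distrib_right)
      also have "\<dots> \<le> real i * \<epsilon> ^ n" using i \<epsilon>0(1) by (intro mult_right_mono) auto
      finally have "norm (R (Seps \<epsilon> (\<phi> \<epsilon> (X i))) (X i)) \<le> real i * \<epsilon> ^ n"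
        using h0[of i] by (simp add: F_def \<epsilon>_def)
      then show False using EX(3)[of i] by (simp add: P_def \<epsilon>_def)
    qed
  qed
qed

text \<open>A derivative is estimated by a difference quotient with step \<open>\<epsilon> ^ \<rho>'\<close>, at the price of one more
  step in \<open>reach\<close>; moderateness bounds the second derivative.\<close>

lemma negligible_Dlist_on_reach:
  fixes \<Omega> :: "'a::euclidean_space set"
  assumes \<Omega>: "open \<Omega>" and R: "R \<in> negligible \<Omega>" and K: "compact K" "K \<subseteq> \<Omega>"
    and "n \<ge> 1" "\<rho> \<ge> 1" "set ds \<subseteq> Basis"
  shows "\<exists>q\<ge>1. \<forall>\<phi>. typeA \<Omega> K q \<phi> \<longrightarrow>
    (\<exists>C. \<forall>\<^sub>F \<epsilon> in at_right 0. \<forall>x\<in>reach K (\<epsilon> ^ \<rho>) j. norm (Dlist ds (\<lambda>y. R (Seps \<epsilon> (\<phi> \<epsilon> y)) y) x) \<le> C * \<epsilon> ^ n)"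
  using assms(5-7)
proof (induction ds arbitrary: n j)
  case Nil
  then show ?case using negligible_on_reach[OF \<Omega> R K] by simp
next
  case (Cons b ds)
  have Rm: "R \<in> moderate \<Omega>" and RE: "R \<in> Ed \<Omega>" using R by (auto simp: negligible_def moderate_def)
  have b: "b \<in> Basis" "norm b = 1" using Cons.prems by auto
  obtain e where e: "e > 0" "(\<Union>k\<in>K. cball k e) \<subseteq> \<Omega>"
    using compact_subset_open_imp_cball_epsilon_subset[OF K(1) \<Omega> K(2)] by blast
  define L where "L = (\<Union>k\<in>K. cball k e)"
  have L: "compact L" "L \<subseteq> \<Omega>" unfolding L_def using compact_cball_neighbourhood[OF K(1)] e(2) by auto
  have mi: "multi_index (mset (b # b # ds))" unfolding multi_index_mset using Cons.prems(3) by simp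
  obtain N where N: "\<And>\<phi>. \<phi> \<in> Cb \<Omega> 0 \<Longrightarrow> \<exists>C. \<forall>\<^sub>F \<epsilon> in at_right 0. \<forall>x\<in>L.
      norm (Rphi R (mset (b # b # ds)) \<phi> \<epsilon> x) \<le> C * inverse \<epsilon> ^ N"
    using moderateD[OF Rm L mi] by (elim exE) (blast dest: bspec)
  \<comment> \<open>The step \<open>\<epsilon> ^ \<rho>'\<close> must not exceed one step of
    \<open>reach\<close>, hence \<open>\<rho>\<close>, and must absorb the loss
    \<open>inverse \<epsilon> ^ N\<close> of the second derivative, hence \<open>n + N\<close>.
    Division by it costs \<open>\<rho>'\<close> powers, so the induction hypothesis is taken with
    exponent \<open>n + \<rho>'\<close>.\<close>
  define \<rho>' where "\<rho>' = max \<rho> (n + N)"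
  have dsB: "set ds \<subseteq> Basis" using Cons.prems(3) by simp
  have "n + \<rho>' \<ge> 1" using Cons.prems(1) by simp
  from Cons.IH[OF this Cons.prems(2) dsB, of "Suc j"] obtain q where q: "q \<ge> 1" and IH: "\<And>\<phi>. typeA \<Omega> K q \<phi> \<Longrightarrow>
    \<exists>C. \<forall>\<^sub>F \<epsilon> in at_right 0. \<forall>x\<in>reach K (\<epsilon> ^ \<rho>) (Suc j). norm (Dlist ds (\<lambda>y. R (Seps \<epsilon> (\<phi> \<epsilon> y)) y) x) \<le> C * \<epsilon> ^ (n + \<rho>')"
    by blast
  show ?case
  proof (intro exI[of _ q] conjI allI impI q)
    fix \<phi> assume ty: "typeA \<Omega> K q \<phi>"
    then have \<phi>: "\<phi> \<in> Cb \<Omega> 0" by (simp add: typeA_def)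
    obtain C1 where C1: "\<forall>\<^sub>F \<epsilon> in at_right 0. \<forall>x\<in>reach K (\<epsilon> ^ \<rho>) (Suc j).
        norm (Dlist ds (\<lambda>y. R (Seps \<epsilon> (\<phi> \<epsilon> y)) y) x) \<le> C1 * \<epsilon> ^ (n + \<rho>')" using IH[OF ty] by blast
    obtain C2 where C2: "\<forall>\<^sub>F \<epsilon> in at_right 0. \<forall>x\<in>L. norm (Rphi R (mset (b # b # ds)) \<phi> \<epsilon> x) \<le> C2 * inverse \<epsilon> ^ N"
      using N[OF \<phi>] by blast
    obtain W where W: "open W" "L \<subseteq> W" "\<forall>\<^sub>F \<epsilon> in at_right 0. ray_smooth W (\<lambda>y. R (Seps \<epsilon> (\<phi> \<epsilon> y)) y)"
      using Rphi_ray_smooth[OF \<Omega> RE \<phi> L] by blast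
    have "\<forall>\<^sub>F \<epsilon> in at_right 0. \<forall>x\<in>reach K (\<epsilon> ^ \<rho>) j.
        norm (Dlist (b # ds) (\<lambda>y. R (Seps \<epsilon> (\<phi> \<epsilon> y)) y) x) \<le> (2 * \<bar>C1\<bar> + \<bar>C2\<bar>) * \<epsilon> ^ n"
      using C1 C2 W(3) reach_small[OF e(1) Cons.prems(2), of K "Suc j"]
    proof eventually_elim
      case (elim \<epsilon>)
      define h where "h = \<epsilon> ^ \<rho>'"
      have \<epsilon>: "0 < \<epsilon>" "\<epsilon> < 1" using elim by auto
      have h: "0 < h" "h \<le> \<epsilon> ^ \<rho>" "h \<le> \<epsilon> ^ (n + N)"
        using \<epsilon> by (auto simp: h_def \<rho>'_def intro!: power_decreasing)
      define g where "g = Dlist ds (\<lambda>y. R (Seps \<epsilon> (\<phi> \<epsilon> y)) y)"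
      have g: "ray_smooth W g" "ray_smooth W (pdiff b g)"
        using ray_smooth_Dlist[OF W(1) elim(3)] ray_smooth_Dlist[OF W(1) elim(3), of "b # ds"]
        by (simp_all add: g_def)
      show ?case
      proof
        fix x assume x: "x \<in> reach K (\<epsilon> ^ \<rho>) j"
        have xs: "x + s *\<^sub>R b \<in> reach K (\<epsilon> ^ \<rho>) (Suc j)" if "\<bar>s\<bar> \<le> h" for s
          using that h(2) by (intro reach_SucI x b(1)) simp
        have xL: "x + s *\<^sub>R b \<in> L" if "\<bar>s\<bar> \<le> h" for s
          using xs[OF that] elim(4) unfolding L_def by blast
        have "norm (g (x + h *\<^sub>R b) - g x - h *\<^sub>R pdiff b g x) \<le> (\<bar>C2\<bar> * inverse \<epsilon> ^ N) * h\<^sup>2"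
        proof (rule along_taylor[OF ray_smooth_diff_along_0[OF g(1)] ray_smooth_diff_along_0[OF g(2)]])
          fix s assume "\<bar>s\<bar> \<le> \<bar>h\<bar>"
          then have s: "x + s *\<^sub>R b \<in> L" using h(1) by (intro xL) simp
          then show sW: "x + s *\<^sub>R b \<in> W" using W(2) by blast
          have "pdiff b (pdiff b g) (x + s *\<^sub>R b) = Rphi R (mset (b # b # ds)) \<phi> \<epsilon> (x + s *\<^sub>R b)"
            using Rphi_eq_Dlist[where R = R and \<phi> = \<phi> and \<epsilon> = \<epsilon>, OF W(1) elim(3) sW, of "b # b # ds"] by (simp add: g_def)
          then have "norm (pdiff b (pdiff b g) (x + s *\<^sub>R b)) \<le> C2 * inverse \<epsilon> ^ N" using elim(2) s by simp
          also have "\<dots> \<le> \<bar>C2\<bar> * inverse \<epsilon> ^ N" using \<epsilon> by (intro mult_right_mono) auto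
          finally show "norm (pdiff b (pdiff b g) (x + s *\<^sub>R b)) \<le> \<bar>C2\<bar> * inverse \<epsilon> ^ N" .
        qed
        also have "(\<bar>C2\<bar> * inverse \<epsilon> ^ N) * h\<^sup>2 \<le> h * (\<bar>C2\<bar> * \<epsilon> ^ n)"
        proof -
          have "inverse \<epsilon> ^ N * h \<le> inverse \<epsilon> ^ N * \<epsilon> ^ (n + N)" using h(3) \<epsilon> by (intro mult_left_mono) auto
          also have "\<dots> = (inverse \<epsilon> ^ N * \<epsilon> ^ N) * \<epsilon> ^ n" by (simp add: power_add mult_ac)
          also have "inverse \<epsilon> ^ N * \<epsilon> ^ N = 1" using \<epsilon> by (simp flip: power_mult_distrib)
          finally have "\<bar>C2\<bar> * (inverse \<epsilon> ^ N * h) \<le> \<bar>C2\<bar> * \<epsilon> ^ n" by (intro mult_left_mono) auto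
          then have "h * (\<bar>C2\<bar> * (inverse \<epsilon> ^ N * h)) \<le> h * (\<bar>C2\<bar> * \<epsilon> ^ n)"
            by (rule mult_left_mono) (use h(1) in simp)
          then show ?thesis by (simp add: power2_eq_square mult_ac)
        qed
        finally have 1: "norm (g (x + h *\<^sub>R b) - g x - h *\<^sub>R pdiff b g x) \<le> h * (\<bar>C2\<bar> * \<epsilon> ^ n)" .
        have gb: "norm (g (x + s *\<^sub>R b)) \<le> h * (\<bar>C1\<bar> * \<epsilon> ^ n)" if "\<bar>s\<bar> \<le> h" for s
        proof -
          have "norm (g (x + s *\<^sub>R b)) \<le> C1 * \<epsilon> ^ (n + \<rho>')" using elim(1) xs[OF that] unfolding g_def by blast
          also have "\<dots> \<le> \<bar>C1\<bar> * \<epsilon> ^ (n + \<rho>')" using \<epsilon> by (intro mult_right_mono) auto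
          finally show ?thesis by (simp add: h_def power_add mult_ac)
        qed
        have 2: "norm (g (x + h *\<^sub>R b)) \<le> h * (\<bar>C1\<bar> * \<epsilon> ^ n)" using h(1) by (intro gb) simp
        have 3: "norm (g x) \<le> h * (\<bar>C1\<bar> * \<epsilon> ^ n)" using gb[of 0] h(1) by simp
        have "h *\<^sub>R pdiff b g x = (g (x + h *\<^sub>R b) - g x) - (g (x + h *\<^sub>R b) - g x - h *\<^sub>R pdiff b g x)" by simp
        then have "norm (h *\<^sub>R pdiff b g x) \<le> norm (g (x + h *\<^sub>R b) - g x) + norm (g (x + h *\<^sub>R b) - g x - h *\<^sub>R pdiff b g x)"
          by (metis norm_triangle_ineq4)
        also have "\<dots> \<le> (h * (\<bar>C1\<bar> * \<epsilon> ^ n) + h * (\<bar>C1\<bar> * \<epsilon> ^ n)) + h * (\<bar>C2\<bar> * \<epsilon> ^ n)"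
          by (intro add_mono order_trans[OF norm_triangle_ineq4] 1 2 3)
        also have "\<dots> = h * ((2 * \<bar>C1\<bar> + \<bar>C2\<bar>) * \<epsilon> ^ n)" by (simp add: algebra_simps)
        finally have "h * norm (pdiff b g x) \<le> h * ((2 * \<bar>C1\<bar> + \<bar>C2\<bar>) * \<epsilon> ^ n)" using h(1) by simp
        then have "norm (pdiff b g x) \<le> (2 * \<bar>C1\<bar> + \<bar>C2\<bar>) * \<epsilon> ^ n" using h(1) by (simp only: mult_le_cancel_left_pos)
        then show "norm (Dlist (b # ds) (\<lambda>y. R (Seps \<epsilon> (\<phi> \<epsilon> y)) y) x) \<le> (2 * \<bar>C1\<bar> + \<bar>C2\<bar>) * \<epsilon> ^ n"
          by (simp add: g_def)
      qed
    qed
    then show "\<exists>C. \<forall>\<^sub>F \<epsilon> in at_right 0. \<forall>x\<in>reach K (\<epsilon> ^ \<rho>) j.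
        norm (Dlist (b # ds) (\<lambda>y. R (Seps \<epsilon> (\<phi> \<epsilon> y)) y) x) \<le> C * \<epsilon> ^ n" by blast
  qed
qed

theorem mainTheorem3:
  fixes \<Omega> :: "'a::euclidean_space set"
    and R :: "('a \<Rightarrow> complex) \<Rightarrow> 'a \<Rightarrow> complex"
  assumes "open \<Omega>"
    and "R \<in> moderate \<Omega>"
  shows "R \<in> negligible \<Omega> \<longleftrightarrow>
    (\<forall>K \<alpha> (n::nat). compact K \<and> K \<subseteq> \<Omega> \<and> multi_index \<alpha> \<and> n \<ge> 1 \<longrightarrow>
      (\<exists>q::nat. q \<ge> 1 \<and> (\<forall>\<phi>. typeA \<Omega> K q \<phi> \<longrightarrow>
         (\<exists>C. \<forall>\<^sub>F \<epsilon> in at_right 0. \<forall>x\<in>K. norm (Rphi R \<alpha> \<phi> \<epsilon> x) \<le> C * \<epsilon> ^ n))))"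
proof
  assume neg: "R \<in> negligible \<Omega>"
  show "\<forall>K \<alpha> (n::nat). compact K \<and> K \<subseteq> \<Omega> \<and> multi_index \<alpha> \<and> n \<ge> 1 \<longrightarrow>
      (\<exists>q::nat. q \<ge> 1 \<and> (\<forall>\<phi>. typeA \<Omega> K q \<phi> \<longrightarrow>
         (\<exists>C. \<forall>\<^sub>F \<epsilon> in at_right 0. \<forall>x\<in>K. norm (Rphi R \<alpha> \<phi> \<epsilon> x) \<le> C * \<epsilon> ^ n)))"
  proof (intro allI impI)
    fix K and \<alpha> :: "'a multiset" and n :: nat
    assume A: "compact K \<and> K \<subseteq> \<Omega> \<and> multi_index \<alpha> \<and> n \<ge> 1"
    then have K: "compact K" "K \<subseteq> \<Omega>" and n: "n \<ge> 1" by auto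
    obtain ds where ds: "mset ds = \<alpha>" using ex_mset by blast
    then have dsB: "set ds \<subseteq> Basis" using A by (auto simp: multi_index_mset)
    \<comment> \<open>Level 0 of \<open>reach\<close> is \<open>K\<close> itself, whatever the step
      length.\<close>
    obtain q where q: "q \<ge> 1" "\<And>\<phi>. typeA \<Omega> K q \<phi> \<Longrightarrow>
      \<exists>C. \<forall>\<^sub>F \<epsilon> in at_right 0. \<forall>x\<in>reach K (\<epsilon> ^ 1) 0. norm (Dlist ds (\<lambda>y. R (Seps \<epsilon> (\<phi> \<epsilon> y)) y) x) \<le> C * \<epsilon> ^ n"
      using negligible_Dlist_on_reach[OF assms(1) neg K n order_refl dsB, of 0] by blast
    show "\<exists>q::nat. q \<ge> 1 \<and> (\<forall>\<phi>. typeA \<Omega> K q \<phi> \<longrightarrow>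
         (\<exists>C. \<forall>\<^sub>F \<epsilon> in at_right 0. \<forall>x\<in>K. norm (Rphi R \<alpha> \<phi> \<epsilon> x) \<le> C * \<epsilon> ^ n))"
    proof (intro exI[of _ q] conjI allI impI q(1))
      fix \<phi> assume ty: "typeA \<Omega> K q \<phi>"
      then have \<phi>: "\<phi> \<in> Cb \<Omega> 0" by (simp add: typeA_def)
      obtain C where C: "\<forall>\<^sub>F \<epsilon> in at_right 0. \<forall>x\<in>K. norm (Dlist ds (\<lambda>y. R (Seps \<epsilon> (\<phi> \<epsilon> y)) y) x) \<le> C * \<epsilon> ^ n"
        using q(2)[OF ty] unfolding reach.simps by blast
      have "R \<in> Ed \<Omega>" using assms(2) by (simp add: moderate_def)
      then obtain W where W: "open W" "K \<subseteq> W" "\<forall>\<^sub>F \<epsilon> in at_right 0. ray_smooth W (\<lambda>y. R (Seps \<epsilon> (\<phi> \<epsilon> y)) y)"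
        using Rphi_ray_smooth[OF assms(1) _ \<phi> K] by blast
      have "\<forall>\<^sub>F \<epsilon> in at_right 0. \<forall>x\<in>K. norm (Rphi R \<alpha> \<phi> \<epsilon> x) \<le> C * \<epsilon> ^ n"
        using C W(3)
      proof eventually_elim
        case (elim \<epsilon>)
        show ?case
        proof
          fix x assume x: "x \<in> K"
          then have "x \<in> W" using W(2) by blast
          from Rphi_eq_Dlist[where R = R and \<phi> = \<phi> and \<epsilon> = \<epsilon>, OF W(1) elim(2) this, of ds] show "norm (Rphi R \<alpha> \<phi> \<epsilon> x) \<le> C * \<epsilon> ^ n"
            using elim(1) x by (simp add: ds)
        qed
      qed
      then show "\<exists>C. \<forall>\<^sub>F \<epsilon> in at_right 0. \<forall>x\<in>K. norm (Rphi R \<alpha> \<phi> \<epsilon> x) \<le> C * \<epsilon> ^ n" by blast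
    qed
  qed
next
  assume cond: "\<forall>K \<alpha> (n::nat). compact K \<and> K \<subseteq> \<Omega> \<and> multi_index \<alpha> \<and> n \<ge> 1 \<longrightarrow>
      (\<exists>q::nat. q \<ge> 1 \<and> (\<forall>\<phi>. typeA \<Omega> K q \<phi> \<longrightarrow>
         (\<exists>C. \<forall>\<^sub>F \<epsilon> in at_right 0. \<forall>x\<in>K. norm (Rphi R \<alpha> \<phi> \<epsilon> x) \<le> C * \<epsilon> ^ n)))"
  show "R \<in> negligible \<Omega>"
    unfolding negligible_def
  proof (intro CollectI conjI assms(2) allI impI)
    fix K and \<alpha> :: "'a multiset" and n :: nat
    assume A: "compact K \<and> K \<subseteq> \<Omega> \<and> multi_index \<alpha> \<and> n \<ge> 1"
    from cond[rule_format, OF this] obtain q where q: "q \<ge> 1" "\<And>\<phi>. typeA \<Omega> K q \<phi> \<Longrightarrow>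
         \<exists>C. \<forall>\<^sub>F \<epsilon> in at_right 0. \<forall>x\<in>K. norm (Rphi R \<alpha> \<phi> \<epsilon> x) \<le> C * \<epsilon> ^ n" by blast
    have "K \<subseteq> \<Omega>" using A by blast
    show "\<exists>q::nat. q \<ge> 1 \<and> (\<forall>\<phi>\<in>Cb \<Omega> q. \<exists>C. \<forall>\<^sub>F \<epsilon> in at_right 0. \<forall>x\<in>K. norm (Rphi R \<alpha> \<phi> \<epsilon> x) \<le> C * \<epsilon> ^ n)"
      by (intro exI[of _ q] conjI q(1) ballI q(2) Cb_imp_typeA[OF assms(1) \<open>K \<subseteq> \<Omega>\<close>])
  qed
qed

end
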